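(* Let $p\ge1$ and $n\ge2$. For any nonnegative functions $f,g\in L^1(S^{n-1})$, $$\int_{S^{n-1}}\int_{S^{n-1}}[u,v]^pf(u)g(v)\,du\,dv\ \ge\ \frac{(n-1)\omega_{n-1}\omega_{n+p-2}}{n\,\omega_n\,\omega_{n+p-3}}\ \|f\|_{\frac{n}{n+p}}\,\|g\|_{\frac{n}{n+p}}.$$ When $n=2$ and $\|f\|_{\frac{2}{2+p}}\|g\|_{\frac{2}{2+p}}>0$, equality holds if and only if there exist $\phi\in\mathrm{SL}(2)$ and constants $d_1,d_2>0$ such that $f(u)=d_1|\phi u|^{-2-p}$ and $g(u)=d_2|\phi u|^{-2-p}$ for almost all $u\in S^1$. When $n\ge3$ and $\|f\|_{\frac{n}{n+p}}\|g\|_{\frac{n}{n+p}}>0$, equality holds if and only if there exist constants $d_3,d_4>0$ such that $f(u)=d_3$ and $g(u)=d_4$ for almost all $u\in S^{n-1}$.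
   Context: $du$ is the rotation-invariant probability measure on $S^{n-1}$, and $L^1(S^{n-1})$, "almost all" refer to it. For $u,v\in\mathbb{R}^n$, $[u,v]=\sqrt{|u|^2|v|^2-(u\cdot v)^2}$. For $q>0$ and nonnegative measurable $f$, $\|f\|_q=\big(\int_{S^{n-1}}f(u)^q\,du\big)^{1/q}$. $\omega_s=\pi^{s/2}/\Gamma(1+s/2)$ for $s\ge0$. *)

theory Defs
  imports "HOL-Analysis.Analysis"
begin

text \<open>The rotation-invariant probability measure on the unit sphere S^{n-1} of real^'n,
  defined as the normalized cone measure: the measure of a Borel set A of the sphere is the
  Lebesgue measure of the cone {t x | 0 < t <= 1, x in A} divided by the volume of the unit ball.\<close>
definition sphere_measure :: "('n::finite) itself \<Rightarrow> (real^'n) measure" where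
  "sphere_measure _ = measure_of (sphere 0 1) (sets (restrict_space borel (sphere (0::real^'n) 1)))
     (\<lambda>A. emeasure lborel {t *\<^sub>R x | t x. 0 < t \<and> t \<le> 1 \<and> x \<in> A}
          / emeasure lborel (ball (0::real^'n) 1))"

definition bracket :: "'a::real_inner \<Rightarrow> 'a \<Rightarrow> real" where
  "bracket u v = sqrt ((norm u)\<^sup>2 * (norm v)\<^sup>2 - (u \<bullet> v)\<^sup>2)"

definition omega :: "real \<Rightarrow> real" where
  "omega s = pi powr (s / 2) / Gamma (1 + s / 2)"

definition sph_norm :: "('n::finite) itself \<Rightarrow> real \<Rightarrow> (real^'n \<Rightarrow> real) \<Rightarrow> real" where
  "sph_norm N q f = (\<integral>u. f u powr q \<partial>sphere_measure N) powr (1 / q)"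

end

theory Submission
  imports Defs "HOL-Complex_Analysis.Great_Picard"
begin

text \<open>
  Raising f and g to the power 1/(n+p) turns the double integral into the integral of [x,y]^p over two star bodies,
  whose volumes are the two norms of f and g. For fixed g the function x -> (integral of [x,v]^p g(v) dv)^(1/p) is a
  norm, and the reverse Hoelder inequality says that f may be replaced by a power of it; so both bodies may be taken
  to be unit balls of norms. Steiner symmetrization in a direction w replaces x by its mean with the reflection of x in
  the midpoint of its chord, and (s,t) -> [x+sw, y+tw]^p is convex, so symmetrization does not increase the energy.
  By compactness there is a minimizer among norms with given volumes and given bounds (both are preserved by
  symmetrization). Equality at the midpoints of two chords shows that the midpoints of all chords in direction w
  lie on a hyperplane common to both bodies; this hyperplane is orthogonal to w if n is at least 3, which makes both
  bodies balls. If n = 2 the oblique reflections obtained in this way preserve the inertia form of the body, which makes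
  both bodies homothetic ellipses. The same rigidity gives the equality cases.
\<close>

section \<open>The bracket and maps preserving Lebesgue measure\<close>

text \<open>The exponent n/(n+p) turns a density N^(-(n+p)) on the sphere into N^(-n), whose
  integral measures the unit ball of N; being less than 1, it reverses Hoelder's inequality. The
  constant is the energy of two Euclidean balls. Passing to norms costs nothing: let N^p be the
  potential of g, f1 = N^(-(n+p)), and M^p the potential of f1. Then the volume of N is also the
  energy of (f1, g), and the volume of M is also the energy of (N, M). Hence the inequality for N
  and M, divided by powers of these volumes, gives the one for f and g. Norms have two Euclidean
  bounds which symmetrization keeps, and such a class is compact by Arzela-Ascoli; a minimizer
  inside it replaces a convergent sequence of symmetrizations, although in the plane SL(2) makes the
  set of all extremal bodies noncompact. The dimensions part because equality makes the components
  of x and y orthogonal to w satisfy m y = l x, where m and l are the heights of the chord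
  midpoints: in a hyperplane of dimension at least 2 this forces m = l = 0, on a line it leaves one
  free slope.\<close>

definition wedge :: "real^'n \<Rightarrow> real^'n \<Rightarrow> real^'n^'n" where
  "wedge x y = (\<chi> i j. x$i * y$j - x$j * y$i)"

lemma bracket_arg_nonneg: "0 \<le> (norm u)\<^sup>2 * (norm v)\<^sup>2 - (u \<bullet> v)\<^sup>2"
proof -
  have "(u \<bullet> v)\<^sup>2 \<le> (norm u * norm v)\<^sup>2"
    using Cauchy_Schwarz_ineq2[of u v] by (metis abs_ge_zero power2_abs power_mono)
  then show ?thesis unfolding power_mult_distrib by linarith
qed

lemma bracket_nonneg [simp]: "0 \<le> bracket u v"
  unfolding bracket_def using bracket_arg_nonneg by (intro real_sqrt_ge_zero)

lemma bracket_sq: "(bracket u v)\<^sup>2 = (norm u)\<^sup>2 * (norm v)\<^sup>2 - (u \<bullet> v)\<^sup>2"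
  unfolding bracket_def using bracket_arg_nonneg by (intro real_sqrt_pow2)

lemma bracket_commute: "bracket u v = bracket v u"
  by (simp add: bracket_def inner_commute mult.commute)

lemma bracket_le: "bracket u v \<le> norm u * norm v"
proof -
  have "(bracket u v)\<^sup>2 \<le> (norm u * norm v)\<^sup>2"
    by (simp add: bracket_sq power_mult_distrib)
  then show ?thesis by (rule power2_le_imp_le) simp
qed

lemma bracket_scaleR_left: "bracket (t *\<^sub>R u) v = \<bar>t\<bar> * bracket u v"
proof -
  have "(bracket (t *\<^sub>R u) v)\<^sup>2 = (\<bar>t\<bar> * bracket u v)\<^sup>2"
    by (simp add: bracket_sq power_mult_distrib algebra_simps)
  then show ?thesis by simp
qed

lemma bracket_scaleR_right: "bracket u (t *\<^sub>R v) = \<bar>t\<bar> * bracket u v"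
  using bracket_scaleR_left bracket_commute by metis

text \<open>Lagrange's identity; the sum over ordered index pairs meets every minor twice, which is
  the factor sqrt 2. As a multiple of the norm of a bilinear expression, the bracket inherits the
  triangle inequality.\<close>

lemma norm_wedge: "norm (wedge x y) = sqrt 2 * bracket x y"
proof -
  have "(norm (wedge x y))\<^sup>2 = (\<Sum>i\<in>UNIV. \<Sum>j\<in>UNIV. (x$i * y$j - x$j * y$i)\<^sup>2)"
    unfolding power2_norm_eq_inner inner_vec_def wedge_def by (simp add: power2_eq_square)
  also have "\<dots> = (\<Sum>i\<in>UNIV. \<Sum>j\<in>UNIV. (x$i * x$i) * (y$j * y$j) + (y$i * y$i) * (x$j * x$j)
      - 2 * ((x$i * y$i) * (x$j * y$j)))"
    by (intro sum.cong refl) (simp add: power2_eq_square algebra_simps)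
  also have "\<dots> = 2 * ((x \<bullet> x) * (y \<bullet> y) - (x \<bullet> y) * (x \<bullet> y))"
    by (simp only: sum.distrib sum_subtractf sum_distrib_left[symmetric] sum_distrib_right[symmetric])
       (simp add: inner_vec_def)
  also have "\<dots> = (sqrt 2 * bracket x y)\<^sup>2"
    by (simp add: power_mult_distrib bracket_sq power2_norm_eq_inner) (simp add: power2_eq_square)
  finally show ?thesis by simp
qed

lemma bracket_eq_norm_wedge: "bracket x y = norm (wedge x y) / sqrt 2"
  by (simp add: norm_wedge)

lemma bracket_add_left: "bracket (x + y) (z::real^'n) \<le> bracket x z + bracket y z"
proof -
  have "wedge (x + y) z = wedge x z + wedge y z"
    by (simp add: wedge_def vec_eq_iff algebra_simps)
  then show ?thesis
    using norm_triangle_ineq[of "wedge x z" "wedge y z"]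
    by (simp add: bracket_eq_norm_wedge add_divide_distrib[symmetric] divide_right_mono)
qed

lemma continuous_on_bracket [continuous_intros]:
  assumes "continuous_on S f" "continuous_on S g"
  shows "continuous_on S (\<lambda>x. bracket (f x) (g x))"
  unfolding bracket_def by (intro continuous_intros assms)

lemma borel_measurable_bracket [measurable (raw)]:
  fixes f g :: "'a \<Rightarrow> 'b::euclidean_space"
  assumes [measurable]: "f \<in> borel_measurable M" "g \<in> borel_measurable M"
  shows "(\<lambda>x. bracket (f x) (g x)) \<in> borel_measurable M"
  unfolding bracket_def by measurable

text \<open>The wedge product of x - s w and y - t w is affine in (s, t), because
  the wedge of w with itself vanishes.\<close>
lemma bracket_midpoint:
  fixes x y w :: "real^'n"
  shows "bracket (x - s *\<^sub>R w) (y - t *\<^sub>R w)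
    \<le> (bracket x y + bracket (x - (2 * s) *\<^sub>R w) (y - (2 * t) *\<^sub>R w)) / 2"
proof -
  have "2 *\<^sub>R wedge (x - s *\<^sub>R w) (y - t *\<^sub>R w)
    = wedge x y + wedge (x - (2 * s) *\<^sub>R w) (y - (2 * t) *\<^sub>R w)"
    by (simp add: wedge_def vec_eq_iff algebra_simps)
  then have "norm (2 *\<^sub>R wedge (x - s *\<^sub>R w) (y - t *\<^sub>R w))
    \<le> norm (wedge x y) + norm (wedge (x - (2 * s) *\<^sub>R w) (y - (2 * t) *\<^sub>R w))"
    by (metis norm_triangle_ineq)
  then show ?thesis
    by (simp add: bracket_eq_norm_wedge add_divide_distrib[symmetric] field_simps)
qed

lemma powr_midpoint_le:
  fixes a b c p :: real
  assumes "1 \<le> p" "0 \<le> a" "0 \<le> b" "0 \<le> c" "c \<le> (a + b) / 2"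
  shows "c powr p \<le> (a powr p + b powr p) / 2"
proof -
  have "c powr p \<le> ((a + b) / 2) powr p" using assms by (intro powr_mono2) auto
  also have "\<dots> \<le> (a powr p + b powr p) / 2"
  proof -
    consider "a = 0" | "b = 0" | "0 < a" "0 < b" using assms by linarith
    then show ?thesis
    proof cases
      case 3
      from convex_onD[OF powr_convex[OF \<open>1 \<le> p\<close>], of "1/2" a b] 3 show ?thesis
        by (simp add: field_simps)
    next
      \<comment> \<open>With one endpoint equal to 0 the claim reduces to (1/2)^p <= 1/2; convexity
        of the power is invoked only for positive \<open>a\<close> and \<open>b\<close>.\<close>
      have half: "(1/2) powr p \<le> (1/2::real)" using powr_mono'[of 1 p "1/2"] assms by simp
      have *: "(d / 2) powr p \<le> d powr p / 2" if "0 \<le> d" for d :: real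
        using mult_right_mono[OF half, of "d powr p"] that by (simp add: powr_divide)
      { case 1 then show ?thesis using *[of b] assms by simp
      next case 2 then show ?thesis using *[of a] assms by simp }
    qed
  qed
  finally show ?thesis .
qed

lemma bracket_powr_midpoint:
  fixes x y w :: "real^'n"
  assumes "1 \<le> p"
  shows "bracket (x - s *\<^sub>R w) (y - t *\<^sub>R w) powr p
    \<le> (bracket x y powr p + bracket (x - (2 * s) *\<^sub>R w) (y - (2 * t) *\<^sub>R w) powr p) / 2"
  using assms by (intro powr_midpoint_le bracket_midpoint) auto

text \<open>Averaging over translates along w replaces a Fubini decomposition into fibres parallel to w.\<close>
lemma distr_fibrewise:
  fixes w :: "'a::euclidean_space" and h :: "'a \<Rightarrow> real"
  assumes [measurable]: "h \<in> borel_measurable borel" and e: "\<bar>e\<bar> = 1"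
    and h: "\<And>x t. h (x + t *\<^sub>R w) = h x + (e - 1) * t"
  shows "distr lborel borel (\<lambda>x. x + h x *\<^sub>R w) = lborel"
proof (rule measure_eqI)
  show "sets (distr lborel borel (\<lambda>x. x + h x *\<^sub>R w)) = sets lborel" by simp
next
  fix A assume "A \<in> sets (distr lborel borel (\<lambda>x. x + h x *\<^sub>R w))"
  then have [measurable]: "A \<in> sets borel" by simp
  define F :: "'a \<Rightarrow> ennreal" where "F = indicator A"
  define G :: "real \<Rightarrow> ennreal" where "G = indicator {0..1}"
  have [measurable]: "F \<in> borel_measurable borel" "G \<in> borel_measurable borel"
    by (auto simp: F_def G_def)
  have e2: "e * e = 1" using e by (metis abs_mult_self_eq mult_1)
  have trans: "(\<integral>\<^sup>+x. H (x + c) \<partial>lborel) = (\<integral>\<^sup>+x. H x \<partial>lborel)"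
    if "H \<in> borel_measurable borel" for H :: "'b::euclidean_space \<Rightarrow> ennreal" and c
    by (subst (2) lborel_distr_plus[of c, symmetric]) (use that in \<open>simp add: nn_integral_distr add.commute\<close>)
  have affine: "(\<integral>\<^sup>+t. H t \<partial>lborel) = (\<integral>\<^sup>+t. H (c + e * t) \<partial>lborel)"
    if "H \<in> borel_measurable borel" for H :: "real \<Rightarrow> ennreal" and c
    using nn_integral_real_affine[OF that, of e c] e by auto
  have G1: "(\<integral>\<^sup>+t. G (t + c) \<partial>lborel) = 1" for c
    by (subst trans) (auto simp: G_def)
  have "(\<integral>\<^sup>+x. F (x + h x *\<^sub>R w) \<partial>lborel) = (\<integral>\<^sup>+t. G t * (\<integral>\<^sup>+x. F (x + h x *\<^sub>R w) \<partial>lborel) \<partial>lborel)"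
    using G1[of 0] by (simp add: nn_integral_multc)
  also have "\<dots> = (\<integral>\<^sup>+t. \<integral>\<^sup>+x. G t * F ((x + t *\<^sub>R w) + h (x + t *\<^sub>R w) *\<^sub>R w) \<partial>lborel \<partial>lborel)"
    by (intro nn_integral_cong) (subst trans[symmetric, where c = "_ *\<^sub>R w"], simp, simp add: nn_integral_cmult)
  also have "\<dots> = (\<integral>\<^sup>+t. \<integral>\<^sup>+x. G t * F (x + (h x + e * t) *\<^sub>R w) \<partial>lborel \<partial>lborel)"
    by (simp add: h algebra_simps)
  also have "\<dots> = (\<integral>\<^sup>+x. \<integral>\<^sup>+t. G t * F (x + (h x + e * t) *\<^sub>R w) \<partial>lborel \<partial>lborel)"
    by (subst lborel_pair.Fubini') auto
  also have "\<dots> = (\<integral>\<^sup>+x. \<integral>\<^sup>+t. G (e * (t - h x)) * F (x + t *\<^sub>R w) \<partial>lborel \<partial>lborel)"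
  proof (rule nn_integral_cong)
    fix x
    have "(\<integral>\<^sup>+t. G (e * (t - h x)) * F (x + t *\<^sub>R w) \<partial>lborel)
      = (\<integral>\<^sup>+t. G (e * (h x + e * t - h x)) * F (x + (h x + e * t) *\<^sub>R w) \<partial>lborel)"
      by (rule affine) measurable
    then show "(\<integral>\<^sup>+t. G t * F (x + (h x + e * t) *\<^sub>R w) \<partial>lborel) = (\<integral>\<^sup>+t. G (e * (t - h x)) * F (x + t *\<^sub>R w) \<partial>lborel)"
      using e2 by (simp add: mult.assoc[symmetric])
  qed
  also have "\<dots> = (\<integral>\<^sup>+t. \<integral>\<^sup>+x. G (e * (t - h x)) * F (x + t *\<^sub>R w) \<partial>lborel \<partial>lborel)"
    by (rule lborel_pair.Fubini') measurable
  \<comment> \<open>Moving \<open>x\<close> back by \<open>t\<close> along \<open>w\<close> frees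
    \<open>F\<close> from \<open>t\<close>; since \<open>e * e = 1\<close>, the weight becomes a
    translate of \<open>G\<close>, whose integral over \<open>t\<close> is 1.\<close>
  also have "\<dots> = (\<integral>\<^sup>+t. \<integral>\<^sup>+x. G (e * (t - h (x + (- t) *\<^sub>R w))) * F ((x + (- t) *\<^sub>R w) + t *\<^sub>R w) \<partial>lborel \<partial>lborel)"
  proof (rule nn_integral_cong)
    fix t
    show "(\<integral>\<^sup>+x. G (e * (t - h x)) * F (x + t *\<^sub>R w) \<partial>lborel)
      = (\<integral>\<^sup>+x. G (e * (t - h (x + (- t) *\<^sub>R w))) * F ((x + (- t) *\<^sub>R w) + t *\<^sub>R w) \<partial>lborel)"
      by (rule trans[symmetric, where c = "(- t) *\<^sub>R w" and H = "\<lambda>x. G (e * (t - h x)) * F (x + t *\<^sub>R w)"]) measurable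
  qed
  also have "\<dots> = (\<integral>\<^sup>+t. \<integral>\<^sup>+x. G (t + (- e * h x)) * F x \<partial>lborel \<partial>lborel)"
  proof (intro nn_integral_cong)
    fix t x
    have "e * (t - h (x + (- t) *\<^sub>R w)) = (e * e) * t - e * h x" by (subst h) (simp add: algebra_simps)
    then show "G (e * (t - h (x + (- t) *\<^sub>R w))) * F ((x + (- t) *\<^sub>R w) + t *\<^sub>R w) = G (t + (- e * h x)) * F x"
      using e2 by simp
  qed
  also have "\<dots> = (\<integral>\<^sup>+x. \<integral>\<^sup>+t. G (t + (- e * h x)) * F x \<partial>lborel \<partial>lborel)"
    by (subst lborel_pair.Fubini') auto
  also have "\<dots> = (\<integral>\<^sup>+x. F x \<partial>lborel)"
    by (simp add: nn_integral_multc G1 del: add_uminus_conv_diff mult_minus_left)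
  finally have "(\<integral>\<^sup>+x. indicator A x \<partial>distr lborel borel (\<lambda>x. x + h x *\<^sub>R w)) = (\<integral>\<^sup>+x. indicator A x \<partial>lborel)"
    unfolding F_def by (subst nn_integral_distr) auto
  then show "emeasure (distr lborel borel (\<lambda>x. x + h x *\<^sub>R w)) A = emeasure lborel A"
    by simp
qed

section \<open>Orthogonal reflections\<close>

definition reflect :: "'a::euclidean_space \<Rightarrow> 'a \<Rightarrow> 'a" where
  "reflect w x = x - (2 * (x \<bullet> w)) *\<^sub>R w"

lemma inner_reflect: "norm w = 1 \<Longrightarrow> reflect w x \<bullet> reflect w y = x \<bullet> y"
  by (simp add: reflect_def algebra_simps norm_eq_1 inner_commute)

lemma norm_reflect: "norm w = 1 \<Longrightarrow> norm (reflect w x) = norm x"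
  by (simp add: norm_eq_sqrt_inner inner_reflect)

lemma bracket_reflect: "norm w = 1 \<Longrightarrow> bracket (reflect w x) (reflect w y) = bracket x y"
  by (simp add: bracket_def norm_reflect inner_reflect)

lemma reflect_measurable [measurable]: "reflect w \<in> borel_measurable borel"
  unfolding reflect_def by measurable

lemma distr_reflect:
  assumes "norm w = 1" shows "distr lborel borel (reflect w) = lborel"
proof -
  have "distr lborel borel (\<lambda>x. x + (- 2 * (x \<bullet> w)) *\<^sub>R w) = lborel"
    by (rule distr_fibrewise[where e = "- 1"]) (use assms in \<open>auto simp: norm_eq_1 algebra_simps\<close>)
  moreover have "(\<lambda>x. x + (- 2 * (x \<bullet> w)) *\<^sub>R w) = reflect w" by (auto simp: reflect_def)
  ultimately show ?thesis by simp
qed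

section \<open>Radial integration and the sphere\<close>

lemma nn_integral_lborel_scaleR:
  fixes H :: "'a::euclidean_space \<Rightarrow> ennreal"
  assumes [measurable]: "H \<in> borel_measurable borel" and "0 < s"
  shows "(\<integral>\<^sup>+x. H x \<partial>lborel) = ennreal (s ^ DIM('a)) * (\<integral>\<^sup>+x. H (s *\<^sub>R x) \<partial>lborel)"
  using \<open>0 < s\<close> by (subst lborel_affine[of s 0]) (auto simp: nn_integral_density nn_integral_distr nn_integral_cmult)

text \<open>Insert the factor 1, written as the integral of ds/s over those s for which the norm of s x lies in [1, e],
  and interchange the integrals: scaling x by 1/s makes the s-integral explicit.\<close>
lemma nn_integral_sublevel_annulus:
  fixes F :: "'a::euclidean_space \<Rightarrow> ennreal" and N :: "'a \<Rightarrow> real"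
  assumes [measurable]: "F \<in> borel_measurable borel" "N \<in> borel_measurable borel"
    and d: "0 \<le> d"
    and F: "\<And>s x. 0 < s \<Longrightarrow> F (s *\<^sub>R x) = ennreal (s powr d) * F x"
    and N: "\<And>s x. 0 < s \<Longrightarrow> N (s *\<^sub>R x) = s * N x" and pos: "\<And>x. x \<noteq> 0 \<Longrightarrow> 0 < N x"
  defines "n \<equiv> real DIM('a)"
  shows "(\<integral>\<^sup>+x. F x * indicator {x. N x < 1} x \<partial>lborel)
    = ennreal (1 / (n + d)) * (\<integral>\<^sup>+x. F x * ennreal (N x powr - (n + d)) * indicator {x. norm x \<in> {1..exp 1}} x \<partial>lborel)"
proof -
  let ?p = "\<lambda>s x. F x * indicator {x. N x < 1} x * (ennreal (1 / s) * indicator {s. 0 < s \<and> s * norm x \<in> {1..exp 1}} s)"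
    and ?q = "\<lambda>s x. F x * indicator {x. norm x \<in> {1..exp 1}} x * (ennreal (s powr (- (n + d) - 1)) * indicator {s. 0 < s \<and> N x < s} s)"
  have n: "0 < n" by (simp add: n_def)
  have AE0: "AE x in lborel. x \<noteq> (0::'a)" by (rule AE_lborel_singleton)
  have g: "(\<integral>\<^sup>+s. ennreal (1 / s) * indicator {s. 0 < s \<and> s * r \<in> {1..exp 1}} s \<partial>lborel) = 1" if "0 < r" for r :: real
  proof -
    have "(\<integral>\<^sup>+s. ennreal (1 / s) * indicator {s. 0 < s \<and> s * r \<in> {1..exp 1}} s \<partial>lborel)
      = (\<integral>\<^sup>+s. ennreal (1 / s) * indicator {1 / r..exp 1 / r} s \<partial>lborel)"
    proof (rule nn_integral_cong)
      fix s
      have "0 < s" if "1 / r \<le> s" using that \<open>0 < r\<close> by (meson divide_pos_pos less_le_trans zero_less_one)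
      then show "ennreal (1 / s) * indicator {s. 0 < s \<and> s * r \<in> {1..exp 1}} s = ennreal (1 / s) * indicator {1 / r..exp 1 / r} s"
        using \<open>0 < r\<close> by (auto simp: indicator_def field_simps)
    qed
    also have "\<dots> = ennreal (ln (exp 1 / r) - ln (1 / r))"
    proof (rule nn_integral_FTC_Icc)
      fix s assume "s \<in> {1 / r..exp 1 / r}"
      then have "0 < s" using \<open>0 < r\<close> by (auto intro: less_le_trans[of 0 "1 / r"])
      then show "(ln has_real_derivative 1 / s) (at s)" "0 \<le> 1 / s" by (auto intro!: derivative_eq_intros)
    qed (use \<open>0 < r\<close> in \<open>auto simp: divide_right_mono\<close>)
    also have "\<dots> = 1" using \<open>0 < r\<close> by (simp add: ln_div)
    finally show ?thesis .
  qed
  have h: "(\<integral>\<^sup>+s. ennreal (s powr (- (n + d) - 1)) * indicator {s. 0 < s \<and> a < s} s \<partial>lborel) = ennreal (1 / (n + d)) * ennreal (a powr - (n + d))"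
    if "0 < a" for a :: real
  proof -
    have "(\<integral>\<^sup>+s. ennreal (s powr (- (n + d) - 1)) * indicator {s. 0 < s \<and> a < s} s \<partial>lborel)
      = (\<integral>\<^sup>+s. ennreal (s powr (- (n + d) - 1)) * indicator {a..} s \<partial>lborel)"
      using AE_lborel_singleton[of a] that
      by (intro nn_integral_cong_AE) (auto elim!: eventually_mono simp: indicator_def)
    also have "\<dots> = ennreal (0 - (- (1 / (n + d)) * a powr - (n + d)))"
    proof (rule nn_integral_FTC_atLeast)
      fix s assume "a \<le> s"
      then have "0 < s" using that by simp
      then show "((\<lambda>s. - (1 / (n + d)) * s powr - (n + d)) has_real_derivative s powr (- (n + d) - 1)) (at s)"
        by (rule DERIV_cong[OF DERIV_cmult[OF has_real_derivative_powr]]) (use n d in \<open>auto simp: field_simps\<close>)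
    next
      have "((\<lambda>s. s powr - (n + d)) \<longlongrightarrow> 0) at_top"
        using n d by (intro tendsto_neg_powr filterlim_ident) auto
      from tendsto_mult[OF tendsto_const[of "- (1 / (n + d))"] this]
      show "((\<lambda>s. - (1 / (n + d)) * s powr - (n + d)) \<longlongrightarrow> 0) at_top" by simp
    qed auto
    also have "\<dots> = ennreal (1 / (n + d)) * ennreal (a powr - (n + d))"
      using n d by (simp add: ennreal_mult[symmetric])
    finally show ?thesis .
  qed
  have "(\<integral>\<^sup>+x. F x * indicator {x. N x < 1} x \<partial>lborel)
    = (\<integral>\<^sup>+x. \<integral>\<^sup>+s. ?p s x \<partial>lborel \<partial>lborel)"
    by (intro nn_integral_cong_AE, use AE0 in eventually_elim) (simp add: nn_integral_cmult g[simplified])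
  also have "\<dots> = (\<integral>\<^sup>+s. \<integral>\<^sup>+x. ?p s x \<partial>lborel \<partial>lborel)"
    by (rule lborel_pair.Fubini') measurable
  also have "\<dots> = (\<integral>\<^sup>+s. \<integral>\<^sup>+x. ?q s x \<partial>lborel \<partial>lborel)"
  proof (rule nn_integral_cong)
    fix s :: real
    show "(\<integral>\<^sup>+x. ?p s x \<partial>lborel)
      = (\<integral>\<^sup>+x. ?q s x \<partial>lborel)"
    proof (cases "0 < s")
      case True
      \<comment> \<open>The exponent -(n+d)-1 collects the Jacobian of scaling by 1/s, the degree of
        \<open>F\<close> and the weight 1/s; the two constraints become \<open>N x < s\<close> and
        one on \<open>norm x\<close> alone.\<close>
      have eq: "F ((1/s) *\<^sub>R x) * indicator {x. N x < 1} ((1/s) *\<^sub>R x) *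
        (ennreal (1 / s) * indicator {r. 0 < r \<and> r * norm ((1/s) *\<^sub>R x) \<in> {1..exp 1}} s)
        = ennreal (s powr n) * (?q s x)" for x
      proof -
        have "ennreal ((1/s) powr d) * ennreal (1/s) = ennreal (s powr n) * ennreal (s powr (- (n + d) - 1))"
          using True by (simp add: ennreal_mult[symmetric] powr_divide powr_add[symmetric])
            (simp add: powr_minus_divide powr_diff powr_add)
        then show ?thesis
          using True by (auto simp: F N indicator_def field_simps mult.left_commute)
      qed
      have one': "ennreal ((1 / s) ^ DIM('a)) * ennreal (s powr n) = 1"
        using True by (simp add: ennreal_mult[symmetric] n_def powr_realpow power_one_over)
      have one: "ennreal ((1 / s) ^ DIM('a)) * (ennreal (s powr n) * Z) = Z" for Z
        unfolding mult.assoc[symmetric] one' by simp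
      show ?thesis
        apply (subst nn_integral_lborel_scaleR[where s = "1/s"])
          apply measurable
        using True apply simp
        apply (simp only: eq)
        apply (subst nn_integral_cmult)
         apply measurable
        apply (rule one)
        done
    qed simp
  qed
  also have "\<dots> = (\<integral>\<^sup>+x. \<integral>\<^sup>+s. ?q s x \<partial>lborel \<partial>lborel)"
    by (rule lborel_pair.Fubini') measurable
  also have "\<dots> = (\<integral>\<^sup>+x. ennreal (1 / (n + d)) * (F x * ennreal (N x powr - (n + d)) * indicator {x. norm x \<in> {1..exp 1}} x) \<partial>lborel)"
  proof (intro nn_integral_cong_AE, use AE0 in eventually_elim)
    fix x :: 'a assume "x \<noteq> 0"
    have "(\<integral>\<^sup>+s. ?q s x \<partial>lborel)
      = F x * indicator {x. norm x \<in> {1..exp 1}} x * (ennreal (1 / (n + d)) * ennreal (N x powr - (n + d)))"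
      unfolding h[OF pos[OF \<open>x \<noteq> 0\<close>], symmetric] by (rule nn_integral_cmult) measurable
    also have "\<dots> = ennreal (1 / (n + d)) * (F x * ennreal (N x powr - (n + d)) * indicator {x. norm x \<in> {1..exp 1}} x)"
      by (simp only: ac_simps)
    finally show "(\<integral>\<^sup>+s. ?q s x \<partial>lborel)
      = ennreal (1 / (n + d)) * (F x * ennreal (N x powr - (n + d)) * indicator {x. norm x \<in> {1..exp 1}} x)" .
  qed
  finally show ?thesis by (simp add: nn_integral_cmult)
qed

section \<open>The sphere measure as an image of Lebesgue measure\<close>

lemma sigma_sets_restrict: "sigma_sets (sphere 0 1) (sets (restrict_space borel (sphere (0::real^'n) 1))) = sets (restrict_space borel (sphere 0 1))"
  using sets.sigma_sets_eq[of "restrict_space borel (sphere (0::real^'n) 1)"] by (simp add: space_restrict_space)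

text \<open>\<open>measure_of\<close> returns the given set function only if that is a measure;
  exhibiting it as an image measure supplies countable additivity. The point \<open>e\<close> is a
  placeholder for the direction of the origin, where the density vanishes.\<close>

lemma sphere_measure_eq_distr:
  fixes e :: "real^'n"
  assumes e: "norm e = 1"
  shows "sphere_measure TYPE('n) = distr (density lborel (\<lambda>x::real^'n. indicator (cball 0 1 - {0}) x / emeasure lborel (ball (0::real^'n) 1)))
     (restrict_space borel (sphere 0 1)) (\<lambda>x. if x = 0 then e else sgn x)" (is "_ = distr ?D ?S ?g")
proof -
  have g[measurable]: "?g \<in> borel \<rightarrow>\<^sub>M ?S"
    by (rule measurable_restrict_space2) (use e in \<open>auto simp: norm_sgn\<close>)
  have "emeasure lborel {t *\<^sub>R x | t x. 0 < t \<and> t \<le> 1 \<and> x \<in> A} / emeasure lborel (ball (0::real^'n) 1)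
    = emeasure (distr ?D ?S ?g) A" if A: "A \<in> sets ?S" for A
  proof -
    have Asub: "A \<subseteq> sphere 0 1" and [measurable]: "A \<in> sets borel"
      using A by (auto simp: sets_restrict_space)
    have cone: "{t *\<^sub>R x | t x. 0 < t \<and> t \<le> 1 \<and> x \<in> A} = ?g -` A \<inter> (cball 0 1 - {0})"
    proof (intro equalityI subsetI)
      fix z assume "z \<in> {t *\<^sub>R x | t x. 0 < t \<and> t \<le> 1 \<and> x \<in> A}"
      then obtain t x where z: "z = t *\<^sub>R x" "0 < t" "t \<le> 1" "x \<in> A" by auto
      then have "norm x = 1" using Asub by auto
      then have "sgn z = x" using z by (simp add: sgn_div_norm)
      with z \<open>norm x = 1\<close> show "z \<in> ?g -` A \<inter> (cball 0 1 - {0})" by auto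
    next
      fix z assume "z \<in> ?g -` A \<inter> (cball 0 1 - {0})"
      then have "z = norm z *\<^sub>R sgn z" "0 < norm z" "norm z \<le> 1" "sgn z \<in> A" by (auto simp: sgn_div_norm split: if_splits)
      then show "z \<in> {t *\<^sub>R x | t x. 0 < t \<and> t \<le> 1 \<and> x \<in> A}" by blast
    qed
    have m: "?g -` A \<in> sets borel" using measurable_sets[OF g A] by simp
    have [measurable]: "cball (0::real^'n) 1 - {0} \<in> sets borel" by auto
    have D: "(\<lambda>x::real^'n. indicator (cball 0 1 - {0}) x / emeasure lborel (ball (0::real^'n) 1)) \<in> borel_measurable lborel"
      by measurable
    have "emeasure (distr ?D ?S ?g) A = (\<integral>\<^sup>+x. indicator (cball 0 1 - {0}) x / emeasure lborel (ball (0::real^'n) 1) * indicator (?g -` A) x \<partial>lborel)"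
      using m A by (simp add: emeasure_distr emeasure_density[OF D])
    also have "\<dots> = (\<integral>\<^sup>+x. indicator (?g -` A \<inter> (cball 0 1 - {0})) x / emeasure lborel (ball (0::real^'n) 1) \<partial>lborel)"
      by (intro nn_integral_cong) (auto simp: indicator_def)
    also have "\<dots> = emeasure lborel (?g -` A \<inter> (cball 0 1 - {0})) / emeasure lborel (ball (0::real^'n) 1)"
      using m by (simp add: nn_integral_divide)
    finally show ?thesis by (simp add: cone)
  qed
  then have "sphere_measure TYPE('n) = measure_of (sphere 0 1) (sets ?S) (emeasure (distr ?D ?S ?g))"
    unfolding sphere_measure_def
    by (intro measure_of_eq) (use space_in_borel sets.sets_into_space[of _ ?S] in \<open>auto simp: space_restrict_space sigma_sets_restrict\<close>)
  also have "\<dots> = distr ?D ?S ?g"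
    using measure_of_of_measure[of "distr ?D ?S ?g"] by (simp add: space_restrict_space)
  finally show ?thesis .
qed

abbreviation (input) sph :: "(real^'n::finite) measure" where
  "sph \<equiv> sphere_measure TYPE('n)"

lemma space_sphere_measure [simp]: "space (sphere_measure TYPE('n::finite)) = sphere 0 1"
  and sets_sphere_measure: "sets (sphere_measure TYPE('n)) = sets (restrict_space borel (sphere 0 1))"
proof -
  obtain e :: "real^'n" where "norm e = 1" using vector_choose_size[of 1] by auto
  from sphere_measure_eq_distr[OF this]
  show "space (sphere_measure TYPE('n::finite)) = sphere 0 1"
    "sets (sphere_measure TYPE('n)) = sets (restrict_space borel (sphere 0 1))"
    by (simp_all add: space_restrict_space)
qed

lemma borel_measurable_sphere:
  "f \<in> borel_measurable borel \<Longrightarrow> f \<in> borel_measurable (sphere_measure TYPE('n::finite))"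
  by (simp add: measurable_restrict_space1 sets_sphere_measure cong: measurable_cong_sets)

lemma measurable_ident_sphere: "(\<lambda>u. u) \<in> borel_measurable (sphere_measure TYPE('n::finite))"
  by (rule borel_measurable_sphere) simp

lemma measurable_fst_sphere: "fst \<in> borel_measurable (sphere_measure TYPE('n::finite) \<Otimes>\<^sub>M M)"
  by (rule measurable_compose[OF measurable_fst measurable_ident_sphere])

lemma measurable_snd_sphere: "snd \<in> borel_measurable (M \<Otimes>\<^sub>M sphere_measure TYPE('n::finite))"
  by (rule measurable_compose[OF measurable_snd measurable_ident_sphere])

lemma nn_integral_sphere_measure:
  fixes G :: "real^'n \<Rightarrow> ennreal"
  assumes [measurable]: "G \<in> borel_measurable borel"
  shows "(\<integral>\<^sup>+u. G u \<partial>sphere_measure TYPE('n)) = (\<integral>\<^sup>+x. G (sgn x) * indicator {x. norm x < 1} x \<partial>lborel) / ennreal (unit_ball_vol (real CARD('n)))"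
proof -
  obtain e :: "real^'n" where e: "norm e = 1" using vector_choose_size[of 1] by auto
  have g[measurable]: "(\<lambda>x. if x = 0 then e else sgn x) \<in> borel \<rightarrow>\<^sub>M restrict_space borel (sphere 0 1)"
    by (rule measurable_restrict_space2) (use e in \<open>auto simp: norm_sgn\<close>)
  \<comment> \<open>The image measure lives on the closed ball without its centre, the claim on the
    open ball; the two differ by null sets.\<close>
  have "AE x in lborel. x \<noteq> (0::real^'n)" by (rule AE_lborel_singleton)
  moreover have "AE x in lborel. x \<notin> sphere (0::real^'n) 1"
  proof (rule AE_not_in)
    have "negligible (sphere (0::real^'n) 1)" using negligible_convex_frontier[of "cball (0::real^'n) 1"] by simp
    then show "sphere (0::real^'n) 1 \<in> null_sets lborel"
      by (simp add: negligible_iff_null_sets null_sets_def)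
  qed
  moreover have "(\<integral>\<^sup>+u. G u \<partial>sphere_measure TYPE('n))
    = (\<integral>\<^sup>+x. indicator (cball 0 1 - {0}) x / emeasure lborel (ball (0::real^'n) 1) * G (if x = 0 then e else sgn x) \<partial>lborel)"
  proof -
    have [measurable]: "cball (0::real^'n) 1 - {0} \<in> sets borel" by auto
    have 1: "(\<lambda>x::real^'n. indicator (cball 0 1 - {0}) x / emeasure lborel (ball (0::real^'n) 1)) \<in> borel_measurable lborel"
      by measurable
    have 2: "(\<lambda>x. G (if x = 0 then e else sgn x)) \<in> borel_measurable lborel"
      using measurable_compose[OF g measurable_restrict_space1[of G borel borel "sphere 0 1"]] by simp
    have 3: "G \<in> borel_measurable (restrict_space borel (sphere 0 1))" by (rule measurable_restrict_space1) simp
    show ?thesis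
      unfolding sphere_measure_eq_distr[OF e]
      by (subst nn_integral_distr) (use 1 2 3 in \<open>auto simp: nn_integral_density\<close>)
  qed
  moreover have "\<dots> = (\<integral>\<^sup>+x. G (sgn x) * indicator {x. norm x < 1} x / ennreal (unit_ball_vol (real CARD('n))) \<partial>lborel)"
    if "AE x in lborel. x \<noteq> (0::real^'n)" "AE x in lborel. x \<notin> sphere (0::real^'n) 1"
    by (intro nn_integral_cong_AE, use that in eventually_elim)
       (auto simp: indicator_def divide_ennreal_def mult_ac emeasure_ball)
  ultimately show ?thesis by (simp add: nn_integral_divide)
qed

text \<open>Polar coordinates without a product decomposition: the sublevel set of \<open>N\<close>
  and the Euclidean ball behind the sphere measure are both reduced to an integral over the same
  annulus, which is then eliminated.\<close>

lemma nn_integral_sublevel_sphere: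
  fixes F :: "real^'n \<Rightarrow> ennreal" and N :: "real^'n \<Rightarrow> real"
  assumes [measurable]: "F \<in> borel_measurable borel" "N \<in> borel_measurable borel"
    and d: "0 \<le> d"
    and F: "\<And>s x. 0 < s \<Longrightarrow> F (s *\<^sub>R x) = ennreal (s powr d) * F x"
    and N: "\<And>s x. 0 < s \<Longrightarrow> N (s *\<^sub>R x) = s * N x" and pos: "\<And>x. x \<noteq> 0 \<Longrightarrow> 0 < N x"
  defines "n \<equiv> real CARD('n)"
  shows "(\<integral>\<^sup>+x. F x * indicator {x. N x < 1} x \<partial>lborel)
    = ennreal (n * unit_ball_vol n / (n + d)) * (\<integral>\<^sup>+u. F u * ennreal (N u powr - (n + d)) \<partial>sphere_measure TYPE('n))"
proof -
  have n: "0 < n" by (simp add: n_def)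
  \<comment> \<open>The degrees d, -(n+d) and n add up to 0: the last factor makes \<open>G\<close>
    constant on rays and is 1 on the sphere.\<close>
  define G where "G = (\<lambda>x. F x * ennreal (N x powr - (n + d)) * ennreal (norm x powr n))"
  have [measurable]: "G \<in> borel_measurable borel" unfolding G_def by measurable
  have G: "G (s *\<^sub>R x) = G x" if "0 < s" for s x
  proof (cases "x = 0")
    case False
    have "ennreal (s powr d) * ennreal (s powr - (n + d)) * ennreal (s powr n) = 1"
      using that by (simp add: ennreal_mult[symmetric] powr_add[symmetric])
    moreover have "G (s *\<^sub>R x) = (ennreal (s powr d) * ennreal (s powr - (n + d)) * ennreal (s powr n)) * G x"
      using that pos[OF False] by (simp add: G_def F N powr_mult ennreal_mult mult_ac)
    ultimately show ?thesis by simp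
  qed (use n in \<open>simp add: G_def\<close>)
  have AE0: "AE x in lborel. x \<noteq> (0::real^'n)" by (rule AE_lborel_singleton)
  have "(\<integral>\<^sup>+u. F u * ennreal (N u powr - (n + d)) \<partial>sphere_measure TYPE('n)) = (\<integral>\<^sup>+u. G u \<partial>sphere_measure TYPE('n))"
    by (intro nn_integral_cong) (simp add: G_def)
  also have "\<dots> = (\<integral>\<^sup>+x. G (sgn x) * indicator {x. norm x < 1} x \<partial>lborel) / ennreal (unit_ball_vol n)"
    unfolding n_def by (rule nn_integral_sphere_measure) simp
  also have "(\<integral>\<^sup>+x. G (sgn x) * indicator {x. norm x < 1} x \<partial>lborel) = (\<integral>\<^sup>+x. G x * indicator {x. norm x < 1} x \<partial>lborel)"
    by (intro nn_integral_cong_AE, use AE0 in eventually_elim) (simp add: G sgn_div_norm)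
  also have "\<dots> = ennreal (1 / n) * (\<integral>\<^sup>+x. G x * ennreal (norm x powr - n) * indicator {x. norm x \<in> {1..exp 1}} x \<partial>lborel)"
    using nn_integral_sublevel_annulus[of G norm 0] by (simp add: G n_def)
  also have "(\<integral>\<^sup>+x. G x * ennreal (norm x powr - n) * indicator {x. norm x \<in> {1..exp 1}} x \<partial>lborel)
    = (\<integral>\<^sup>+x. F x * ennreal (N x powr - (n + d)) * indicator {x. norm x \<in> {1..exp 1}} x \<partial>lborel)"
    by (intro nn_integral_cong_AE, use AE0 in eventually_elim)
       (simp add: G_def mult.assoc ennreal_mult[symmetric] powr_add[symmetric])
  finally have *: "(\<integral>\<^sup>+u. F u * ennreal (N u powr - (n + d)) \<partial>sphere_measure TYPE('n))
    = ennreal (1 / n) * (\<integral>\<^sup>+x. F x * ennreal (N x powr - (n + d)) * indicator {x. norm x \<in> {1..exp 1}} x \<partial>lborel) / ennreal (unit_ball_vol n)" .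
  have c: "ennreal (n * unit_ball_vol n / (n + d)) * (ennreal (1 / n) * Z / ennreal (unit_ball_vol n)) = ennreal (1 / (n + d)) * Z" for Z
  proof -
    have v: "0 < unit_ball_vol n" using n by simp
    have "ennreal (n * unit_ball_vol n / (n + d)) * (ennreal (1 / n) * ennreal (1 / unit_ball_vol n)) = ennreal (1 / (n + d))"
      using n d v less_imp_neq[OF v] by (simp add: ennreal_mult[symmetric] del: unit_ball_vol_pos)
    then show ?thesis using v
      by (simp add: divide_ennreal_def inverse_ennreal inverse_eq_divide mult_ac)
  qed
  show ?thesis
    unfolding * c using nn_integral_sublevel_annulus[OF assms(1,2) d F N pos] by (simp add: n_def)
qed

lemma emeasure_sphere_measure_space: "emeasure (sphere_measure TYPE('n::finite)) (sphere 0 1) = 1"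
proof -
  have "emeasure (sphere_measure TYPE('n)) (sphere 0 1) = (\<integral>\<^sup>+u. 1 \<partial>sphere_measure TYPE('n))" by simp
  also have "\<dots> = (\<integral>\<^sup>+x. 1 * indicator {x::real^'n. norm x < 1} x \<partial>lborel) / ennreal (unit_ball_vol (real CARD('n)))"
    by (rule nn_integral_sphere_measure) simp
  also have "{x::real^'n. norm x < 1} = ball 0 1" by auto
  finally have "emeasure (sphere_measure TYPE('n)) (sphere 0 1) = (\<integral>\<^sup>+x. 1 * indicator (ball (0::real^'n) 1) x \<partial>lborel) / ennreal (unit_ball_vol (real CARD('n)))" .
  moreover have "(\<integral>\<^sup>+x. 1 * indicator (ball (0::real^'n) 1) x \<partial>lborel) = ennreal (unit_ball_vol (real CARD('n)))"
    by (simp add: emeasure_ball)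
  moreover have "0 < unit_ball_vol (real CARD('n))" by simp
  ultimately show ?thesis by (simp add: divide_ennreal del: unit_ball_vol_pos)
qed

lemma finite_measure_sphere: "finite_measure (sphere_measure TYPE('n::finite))"
  by standard (simp add: emeasure_sphere_measure_space)

lemma sigma_finite_sphere: "sigma_finite_measure (sphere_measure TYPE('n::finite))"
  using finite_measure_sphere by (rule finite_measure.axioms)

text \<open>The cone over the part of the sphere inside \<open>S\<close> lies in \<open>S\<close>, a
  Lebesgue null set. It serves for lines, since the bracket with a fixed vector vanishes on a
  line.\<close>

lemma null_sphere_lowdim:
  fixes S :: "(real^'n) set"
  assumes S: "subspace S" "dim S < CARD('n)" and [measurable]: "S \<in> sets borel"
  shows "AE u in sphere_measure TYPE('n). u \<notin> S"
proof -
  have "negligible S" using S by (intro negligible_lowdim) simp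
  then have 1: "AE x in lborel. x \<notin> S"
    by (intro AE_not_in) (simp add: negligible_iff_null_sets null_sets_completion_iff)
  have "(\<integral>\<^sup>+u. indicator S u \<partial>sphere_measure TYPE('n)) = (\<integral>\<^sup>+x. indicator S (sgn x) * indicator {x. norm x < 1} x \<partial>lborel) / ennreal (unit_ball_vol (real CARD('n)))"
    by (rule nn_integral_sphere_measure) simp
  also have "(\<integral>\<^sup>+x. indicator S (sgn x) * indicator {x. norm x < 1} x \<partial>lborel) = (\<integral>\<^sup>+x. 0 \<partial>(lborel :: (real^'n) measure))"
  proof (intro nn_integral_cong_AE, use 1 in eventually_elim)
    fix x assume "x \<notin> S"
    then have "sgn x \<notin> S"
      using S(1) subspace_scale[OF S(1), of "sgn x" "norm x"] by (cases "x = 0") (auto simp: sgn_div_norm)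
    then show "indicator S (sgn x) * indicator {x. norm x < 1} x = (0::ennreal)" by simp
  qed
  finally have "(\<integral>\<^sup>+u. indicator S u \<partial>sphere_measure TYPE('n)) = 0" by simp
  then have "AE u in sphere_measure TYPE('n). indicator S u = (0::ennreal)"
    by (subst (asm) nn_integral_0_iff_AE) (auto intro!: borel_measurable_sphere)
  then show ?thesis by eventually_elim (auto simp: indicator_def split: if_splits)
qed

section \<open>Steiner symmetrization of norms\<close>

text \<open>The Euclidean bounds are parameters rather than existentially quantified, because the
  same \<open>a\<close> and \<open>b\<close> must survive symmetrization and pointwise limits to
  give a compact class.\<close>

locale norm_fn =
  fixes a b :: real and N :: "'a::euclidean_space \<Rightarrow> real"
  assumes a_pos: "0 < a"
    and subadd: "\<And>x y. N (x + y) \<le> N x + N y"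
    and homog: "\<And>t x. N (t *\<^sub>R x) = \<bar>t\<bar> * N x"
    and lower: "\<And>x. a * norm x \<le> N x"
    and upper: "\<And>x. N x \<le> b * norm x"
begin

lemma zero [simp]: "N 0 = 0"
  using homog[of 0 0] by simp

lemma minus [simp]: "N (- x) = N x"
  using homog[of "-1" x] by simp

lemma pos: "x \<noteq> 0 \<Longrightarrow> 0 < N x"
  using lower[of x] a_pos by (smt (verit) mult_pos_pos zero_less_norm_iff)

lemma nonneg: "0 \<le> N x"
  using pos[of x] by (cases "x = 0") auto

lemma homog_pos: "0 < s \<Longrightarrow> N (s *\<^sub>R x) = s * N x"
  by (simp add: homog)

lemma lipschitz: "\<bar>N x - N y\<bar> \<le> b * norm (x - y)"
proof -
  have "N x \<le> N y + N (x - y)" "N y \<le> N x + N (y - x)"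
    using subadd[of y "x - y"] subadd[of x "y - x"] by simp_all
  moreover have "N (y - x) = N (x - y)" using minus[of "x - y"] by simp
  ultimately show ?thesis using upper[of "x - y"] by linarith
qed

lemma continuous: "continuous_on S N"
proof (rule lipschitz_on_continuous_on[of "\<bar>b\<bar>"], rule lipschitz_onI)
  fix x y :: 'a
  have "b * norm (x - y) \<le> \<bar>b\<bar> * norm (x - y)" by (intro mult_right_mono) auto
  then show "dist (N x) (N y) \<le> \<bar>b\<bar> * dist x y" using lipschitz[of x y] by (simp add: dist_norm)
qed simp

lemma measurable_N [measurable]: "N \<in> borel_measurable borel"
  by (rule borel_measurable_continuous_onI) (rule continuous)

lemma continuous_compose [continuous_intros]: "continuous_on S f \<Longrightarrow> continuous_on S (\<lambda>x. N (f x))"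
  by (rule continuous_on_compose2[OF continuous[of UNIV]]) auto

lemma convex_comb_less:
  assumes "N x < 1" "N y < 1" "0 \<le> u" "0 \<le> v" "u + v = 1"
  shows "N (u *\<^sub>R x + v *\<^sub>R y) < 1"
proof -
  have "N (u *\<^sub>R x + v *\<^sub>R y) \<le> u * N x + v * N y"
    using subadd[of "u *\<^sub>R x" "v *\<^sub>R y"] assms by (simp add: homog)
  also have "\<dots> < 1"
    using assms convex_bound_lt[of "N x" 1 "N y" u v] by auto
  finally show ?thesis .
qed

end

text \<open>The codomain is polymorphic because the ball enters both nonnegative and real-valued
  integrals.\<close>

abbreviation ind :: "('a \<Rightarrow> real) \<Rightarrow> 'a \<Rightarrow> 'b::zero_neq_one" where
  "ind N x \<equiv> indicator {x. N x < 1} x"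

definition fib_dom :: "('a::euclidean_space \<Rightarrow> real) \<Rightarrow> 'a \<Rightarrow> 'a set" where
  "fib_dom N w = {x. \<exists>t. N (x + t *\<^sub>R w) < 1}"

definition fib_top :: "('a::euclidean_space \<Rightarrow> real) \<Rightarrow> 'a \<Rightarrow> 'a \<Rightarrow> real" where
  "fib_top N w x = Sup {t. N (x + t *\<^sub>R w) < 1}"

text \<open>For a symmetric body the lower end of the chord through x in direction w is the negative of the
  upper end of the chord through -x; hence this is the w-component of the midpoint of the chord through x.\<close>
definition fib_mid :: "('a::euclidean_space \<Rightarrow> real) \<Rightarrow> 'a \<Rightarrow> 'a \<Rightarrow> real" where
  "fib_mid N w x = (if x \<in> fib_dom N w then x \<bullet> w + (fib_top N w x - fib_top N w (- x)) / 2 else 0)"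

text \<open>The norm whose unit ball is the Steiner symmetral of the unit ball of N.\<close>
definition steiner :: "('a::euclidean_space \<Rightarrow> real) \<Rightarrow> 'a \<Rightarrow> 'a \<Rightarrow> real" where
  "steiner N w z = (INF s. max (N (z + s *\<^sub>R w)) (N (reflect w z + s *\<^sub>R w)))"

lemma fib_dom_shift: "x + t *\<^sub>R w \<in> fib_dom N w \<longleftrightarrow> x \<in> fib_dom N w"
proof -
  have "x + t *\<^sub>R w \<in> fib_dom N w" if "x \<in> fib_dom N w" for x t
  proof -
    from that obtain s where "N (x + s *\<^sub>R w) < 1" by (auto simp: fib_dom_def)
    then have "N (x + t *\<^sub>R w + (s - t) *\<^sub>R w) < 1" by (simp add: algebra_simps)
    then show ?thesis by (auto simp: fib_dom_def)
  qed
  from this[of x t] this[of "x + t *\<^sub>R w" "- t"] show ?thesis by auto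
qed

locale norm_fn_dir = norm_fn a b N for a b and N :: "'a::euclidean_space \<Rightarrow> real" +
  fixes w :: 'a assumes w: "norm w = 1"
begin

lemma ww [simp]: "w \<bullet> w = 1"
  using w by (simp add: norm_eq_1)

lemma reflect_diff: "reflect w (x - c *\<^sub>R w) = x + (c - 2 * (x \<bullet> w)) *\<^sub>R w"
proof -
  have "reflect w (x - c *\<^sub>R w) = x + ((- c) *\<^sub>R w + (- (2 * (x \<bullet> w - c))) *\<^sub>R w)"
    by (simp add: reflect_def inner_diff_left algebra_simps)
  also have "\<dots> = x + (- c + - (2 * (x \<bullet> w - c))) *\<^sub>R w" by (simp only: scaleR_add_left)
  also have "- c + - (2 * (x \<bullet> w - c)) = c - 2 * (x \<bullet> w)" by simp
  finally show ?thesis .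
qed

lemma minus_fib: "N (- x + (- t) *\<^sub>R w) = N (x + t *\<^sub>R w)"
proof -
  have "- x + (- t) *\<^sub>R w = - (x + t *\<^sub>R w)" by simp
  then show ?thesis by (simp only: minus)
qed

lemma fib_bdd: "bdd_above {t. N (x + t *\<^sub>R w) < 1}"
proof (rule bdd_aboveI)
  fix t assume "t \<in> {t. N (x + t *\<^sub>R w) < 1}"
  then have "a * norm (x + t *\<^sub>R w) < 1" using lower[of "x + t *\<^sub>R w"] by simp
  then have "norm (x + t *\<^sub>R w) < 1 / a" using a_pos by (simp add: field_simps)
  moreover have "\<bar>t\<bar> \<le> norm (x + t *\<^sub>R w) + norm x"
    using norm_triangle_ineq4[of "x + t *\<^sub>R w" x] w by simp
  ultimately show "t \<le> 1 / a + norm x" by linarith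
qed

lemma fib_dom_minus: "- x \<in> fib_dom N w \<longleftrightarrow> x \<in> fib_dom N w"
proof -
  have "- x \<in> fib_dom N w" if "x \<in> fib_dom N w" for x
  proof -
    from that obtain s where "N (x + s *\<^sub>R w) < 1" by (auto simp: fib_dom_def)
    then have "N (- x + (- s) *\<^sub>R w) < 1" by (simp only: minus_fib)
    then show ?thesis unfolding fib_dom_def by blast
  qed
  from this[of x] this[of "- x"] show ?thesis by auto
qed

lemma fib_less_top: "N (x + t *\<^sub>R w) < 1 \<Longrightarrow> t < fib_top N w x"
proof -
  assume t: "N (x + t *\<^sub>R w) < 1"
  have "open {s. N (x + s *\<^sub>R w) < 1}"
    by (intro open_Collect_less continuous_intros)
  then obtain e where e: "0 < e" "\<And>s. dist s t < e \<Longrightarrow> N (x + s *\<^sub>R w) < 1"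
    using t unfolding open_dist by blast
  then have "N (x + (t + e / 2) *\<^sub>R w) < 1" by (simp add: dist_real_def)
  then have "t + e / 2 \<le> fib_top N w x"
    unfolding fib_top_def by (intro cSup_upper fib_bdd) simp
  then show ?thesis using e by simp
qed

lemma less_fib_top:
  assumes "x \<in> fib_dom N w" "c < fib_top N w x"
  obtains t where "N (x + t *\<^sub>R w) < 1" "c < t"
proof -
  have "{t. N (x + t *\<^sub>R w) < 1} \<noteq> {}" using assms(1) by (auto simp: fib_dom_def)
  from less_cSup_iff[OF this fib_bdd, of c] assms(2) show thesis
    using that by (auto simp: fib_top_def)
qed

text \<open>The supremum property gives points of the chord beyond \<open>t\<close> on both sides,
  the lower one through the symmetric chord of \<open>- x\<close>; \<open>t\<close> is a convex
  combination of their parameters.\<close>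

lemma fib_iff:
  assumes "x \<in> fib_dom N w"
  shows "N (x + t *\<^sub>R w) < 1 \<longleftrightarrow> - fib_top N w (- x) < t \<and> t < fib_top N w x"
proof
  assume t: "N (x + t *\<^sub>R w) < 1"
  then have "N (- x + (- t) *\<^sub>R w) < 1" by (simp only: minus_fib)
  from fib_less_top[OF this] fib_less_top[OF t]
  show "- fib_top N w (- x) < t \<and> t < fib_top N w x" by simp
next
  assume *: "- fib_top N w (- x) < t \<and> t < fib_top N w x"
  obtain r where r: "N (x + r *\<^sub>R w) < 1" "t < r"
    using less_fib_top[OF assms] * by blast
  moreover have "- x \<in> fib_dom N w" "- t < fib_top N w (- x)" using assms * by (auto simp: fib_dom_minus)
  then obtain s where "N (- x + s *\<^sub>R w) < 1" "- t < s"
    by (rule less_fib_top)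
  ultimately have rs: "N (x + r *\<^sub>R w) < 1" "t < r" "N (- x + s *\<^sub>R w) < 1" "- t < s" by auto
  from rs(3) have "N (- (x + (- s) *\<^sub>R w)) < 1" by (simp add: algebra_simps)
  then have s: "N (x + (- s) *\<^sub>R w) < 1" by (simp only: minus)
  define u v where "u = (t + s) / (r + s)" and "v = (r - t) / (r + s)"
  have rs0: "0 < r + s" using rs(2,4) by linarith
  have uv: "0 \<le> u" "0 \<le> v" "u + v = 1"
    using rs(2,4) rs0 by (auto simp: u_def v_def add_divide_distrib[symmetric])
  have "u * r + v * (- s) = t"
  proof -
    have "u * (r + s) = t + s" "v * (r + s) = r - t" using rs0 by (simp_all add: u_def v_def)
    moreover have "(u * r + v * (- s)) * (r + s) = (u * (r + s)) * r - (v * (r + s)) * s" by (simp add: algebra_simps)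
    ultimately have "(u * r + v * (- s)) * (r + s) = (t + s) * r - (r - t) * s" by simp
    also have "\<dots> = t * (r + s)" by (simp add: algebra_simps)
    finally show ?thesis using rs0 by simp
  qed
  moreover have "u *\<^sub>R (x + r *\<^sub>R w) + v *\<^sub>R (x + (- s) *\<^sub>R w) = (u + v) *\<^sub>R x + (u * r + v * (- s)) *\<^sub>R w"
    by (simp add: algebra_simps)
  ultimately have "u *\<^sub>R (x + r *\<^sub>R w) + v *\<^sub>R (x + (- s) *\<^sub>R w) = (u + v) *\<^sub>R x + t *\<^sub>R w"
    by simp
  then show "N (x + t *\<^sub>R w) < 1"
    using convex_comb_less[OF rs(1) s uv] uv by simp
qed

lemma fib_iff0:
  assumes "x \<in> fib_dom N w"
  shows "N x < 1 \<longleftrightarrow> - fib_top N w (- x) < 0 \<and> 0 < fib_top N w x"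
  using fib_iff[OF assms, of 0] by simp

lemma fib_top_shift:
  assumes "x \<in> fib_dom N w"
  shows "fib_top N w (x + t *\<^sub>R w) = fib_top N w x - t"
proof -
  have "{s. N (x + t *\<^sub>R w + s *\<^sub>R w) < 1} = (\<lambda>s. - t + s) ` {s. N (x + s *\<^sub>R w) < 1}" (is "?A = ?f ` ?B")
  proof (intro equalityI subsetI)
    fix s assume "s \<in> ?A"
    then have "t + s \<in> ?B" by (simp add: algebra_simps)
    then have "?f (t + s) \<in> ?f ` ?B" by blast
    then show "s \<in> ?f ` ?B" by simp
  qed (auto simp: algebra_simps)
  then have "fib_top N w (x + t *\<^sub>R w) = Sup (?f ` ?B)" by (simp add: fib_top_def)
  also have "\<dots> = - t + Sup ?B"
  proof (rule cSup_eq_non_empty)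
    show "?f ` ?B \<noteq> {}" using assms by (auto simp: fib_dom_def)
    show "y \<le> - t + Sup ?B" if "y \<in> ?f ` ?B" for y using that by (auto intro!: cSup_upper fib_bdd)
    show "- t + Sup ?B \<le> y" if *: "\<And>x. x \<in> ?f ` ?B \<Longrightarrow> x \<le> y" for y
    proof -
      have "Sup ?B \<le> y + t"
        using assms * by (intro cSup_least) (force simp: fib_dom_def)+
      then show ?thesis by simp
    qed
  qed
  finally show ?thesis by (simp add: fib_top_def)
qed

text \<open>A shift by \<open>t\<close> adds t to \<open>x \<bullet> w\<close> and removes t/2
  through each of the two chord ends. Constancy along \<open>w\<close> is what
  \<open>distr_fibrewise\<close> needs with e = 1, both for centring and for flipping.\<close>

lemma fib_mid_shift: "fib_mid N w (x + t *\<^sub>R w) = fib_mid N w x"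
proof (cases "x \<in> fib_dom N w")
  case True
  then have "- x \<in> fib_dom N w" by (simp add: fib_dom_minus)
  from fib_top_shift[OF this, of "- t"] fib_top_shift[OF True, of t] True
  show ?thesis by (simp add: fib_mid_def fib_dom_shift algebra_simps add_divide_distrib diff_divide_distrib)
qed (simp add: fib_mid_def fib_dom_shift)

lemma fib_dom_open: "open (fib_dom N w)"
proof -
  have "fib_dom N w = (\<Union>t. {x. N (x + t *\<^sub>R w) < 1})" by (auto simp: fib_dom_def)
  also have "open \<dots>" by (intro open_UN ballI open_Collect_less continuous_intros)
  finally show ?thesis .
qed

lemma fib_dom_comb:
  assumes "N (x + s *\<^sub>R w) < 1" "N (y + r *\<^sub>R w) < 1" "0 \<le> u" "0 \<le> v" "u + v = 1"
  shows "N ((u *\<^sub>R x + v *\<^sub>R y) + (u * s + v * r) *\<^sub>R w) < 1"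
proof -
  have "u *\<^sub>R (x + s *\<^sub>R w) + v *\<^sub>R (y + r *\<^sub>R w) = (u *\<^sub>R x + v *\<^sub>R y) + (u * s + v * r) *\<^sub>R w"
    by (simp add: algebra_simps)
  with convex_comb_less[OF assms] show ?thesis by simp
qed

lemma fib_dom_convex: "convex (fib_dom N w)"
  unfolding convex_def using fib_dom_comb by (fastforce simp: fib_dom_def)

text \<open>Convex combinations of points on two chords lie on the intermediate chord. Concavity on
  an open set yields continuity, from which the continuity and measurability of
  \<open>fib_mid\<close> follow.\<close>

lemma fib_top_concave: "convex_on (fib_dom N w) (\<lambda>x. - fib_top N w x)"
proof (rule convex_onI)
  fix t x y assume t: "0 < (t::real)" "t < 1" and xy: "x \<in> fib_dom N w" "y \<in> fib_dom N w"
  have "(1 - t) * fib_top N w x + t * fib_top N w y \<le> fib_top N w ((1 - t) *\<^sub>R x + t *\<^sub>R y)"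
  proof (rule field_le_epsilon)
    fix e :: real assume "0 < e"
    obtain r where "N (x + r *\<^sub>R w) < 1" "fib_top N w x - e < r"
      by (rule less_fib_top[OF xy(1), of "fib_top N w x - e"]) (use \<open>0 < e\<close> in auto)
    moreover obtain s where "N (y + s *\<^sub>R w) < 1" "fib_top N w y - e < s"
      by (rule less_fib_top[OF xy(2), of "fib_top N w y - e"]) (use \<open>0 < e\<close> in auto)
    ultimately have rs: "N (x + r *\<^sub>R w) < 1" "fib_top N w x - e < r" "N (y + s *\<^sub>R w) < 1" "fib_top N w y - e < s"
      by auto
    have "(1 - t) * r + t * s < fib_top N w ((1 - t) *\<^sub>R x + t *\<^sub>R y)"
      using fib_dom_comb[OF rs(1,3), of "1 - t" t] t by (intro fib_less_top) simp
    moreover have "(1 - t) * (fib_top N w x - e) + t * (fib_top N w y - e) \<le> (1 - t) * r + t * s"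
      using t rs by (intro add_mono mult_left_mono) auto
    ultimately show "(1 - t) * fib_top N w x + t * fib_top N w y \<le> fib_top N w ((1 - t) *\<^sub>R x + t *\<^sub>R y) + e"
      by (simp add: algebra_simps)
  qed
  then show "- fib_top N w ((1 - t) *\<^sub>R x + t *\<^sub>R y) \<le> (1 - t) * - fib_top N w x + t * - fib_top N w y"
    by simp
qed (rule fib_dom_convex)

lemma fib_mid_continuous: "continuous_on (fib_dom N w) (fib_mid N w)"
proof -
  have 1: "continuous_on (fib_dom N w) (\<lambda>x. - fib_top N w x)"
    by (rule convex_on_continuous[OF fib_dom_open fib_top_concave])
  then have 2: "continuous_on (fib_dom N w) (\<lambda>x. - fib_top N w (- x))"
    by (rule continuous_on_compose2) (auto intro!: continuous_intros simp: fib_dom_minus)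
  have "continuous_on (fib_dom N w) (\<lambda>x. x \<bullet> w + (- (- fib_top N w x) + - fib_top N w (- x)) / 2)"
    by (intro continuous_intros 1 2) auto
  then show ?thesis
    by (subst continuous_on_cong[OF refl, where g = "\<lambda>x. x \<bullet> w + (- (- fib_top N w x) + - fib_top N w (- x)) / 2"])
       (auto simp: fib_mid_def)
qed

lemma fib_mid_measurable [measurable]: "fib_mid N w \<in> borel_measurable borel"
proof -
  have "(\<lambda>x. indicator (fib_dom N w) x *\<^sub>R fib_mid N w x) \<in> borel_measurable borel"
    by (rule borel_measurable_continuous_on_indicator[OF _ fib_mid_continuous]) (simp add: fib_dom_open)
  moreover have "(\<lambda>x. indicator (fib_dom N w) x *\<^sub>R fib_mid N w x) = fib_mid N w"
    by (auto simp: fib_mid_def indicator_def)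
  ultimately show ?thesis by simp
qed

lemma steiner_bdd: "bdd_below (range (\<lambda>s. max (N (z + s *\<^sub>R w)) (N (reflect w z + s *\<^sub>R w))))"
  by (rule bdd_belowI[of _ 0]) (auto simp: nonneg le_max_iff_disj)

lemma steiner_less_iff: "steiner N w z < c \<longleftrightarrow> (\<exists>s. N (z + s *\<^sub>R w) < c \<and> N (reflect w z + s *\<^sub>R w) < c)"
  unfolding steiner_def by (subst cINF_less_iff[OF _ steiner_bdd]) auto

lemma steiner_le: "steiner N w z \<le> max (N (z + s *\<^sub>R w)) (N (reflect w z + s *\<^sub>R w))"
  unfolding steiner_def by (rule cINF_lower[OF steiner_bdd]) simp

lemma le_steiner: "(\<And>s. c \<le> max (N (z + s *\<^sub>R w)) (N (reflect w z + s *\<^sub>R w))) \<Longrightarrow> c \<le> steiner N w z"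
  unfolding steiner_def by (rule cINF_greatest) auto

text \<open>Shift parameters add when vectors are added and scale when vectors are scaled, so the
  infimum inherits the norm axioms. That the bounds are unchanged keeps the symmetral admissible in
  the minimization.\<close>

lemma steiner_norm_fn: "norm_fn a b (steiner N w)"
proof
  show "0 < a" by (rule a_pos)
next
  fix x y
  have 1: "steiner N w (x + y) - max (N (y + t *\<^sub>R w)) (N (reflect w y + t *\<^sub>R w)) \<le> steiner N w x" for t
  proof (rule le_steiner)
    fix s
    have "N (x + y + (s + t) *\<^sub>R w) \<le> N (x + s *\<^sub>R w) + N (y + t *\<^sub>R w)"
      using subadd[of "x + s *\<^sub>R w" "y + t *\<^sub>R w"] by (simp add: algebra_simps)
    moreover have "N (reflect w (x + y) + (s + t) *\<^sub>R w) \<le> N (reflect w x + s *\<^sub>R w) + N (reflect w y + t *\<^sub>R w)"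
      using subadd[of "reflect w x + s *\<^sub>R w" "reflect w y + t *\<^sub>R w"] by (simp add: reflect_def algebra_simps)
    ultimately show "steiner N w (x + y) - max (N (y + t *\<^sub>R w)) (N (reflect w y + t *\<^sub>R w))
        \<le> max (N (x + s *\<^sub>R w)) (N (reflect w x + s *\<^sub>R w))"
      using steiner_le[of "x + y" "s + t"] by linarith
  qed
  have "steiner N w (x + y) - steiner N w x \<le> steiner N w y"
    by (rule le_steiner) (use 1 in \<open>simp add: algebra_simps\<close>)
  then show "steiner N w (x + y) \<le> steiner N w x + steiner N w y" by simp
next
  fix t x
  have *: "\<bar>t\<bar> * steiner N w x \<le> steiner N w (t *\<^sub>R x)" if "t \<noteq> 0" for t x
  proof (rule le_steiner)
    fix s
    have "t *\<^sub>R x + s *\<^sub>R w = t *\<^sub>R (x + (s / t) *\<^sub>R w)" "reflect w (t *\<^sub>R x) + s *\<^sub>R w = t *\<^sub>R (reflect w x + (s / t) *\<^sub>R w)"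
      using that by (simp_all add: reflect_def algebra_simps)
    then have "N (t *\<^sub>R x + s *\<^sub>R w) = \<bar>t\<bar> * N (x + (s / t) *\<^sub>R w)"
      "N (reflect w (t *\<^sub>R x) + s *\<^sub>R w) = \<bar>t\<bar> * N (reflect w x + (s / t) *\<^sub>R w)"
      by (simp_all only: homog)
    then show "\<bar>t\<bar> * steiner N w x \<le> max (N (t *\<^sub>R x + s *\<^sub>R w)) (N (reflect w (t *\<^sub>R x) + s *\<^sub>R w))"
      using mult_left_mono[OF steiner_le[of x "s / t"], of "\<bar>t\<bar>"] by (simp add: max_mult_distrib_left)
  qed
  show "steiner N w (t *\<^sub>R x) = \<bar>t\<bar> * steiner N w x"
  proof (cases "t = 0")
    case True
    have "steiner N w 0 \<le> 0" using steiner_le[of 0 0] by (simp add: reflect_def)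
    moreover have "0 \<le> steiner N w 0" by (rule le_steiner) (simp add: nonneg le_max_iff_disj)
    ultimately show ?thesis using True by simp
  next
    case False
    with *[of t x] *[of "1 / t" "t *\<^sub>R x"] show ?thesis by (simp add: field_simps)
  qed
next
  fix x
  show "a * norm x \<le> steiner N w x"
  proof (rule le_steiner)
    fix s
    have "(norm x)\<^sup>2 \<le> (max (norm (x + s *\<^sub>R w)) (norm (reflect w x + s *\<^sub>R w)))\<^sup>2"
    proof -
      \<comment> \<open>Reflection reverses the component along \<open>w\<close>, so the cross terms
        cancel and one of the two squares is at least the square of \<open>norm x\<close>.\<close>
      have "(norm (x + s *\<^sub>R w))\<^sup>2 + (norm (reflect w x + s *\<^sub>R w))\<^sup>2 = 2 * (norm x)\<^sup>2 + 2 * s\<^sup>2"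
        unfolding power2_norm_eq_inner reflect_def by (simp add: algebra_simps inner_commute power2_eq_square)
      then have "(norm x)\<^sup>2 \<le> (norm (x + s *\<^sub>R w))\<^sup>2 \<or> (norm x)\<^sup>2 \<le> (norm (reflect w x + s *\<^sub>R w))\<^sup>2"
        using zero_le_power2[of s] by linarith
      then show ?thesis
        by (auto simp: max_def intro: order_trans power_mono)
    qed
    then have "norm x \<le> max (norm (x + s *\<^sub>R w)) (norm (reflect w x + s *\<^sub>R w))"
      by (rule power2_le_imp_le) (simp add: le_max_iff_disj)
    from mult_left_mono[OF this, of a]
    show "a * norm x \<le> max (N (x + s *\<^sub>R w)) (N (reflect w x + s *\<^sub>R w))"
      using a_pos lower[of "x + s *\<^sub>R w"] lower[of "reflect w x + s *\<^sub>R w"] by (simp add: max_mult_distrib_left)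
  qed
next
  fix x
  show "steiner N w x \<le> b * norm x"
    using steiner_le[of x 0] upper[of x] upper[of "reflect w x"] w by (simp add: norm_reflect)
qed

text \<open>Moving every chord along itself until its midpoint lies in the hyperplane orthogonal to
  \<open>w\<close> carries the ball of \<open>N\<close> onto the ball of its symmetral.\<close>

lemma steiner_mid_iff: "steiner N w (x - fib_mid N w x *\<^sub>R w) < 1 \<longleftrightarrow> N x < 1"
proof (cases "x \<in> fib_dom N w")
  case True
  define m where "m = fib_mid N w x"
  define lo hi where "lo = - fib_top N w (- x)" and "hi = fib_top N w x"
  have m: "m = x \<bullet> w + (lo + hi) / 2" using True by (simp add: m_def fib_mid_def lo_def hi_def)
  have iff: "N (x + t *\<^sub>R w) < 1 \<longleftrightarrow> lo < t \<and> t < hi" for t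
    using fib_iff[OF True, of t] by (simp add: lo_def hi_def)
  have "reflect w (x - m *\<^sub>R w) + s *\<^sub>R w = x + (s - m + lo + hi) *\<^sub>R w" for s
    unfolding reflect_diff by (simp add: m algebra_simps flip: scaleR_add_left)
  moreover have "x - m *\<^sub>R w + s *\<^sub>R w = x + (s - m) *\<^sub>R w" for s by (simp add: algebra_simps)
  ultimately have "steiner N w (x - m *\<^sub>R w) < 1 \<longleftrightarrow> (\<exists>s. lo < s - m \<and> s - m < hi \<and> lo < s - m + lo + hi \<and> s - m + lo + hi < hi)"
    by (simp only: steiner_less_iff iff) auto
  \<comment> \<open>The conditions say that u = s - m and -u both lie strictly between
    \<open>lo\<close> and \<open>hi\<close>, which is possible exactly when 0 does; u = 0 is the
    witness.\<close>
  also have "\<dots> \<longleftrightarrow> lo < 0 \<and> 0 < hi"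
  proof
    assume "lo < 0 \<and> 0 < hi"
    then show "\<exists>s. lo < s - m \<and> s - m < hi \<and> lo < s - m + lo + hi \<and> s - m + lo + hi < hi"
      by (intro exI[of _ m]) (auto simp: field_simps)
  qed auto
  also have "\<dots> \<longleftrightarrow> N x < 1" using iff[of 0] by simp
  finally show ?thesis by (simp add: m_def)
next
  case False
  then have "\<not> N (x + t *\<^sub>R w) < 1" for t by (auto simp: fib_dom_def)
  with this[of 0] False show ?thesis by (simp add: steiner_less_iff fib_mid_def)
qed

text \<open>Flipping followed by reflection reverses each chord about its midpoint, hence maps the
  ball to itself. This gives a second expression for the energy of the same pair.\<close>

lemma reflect_mid_iff: "N (reflect w (x - (2 * fib_mid N w x) *\<^sub>R w)) < 1 \<longleftrightarrow> N x < 1"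
proof (cases "x \<in> fib_dom N w")
  case True
  have "reflect w (x - (2 * fib_mid N w x) *\<^sub>R w) = x + (fib_top N w x - fib_top N w (- x)) *\<^sub>R w"
    unfolding reflect_diff using True by (simp add: fib_mid_def)
  with True show ?thesis by (auto simp: fib_iff fib_iff0)
next
  case False
  then have *: "\<not> N (x + t *\<^sub>R w) < 1" for t by (auto simp: fib_dom_def)
  have "reflect w (x - (2 * fib_mid N w x) *\<^sub>R w) = x + (- 2 * (x \<bullet> w)) *\<^sub>R w"
    using False by (simp add: reflect_def fib_mid_def)
  with *[of 0] * show ?thesis by (metis add_0_right scaleR_zero_left)
qed

lemma centre_mem: "x \<in> fib_dom N w \<Longrightarrow> N (x - (x \<bullet> w) *\<^sub>R w + fib_mid N w x *\<^sub>R w) < 1"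
proof -
  assume x: "x \<in> fib_dom N w"
  have eq: "x - (x \<bullet> w) *\<^sub>R w + fib_mid N w x *\<^sub>R w = x + ((fib_top N w x - fib_top N w (- x)) / 2) *\<^sub>R w"
    using x by (simp add: fib_mid_def algebra_simps)
  moreover have "- fib_top N w (- x) < fib_top N w x"
    using x fib_iff[OF x] by (force simp: fib_dom_def)
  ultimately show ?thesis unfolding eq fib_iff[OF x] by (simp add: field_simps)
qed

abbreviation centred :: "'a \<Rightarrow> 'a" where "centred x \<equiv> x - fib_mid N w x *\<^sub>R w"

abbreviation flipped :: "'a \<Rightarrow> 'a" where "flipped x \<equiv> x - (2 * fib_mid N w x) *\<^sub>R w"

end

section \<open>The energy decreases under Steiner symmetrization\<close>

lemma nn_integral2_add:
  assumes [measurable]: "(\<lambda>z. F (fst z) (snd z)) \<in> borel_measurable (lborel \<Otimes>\<^sub>M lborel)"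
    "(\<lambda>z. G (fst z) (snd z)) \<in> borel_measurable (lborel \<Otimes>\<^sub>M lborel)"
  shows "(\<integral>\<^sup>+x. \<integral>\<^sup>+y. F x y + G x y \<partial>lborel \<partial>lborel)
    = (\<integral>\<^sup>+x. \<integral>\<^sup>+y. F x y \<partial>lborel \<partial>lborel) + (\<integral>\<^sup>+x. \<integral>\<^sup>+y. G x y \<partial>lborel \<partial>(lborel :: 'a::euclidean_space measure))"
  using lborel.nn_integral_fst[of "\<lambda>z. F (fst z) (snd z)" "lborel :: 'a measure"]
    lborel.nn_integral_fst[of "\<lambda>z. G (fst z) (snd z)" "lborel :: 'a measure"]
    lborel.nn_integral_fst[of "\<lambda>z. F (fst z) (snd z) + G (fst z) (snd z)" "lborel :: 'a measure"]
  by (simp add: nn_integral_add)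

lemma powr_eq_imp_eq:
  fixes x y :: real
  assumes "0 < p" "0 \<le> x" "0 \<le> y" "x powr p = y powr p"
  shows "x = y"
  using powr_less_mono2[of p x y] powr_less_mono2[of p y x] assms
  by (cases x y rule: linorder_cases) auto

lemma mem_fib_dom: "N x < 1 \<Longrightarrow> x \<in> fib_dom N w"
  by (auto simp: fib_dom_def intro!: exI[of _ 0])

definition body_energy :: "real \<Rightarrow> ('a::euclidean_space \<Rightarrow> real) \<Rightarrow> ('a \<Rightarrow> real) \<Rightarrow> ennreal" where
  "body_energy p N M = (\<integral>\<^sup>+x. \<integral>\<^sup>+y. ennreal (bracket x y powr p) * ind N x * ind M y \<partial>lborel \<partial>lborel)"

context norm_fn_dir
begin

lemma nn_integral_steiner_ball:
  assumes [measurable]: "F \<in> borel_measurable borel"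
  shows "(\<integral>\<^sup>+z. F z * ind (steiner N w) z \<partial>lborel)
    = (\<integral>\<^sup>+x. F (x - fib_mid N w x *\<^sub>R w) * ind N x \<partial>lborel)"
proof -
  interpret S: norm_fn a b "steiner N w" by (rule steiner_norm_fn)
  have "distr lborel borel (\<lambda>x. x + (- fib_mid N w x) *\<^sub>R w) = lborel"
    by (rule distr_fibrewise[where e = 1]) (auto simp: fib_mid_shift)
  then have "(\<integral>\<^sup>+z. F z * ind (steiner N w) z \<partial>lborel)
    = (\<integral>\<^sup>+z. F z * ind (steiner N w) z \<partial>distr lborel borel (\<lambda>x. x + (- fib_mid N w x) *\<^sub>R w))"
    by simp
  also have "\<dots> = (\<integral>\<^sup>+x. F (x - fib_mid N w x *\<^sub>R w) * ind N x \<partial>lborel)"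
    by (subst nn_integral_distr) (auto simp: indicator_def steiner_mid_iff)
  finally show ?thesis .
qed

lemma nn_integral_reflect_ball:
  assumes [measurable]: "F \<in> borel_measurable borel"
  shows "(\<integral>\<^sup>+z. F z * ind N z \<partial>lborel)
    = (\<integral>\<^sup>+x. F (reflect w (x - (2 * fib_mid N w x) *\<^sub>R w)) * ind N x \<partial>lborel)"
proof -
  have 1: "distr lborel borel (\<lambda>x. x + (- 2 * fib_mid N w x) *\<^sub>R w) = lborel"
    by (rule distr_fibrewise[where e = 1]) (auto simp: fib_mid_shift)
  have "(\<integral>\<^sup>+z. F z * ind N z \<partial>lborel) = (\<integral>\<^sup>+z. F z * ind N z \<partial>distr lborel borel (reflect w))"
    by (simp add: distr_reflect w)
  also have "\<dots> = (\<integral>\<^sup>+z. F (reflect w z) * ind N (reflect w z) \<partial>lborel)"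
    by (subst nn_integral_distr) auto
  also have "\<dots> = (\<integral>\<^sup>+z. F (reflect w z) * ind N (reflect w z) \<partial>distr lborel borel (\<lambda>x. x + (- 2 * fib_mid N w x) *\<^sub>R w))"
    by (simp only: 1)
  also have "\<dots> = (\<integral>\<^sup>+x. F (reflect w (x - (2 * fib_mid N w x) *\<^sub>R w)) * ind N x \<partial>lborel)"
    by (subst nn_integral_distr) (auto simp: indicator_def reflect_mid_iff)
  finally show ?thesis .
qed

end

text \<open>Finiteness permits cancelling the energy when the total defect is isolated in
  \<open>defect_eq_0\<close>.\<close>

lemma body_energy_finite:
  assumes "norm_fn a b N" "norm_fn a' b' M" "0 \<le> p"
  shows "body_energy p N M < \<infinity>"
proof -
  interpret N: norm_fn a b N by fact
  interpret M: norm_fn a' b' M by fact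
  have sub: "norm x \<le> 1 / c" if "norm_fn c d K" "K x < 1" for c d K and x :: 'a
  proof -
    interpret norm_fn c d K by fact
    have "c * norm x \<le> 1" using lower[of x] that by simp
    then show ?thesis using a_pos by (simp add: field_simps)
  qed
  let ?C = "(1 / a * (1 / a')) powr p"
  have "body_energy p N M \<le> (\<integral>\<^sup>+x. \<integral>\<^sup>+y. ennreal ?C * indicator (cball (0::'a) (1 / a)) x * indicator (cball (0::'a) (1 / a')) y \<partial>lborel \<partial>lborel)"
    unfolding body_energy_def
  proof (intro nn_integral_mono)
    fix x y :: 'a
    show "ennreal (bracket x y powr p) * ind N x * ind M y
      \<le> ennreal ?C * indicator (cball 0 (1 / a)) x * indicator (cball 0 (1 / a')) y"
    proof (cases "N x < 1 \<and> M y < 1")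
      case True
      then have *: "norm x \<le> 1 / a" "norm y \<le> 1 / a'" using sub assms by blast+
      then have "bracket x y \<le> 1 / a * (1 / a')"
        using bracket_le[of x y] mult_mono[OF *] N.a_pos by (simp add: order_trans)
      then have "bracket x y powr p \<le> ?C" using \<open>0 \<le> p\<close> by (intro powr_mono2) auto
      with True * show ?thesis by (simp add: ennreal_leI)
    qed (auto simp: indicator_def)
  qed
  also have "\<dots> = (\<integral>\<^sup>+x. ennreal ?C * emeasure lborel (cball (0::'a) (1 / a')) * indicator (cball (0::'a) (1 / a)) x \<partial>lborel)"
    by (intro nn_integral_cong, subst nn_integral_cmult_indicator) (simp_all only: mult_ac, simp)
  also have "\<dots> = ennreal ?C * emeasure lborel (cball (0::'a) (1 / a)) * emeasure lborel (cball (0::'a) (1 / a'))"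
    by (subst nn_integral_cmult_indicator) (simp_all only: mult_ac, simp)
  also have "\<dots> < \<infinity>"
    using N.a_pos M.a_pos by (simp add: emeasure_cball ennreal_mult_less_top)
  finally show ?thesis .
qed

locale norm_pair = N: norm_fn_dir a b N w + M: norm_fn_dir a' b' M w
  for a b a' b' and N M :: "real^'n \<Rightarrow> real" and w
begin

text \<open>The gap in the midpoint inequality along the segment from a pair of points to the
  flipped pair: the pointwise energy loss under symmetrization.\<close>

definition defect :: "real \<Rightarrow> real^'n \<Rightarrow> real^'n \<Rightarrow> real" where
  "defect p x y = (bracket x y powr p
      + bracket (N.flipped x) (M.flipped y) powr p) / 2
      - bracket (N.centred x) (M.centred y) powr p"

lemma defect_nonneg: "1 \<le> p \<Longrightarrow> 0 \<le> defect p x y"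
  using bracket_powr_midpoint[of p x "fib_mid N w x" w y "fib_mid M w y"] by (simp add: defect_def)

lemma defect_measurable [measurable]: "(\<lambda>z. defect p (fst z) (snd z)) \<in> borel_measurable (borel \<Otimes>\<^sub>M borel)"
  unfolding defect_def by measurable

text \<open>The energy of the pair is the integral over the original points and, by reversing all
  chords, also over the flipped points; the symmetrized energy is the integral over the centred
  points between them. The identity is additive because the values are extended nonnegative
  reals.\<close>

lemma body_energy_steiner:
  assumes "1 \<le> p"
  shows "body_energy p (steiner N w) (steiner M w)
    + (\<integral>\<^sup>+x. \<integral>\<^sup>+y. ennreal (defect p x y) * ind N x * ind M y \<partial>lborel \<partial>lborel)
    = body_energy p N M" (is "?S + ?D = _")
proof -
  interpret SN: norm_fn a b "steiner N w" by (rule N.steiner_norm_fn)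
  interpret SM: norm_fn a' b' "steiner M w" by (rule M.steiner_norm_fn)
  let ?i = "\<lambda>x y. ind N x * ind M y :: ennreal"
  have S: "?S = (\<integral>\<^sup>+x. \<integral>\<^sup>+y. ennreal (bracket (N.centred x) (M.centred y) powr p) * ?i x y \<partial>lborel \<partial>lborel)"
  proof -
    have "?S = (\<integral>\<^sup>+x. (\<integral>\<^sup>+y. ennreal (bracket x y powr p) * ind (steiner M w) y \<partial>lborel) * ind (steiner N w) x \<partial>lborel)"
      unfolding body_energy_def by (intro nn_integral_cong) (auto simp: indicator_def)
    also have "\<dots> = (\<integral>\<^sup>+x. (\<integral>\<^sup>+y. ennreal (bracket x (M.centred y) powr p) * ind M y \<partial>lborel) * ind (steiner N w) x \<partial>lborel)"
      by (subst M.nn_integral_steiner_ball) auto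
    also have "\<dots> = (\<integral>\<^sup>+x. (\<integral>\<^sup>+y. ennreal (bracket (N.centred x) (M.centred y) powr p) * ind M y \<partial>lborel) * ind N x \<partial>lborel)"
      by (subst N.nn_integral_steiner_ball) auto
    also have "\<dots> = (\<integral>\<^sup>+x. \<integral>\<^sup>+y. ennreal (bracket (N.centred x) (M.centred y) powr p) * ?i x y \<partial>lborel \<partial>lborel)"
      by (intro nn_integral_cong) (auto simp: indicator_def)
    finally show ?thesis .
  qed
  have R: "body_energy p N M = (\<integral>\<^sup>+x. \<integral>\<^sup>+y. ennreal (bracket (N.flipped x) (M.flipped y) powr p) * ?i x y \<partial>lborel \<partial>lborel)"
  proof -
    have "body_energy p N M = (\<integral>\<^sup>+x. (\<integral>\<^sup>+y. ennreal (bracket x y powr p) * ind M y \<partial>lborel) * ind N x \<partial>lborel)"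
      unfolding body_energy_def by (intro nn_integral_cong) (auto simp: indicator_def)
    also have "\<dots> = (\<integral>\<^sup>+x. (\<integral>\<^sup>+y. ennreal (bracket x (reflect w (M.flipped y)) powr p) * ind M y \<partial>lborel) * ind N x \<partial>lborel)"
      by (subst M.nn_integral_reflect_ball) auto
    also have "\<dots> = (\<integral>\<^sup>+x. (\<integral>\<^sup>+y. ennreal (bracket (reflect w (N.flipped x)) (reflect w (M.flipped y)) powr p) * ind M y \<partial>lborel) * ind N x \<partial>lborel)"
      by (subst N.nn_integral_reflect_ball) auto
    also have "\<dots> = (\<integral>\<^sup>+x. \<integral>\<^sup>+y. ennreal (bracket (N.flipped x) (M.flipped y) powr p) * ?i x y \<partial>lborel \<partial>lborel)"
      by (intro nn_integral_cong) (auto simp: indicator_def bracket_reflect N.w)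
    finally show ?thesis .
  qed
  have P: "body_energy p N M = (\<integral>\<^sup>+x. \<integral>\<^sup>+y. ennreal (bracket x y powr p) * ?i x y \<partial>lborel \<partial>lborel)"
    unfolding body_energy_def by (simp add: mult.assoc)
  have D: "?D = (\<integral>\<^sup>+x. \<integral>\<^sup>+y. ennreal (defect p x y) * ?i x y \<partial>lborel \<partial>lborel)" by (simp add: mult.assoc)
  have [measurable]: "(\<lambda>z. bracket (fst z - fib_mid N w (fst z) *\<^sub>R w) (snd z - fib_mid M w (snd z) *\<^sub>R w)) \<in> borel_measurable (lborel \<Otimes>\<^sub>M lborel)"
    "(\<lambda>z. bracket (fst z - (2 * fib_mid N w (fst z)) *\<^sub>R w) (snd z - (2 * fib_mid M w (snd z)) *\<^sub>R w)) \<in> borel_measurable (lborel \<Otimes>\<^sub>M lborel)"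
    "(\<lambda>z. bracket (fst z) (snd z)) \<in> borel_measurable (lborel \<Otimes>\<^sub>M (lborel :: (real^'n) measure))"
    "(\<lambda>z. defect p (fst z) (snd z)) \<in> borel_measurable (lborel \<Otimes>\<^sub>M lborel)"
    "(\<lambda>z. ?i (fst z) (snd z)) \<in> borel_measurable (lborel \<Otimes>\<^sub>M lborel)"
    unfolding defect_def by measurable
  let ?A = "\<lambda>x y. ennreal (bracket (N.centred x) (M.centred y) powr p) * ?i x y"
  let ?B = "\<lambda>x y. ennreal (defect p x y) * ?i x y"
  have AB: "(\<integral>\<^sup>+x. \<integral>\<^sup>+y. ?A x y + ?B x y \<partial>lborel \<partial>lborel) = ?S + ?D"
    unfolding S D by (rule nn_integral2_add) measurable
  \<comment> \<open>Doubling avoids halves among extended nonnegative reals; the factor 2 is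
    cancelled at the end.\<close>
  have "2 * (?S + ?D) = (\<integral>\<^sup>+x. \<integral>\<^sup>+y. ?A x y + ?B x y \<partial>lborel \<partial>lborel) + (\<integral>\<^sup>+x. \<integral>\<^sup>+y. ?A x y + ?B x y \<partial>lborel \<partial>lborel)"
    unfolding AB by (rule mult_2)
  also have "\<dots> = (\<integral>\<^sup>+x. \<integral>\<^sup>+y. (?A x y + ?B x y) + (?A x y + ?B x y) \<partial>lborel \<partial>lborel)"
    by (rule nn_integral2_add[symmetric]) measurable
  also have "\<dots> = (\<integral>\<^sup>+x. \<integral>\<^sup>+y. ennreal (bracket x y powr p) * ?i x y + ennreal (bracket (N.flipped x) (M.flipped y) powr p) * ?i x y \<partial>lborel \<partial>lborel)"
  proof (intro nn_integral_cong)
    fix x y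
    have "2 * (ennreal (bracket (N.centred x) (M.centred y) powr p) + ennreal (defect p x y))
      = ennreal (2 * (bracket (N.centred x) (M.centred y) powr p + defect p x y))"
      using defect_nonneg[OF assms, of x y] by (simp add: ennreal_mult)
    also have "2 * (bracket (N.centred x) (M.centred y) powr p + defect p x y)
      = bracket x y powr p + bracket (N.flipped x) (M.flipped y) powr p"
      unfolding defect_def by argo
    also have "ennreal \<dots> = ennreal (bracket x y powr p) + ennreal (bracket (N.flipped x) (M.flipped y) powr p)"
      by (intro ennreal_plus) auto
    finally show "(?A x y + ?B x y) + (?A x y + ?B x y)
      = ennreal (bracket x y powr p) * ?i x y + ennreal (bracket (N.flipped x) (M.flipped y) powr p) * ?i x y"
      by (simp only: distrib_right[symmetric] mult.assoc[symmetric] mult_2[symmetric])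
  qed
  also have "\<dots> = (\<integral>\<^sup>+x. \<integral>\<^sup>+y. ennreal (bracket x y powr p) * ?i x y \<partial>lborel \<partial>lborel)
      + (\<integral>\<^sup>+x. \<integral>\<^sup>+y. ennreal (bracket (N.flipped x) (M.flipped y) powr p) * ?i x y \<partial>lborel \<partial>lborel)"
    by (rule nn_integral2_add) measurable
  also have "\<dots> = body_energy p N M + body_energy p N M"
    by (rule arg_cong2[where f = "(+)", OF P[symmetric] R[symmetric]])
  finally have "2 * (?S + ?D) = 2 * body_energy p N M" by (simp add: mult_2)
  then show ?thesis by (subst (asm) ennreal_mult_cancel_left) auto
qed

text \<open>A vanishing integral gives a zero almost everywhere; the defect is continuous on the
  open product of the balls, so a positive value would persist on an open set of positive
  measure.\<close>

lemma defect_eq_0: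
  assumes p: "1 \<le> p" and le: "body_energy p N M \<le> body_energy p (steiner N w) (steiner M w)"
    and x: "N x < 1" and y: "M y < 1"
  shows "defect p x y = 0"
proof (rule ccontr)
  assume ne: "defect p x y \<noteq> 0"
  define O' where "O' = {z. N (fst z) < 1 \<and> M (snd z) < 1}"
  have opO: "open O'"
    unfolding O'_def by (intro open_Collect_conj open_Collect_less N.continuous_compose M.continuous_compose continuous_intros)
  have cont: "continuous_on O' (\<lambda>z. defect p (fst z) (snd z))"
  proof -
    have 1: "continuous_on O' (\<lambda>z. fib_mid N w (fst z))"
      by (rule continuous_on_compose2[OF N.fib_mid_continuous]) (auto intro!: continuous_intros mem_fib_dom simp: O'_def)
    have 2: "continuous_on O' (\<lambda>z. fib_mid M w (snd z))"
      by (rule continuous_on_compose2[OF M.fib_mid_continuous]) (auto intro!: continuous_intros mem_fib_dom simp: O'_def)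
    show ?thesis unfolding defect_def using p by (intro continuous_intros continuous_on_powr' 1 2) auto
  qed
  define V where "V = {z \<in> O'. defect p (fst z) (snd z) \<in> {0<..}}"
  have "open V" using continuous_open_preimage[OF cont opO, of "{0<..}"] by (simp add: V_def vimage_def Int_def)
  moreover have "(x, y) \<in> V"
    using x y ne defect_nonneg[OF p, of x y] by (auto simp: V_def O'_def)
  ultimately have "\<not> negligible V" using open_not_negligible by blast
  have fin: "body_energy p (steiner N w) (steiner M w) \<noteq> \<infinity>"
    using body_energy_finite[OF N.steiner_norm_fn M.steiner_norm_fn, of p] p by simp
  define D where "D = (\<integral>\<^sup>+x. \<integral>\<^sup>+y. ennreal (defect p x y) * ind N x * ind M y \<partial>lborel \<partial>lborel)"
  have "body_energy p (steiner N w) (steiner M w) + D \<le> body_energy p (steiner N w) (steiner M w) + 0"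
    using body_energy_steiner[OF p] le by (simp add: D_def)
  then have "D = 0"
    using fin by (subst (asm) ennreal_add_left_cancel_le) auto
  then have "(\<integral>\<^sup>+z. ennreal (defect p (fst z) (snd z)) * ind N (fst z) * ind M (snd z) \<partial>(lborel \<Otimes>\<^sub>M lborel)) = 0"
    unfolding D_def by (subst lborel.nn_integral_fst[symmetric]) auto
  then have "AE z in lborel \<Otimes>\<^sub>M lborel. ennreal (defect p (fst z) (snd z)) * ind N (fst z) * ind M (snd z) = 0"
    by (subst (asm) nn_integral_0_iff_AE) auto
  then have "AE z in lborel. z \<notin> V"
    unfolding lborel_prod by eventually_elim (auto simp: V_def O'_def indicator_def)
  then have "V \<in> null_sets lborel"
    using \<open>open V\<close> by (subst AE_iff_null_sets) auto
  then have "negligible V" by (simp add: negligible_iff_null_sets null_sets_completionI)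
  with \<open>\<not> negligible V\<close> show False by simp
qed

end

text \<open>The wedge product splits into that of x and y and that of w and m y - l x, which are
  orthogonal to each other.\<close>

lemma bracket_orthogonal_sq:
  assumes "norm w = 1" "x \<bullet> w = 0" "y \<bullet> w = 0"
  shows "(bracket (x + m *\<^sub>R w) (y + l *\<^sub>R w))\<^sup>2 = (bracket x y)\<^sup>2 + (norm (m *\<^sub>R y - l *\<^sub>R x))\<^sup>2"
  using assms unfolding bracket_sq power2_norm_eq_inner norm_eq_1
  by (simp add: inner_add_left inner_add_right inner_diff_left inner_diff_right inner_commute power2_eq_square algebra_simps)

context norm_pair
begin

text \<open>At the midpoints of two chords, the reflected pair has the same bracket, so that equality in the
  midpoint inequality forces the bracket not to change along the segment.\<close>
lemma mid_proportional:
  assumes p: "1 \<le> p" and le: "body_energy p N M \<le> body_energy p (steiner N w) (steiner M w)"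
    and x: "x \<in> fib_dom N w" and y: "y \<in> fib_dom M w"
  shows "fib_mid N w x *\<^sub>R (y - (y \<bullet> w) *\<^sub>R w) = fib_mid M w y *\<^sub>R (x - (x \<bullet> w) *\<^sub>R w)"
proof -
  define x0 y0 m l where "x0 = x - (x \<bullet> w) *\<^sub>R w" and "y0 = y - (y \<bullet> w) *\<^sub>R w"
    and "m = fib_mid N w x" and "l = fib_mid M w y"
  have orth: "x0 \<bullet> w = 0" "y0 \<bullet> w = 0" by (simp_all add: x0_def y0_def inner_diff_left)
  have mid: "fib_mid N w (x0 + m *\<^sub>R w) = m" "fib_mid M w (y0 + l *\<^sub>R w) = l"
  proof -
    have "x0 + m *\<^sub>R w = x + (m - x \<bullet> w) *\<^sub>R w" "y0 + l *\<^sub>R w = y + (l - y \<bullet> w) *\<^sub>R w"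
      by (simp_all add: x0_def y0_def scaleR_left_diff_distrib)
    then show "fib_mid N w (x0 + m *\<^sub>R w) = m" "fib_mid M w (y0 + l *\<^sub>R w) = l"
      by (simp_all only: N.fib_mid_shift M.fib_mid_shift m_def l_def)
  qed
  have d0: "defect p (x0 + m *\<^sub>R w) (y0 + l *\<^sub>R w) = 0"
    using N.centre_mem[OF x] M.centre_mem[OF y]
    unfolding x0_def y0_def m_def l_def by (intro defect_eq_0 p le)
  have flip: "u + c *\<^sub>R w - (2 * c) *\<^sub>R w = u + (- c) *\<^sub>R w" "u + c *\<^sub>R w - c *\<^sub>R w = u" for u c
  proof -
    have "u + c *\<^sub>R w - (2 * c) *\<^sub>R w = u + (c - 2 * c) *\<^sub>R w" by (simp only: scaleR_left_diff_distrib add_diff_eq)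
    then show "u + c *\<^sub>R w - (2 * c) *\<^sub>R w = u + (- c) *\<^sub>R w" by simp
  qed simp
  have flip2: "bracket (x0 + (- m) *\<^sub>R w) (y0 + (- l) *\<^sub>R w) = bracket (x0 + m *\<^sub>R w) (y0 + l *\<^sub>R w)"
  proof -
    have "(- m) *\<^sub>R y0 - (- l) *\<^sub>R x0 = - (m *\<^sub>R y0 - l *\<^sub>R x0)" by simp
    then have "norm ((- m) *\<^sub>R y0 - (- l) *\<^sub>R x0) = norm (m *\<^sub>R y0 - l *\<^sub>R x0)" by (simp only: norm_minus_cancel)
    then have "(bracket (x0 + (- m) *\<^sub>R w) (y0 + (- l) *\<^sub>R w))\<^sup>2 = (bracket (x0 + m *\<^sub>R w) (y0 + l *\<^sub>R w))\<^sup>2"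
      by (simp only: bracket_orthogonal_sq[OF N.w orth])
    then show ?thesis by (simp only: power2_eq_iff_nonneg bracket_nonneg)
  qed
  have "bracket (x0 + m *\<^sub>R w) (y0 + l *\<^sub>R w) powr p = bracket x0 y0 powr p"
    using d0 unfolding defect_def mid flip flip2 by argo
  then have "bracket (x0 + m *\<^sub>R w) (y0 + l *\<^sub>R w) = bracket x0 y0"
    by (rule powr_eq_imp_eq[rotated 3]) (use p in simp_all)
  then have "(norm (m *\<^sub>R y0 - l *\<^sub>R x0))\<^sup>2 = 0"
    using bracket_orthogonal_sq[OF N.w orth, of m l] by (simp only: add_cancel_left_right)
  then have "m *\<^sub>R y0 = l *\<^sub>R x0" by simp
  then show ?thesis unfolding x0_def y0_def m_def l_def .
qed

end

section \<open>Rigidity of stationary pairs\<close>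

text \<open>Homogeneity moves the level 1 to any value strictly between \<open>f x\<close> and
  \<open>g x\<close>, so comparing unit balls compares the functions.\<close>

lemma homog_le:
  fixes f g :: "'a::real_vector \<Rightarrow> real"
  assumes f: "\<And>s x. 0 < s \<Longrightarrow> f (s *\<^sub>R x) = s * f x" "\<And>x. 0 \<le> f x"
    and g: "\<And>s x. 0 < s \<Longrightarrow> g (s *\<^sub>R x) = s * g x"
    and le: "\<And>x. f x < 1 \<Longrightarrow> g x < 1"
  shows "g x \<le> f x"
proof (rule ccontr)
  assume "\<not> g x \<le> f x"
  define c where "c = (f x + g x) / 2"
  have c: "0 < c" "f x < c" "c < g x"
    using \<open>\<not> g x \<le> f x\<close> f(2)[of x] by (auto simp: c_def)
  have "f ((1 / c) *\<^sub>R x) < 1" using c f(1)[of "1 / c" x] by simp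
  then have "g ((1 / c) *\<^sub>R x) < 1" by (rule le)
  then show False using c g[of "1 / c" x] by simp
qed

text \<open>For a unit vector \<open>w\<close> orthogonal to \<open>e\<close>, this is the
  reflection in direction \<open>w\<close> whose mirror is the hyperplane
  \<open>x \<bullet> w = k * (x \<bullet> e)\<close>; \<open>k = 0\<close> gives
  \<open>reflect\<close>.\<close>

definition oblique :: "'a::euclidean_space \<Rightarrow> 'a \<Rightarrow> real \<Rightarrow> 'a \<Rightarrow> 'a" where
  "oblique w e k x = x - (2 * (x \<bullet> w) - 2 * k * (x \<bullet> e)) *\<^sub>R w"

lemma oblique_scaleR: "oblique w e k (s *\<^sub>R x) = s *\<^sub>R oblique w e k x"
  by (simp add: oblique_def algebra_simps)

lemma oblique_oblique:
  assumes "norm w = 1" "e \<bullet> w = 0"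
  shows "oblique w e k (oblique w e k x) = x"
proof -
  define l where "l = 2 * (x \<bullet> w) - 2 * k * (x \<bullet> e)"
  have "(x - l *\<^sub>R w) \<bullet> w = x \<bullet> w - l" "(x - l *\<^sub>R w) \<bullet> e = x \<bullet> e"
    using assms by (simp_all add: inner_diff_left norm_eq_1) (simp add: inner_commute)
  then have "2 * ((x - l *\<^sub>R w) \<bullet> w) - 2 * k * ((x - l *\<^sub>R w) \<bullet> e) = - l"
    by (simp only:) (simp add: l_def)
  then have "oblique w e k (x - l *\<^sub>R w) = x - l *\<^sub>R w - (- l) *\<^sub>R w"
    unfolding oblique_def by (simp only:)
  moreover have "oblique w e k x = x - l *\<^sub>R w" by (simp only: oblique_def l_def)
  ultimately show ?thesis by simp
qed

lemma distr_oblique: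
  assumes "norm w = 1" "e \<bullet> w = 0"
  shows "distr lborel borel (oblique w e k) = lborel"
proof -
  have "distr lborel borel (\<lambda>x. x + (- (2 * (x \<bullet> w) - 2 * k * (x \<bullet> e))) *\<^sub>R w) = lborel"
    by (rule distr_fibrewise[where e = "-1"])
       (use assms in \<open>auto simp: inner_add_left norm_eq_1 inner_commute algebra_simps\<close>)
  moreover have "(\<lambda>x. x + (- (2 * (x \<bullet> w) - 2 * k * (x \<bullet> e))) *\<^sub>R w) = oblique w e k"
    by (rule ext) (simp only: oblique_def scaleR_minus_left diff_conv_add_uminus)
  ultimately show ?thesis by simp
qed

text \<open>When the midpoints lie on the mirror, chord reversal is the oblique reflection. One
  inclusion of balls suffices because the map is an involution.\<close>

lemma (in norm_fn) oblique_invariant: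
  assumes "norm_fn_dir a b N w" and e: "e \<bullet> w = 0"
    and mid: "\<And>x. N x < 1 \<Longrightarrow> fib_mid N w x = k * (x \<bullet> e)"
  shows "N (oblique w e k x) = N x"
proof -
  interpret norm_fn_dir a b N w by fact
  have le: "N (oblique w e k x) \<le> N x" for x
  proof (rule homog_le[where f = N and g = "\<lambda>x. N (oblique w e k x)"])
    fix x assume x: "N x < 1"
    have "reflect w (x - (2 * fib_mid N w x) *\<^sub>R w) = oblique w e k x"
      unfolding reflect_diff mid[OF x] oblique_def by (simp add: algebra_simps)
    then show "N (oblique w e k x) < 1" using reflect_mid_iff[of x] x by simp
  qed (simp_all add: homog_pos oblique_scaleR nonneg)
  from le[of x] le[of "oblique w e k x"] show ?thesis
    by (simp add: oblique_oblique[OF w e])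
qed

text \<open>What is kept of minimality: no single symmetrization lowers the energy. Minimizers have
  this property, and so do pairs with equality, so one rigidity argument serves for both.\<close>

locale stationary_pair = N: norm_fn a b N + M: norm_fn a' b' M
  for a b a' b' and N M :: "real^'n \<Rightarrow> real" +
  fixes p :: real
  assumes p: "1 \<le> p"
    and stationary: "\<And>w. norm w = 1 \<Longrightarrow> body_energy p N M \<le> body_energy p (steiner N w) (steiner M w)"
    and card: "2 \<le> CARD('n)"
begin

text \<open>The \<open>e\<close>-component of \<open>mid_proportional\<close> reads m(x) (y.e) =
  l(y) (x.e); fixing one point \<open>d *\<^sub>R e\<close> inside both balls separates the
  variables and yields the same slope for both bodies.\<close>

lemma mid_linear:
  assumes w: "norm w = 1" and e: "norm e = 1" "e \<bullet> w = 0"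
  obtains k where "\<And>x. N x < 1 \<Longrightarrow> fib_mid N w x = k * (x \<bullet> e)"
    "\<And>x. M x < 1 \<Longrightarrow> fib_mid M w x = k * (x \<bullet> e)"
proof -
  interpret norm_pair a b a' b' N M w
    by unfold_locales (rule w)+
  have "\<exists>d>0. N (d *\<^sub>R e) < 1 \<and> M (d *\<^sub>R e) < 1"
  proof -
    have "0 \<le> N e" "0 \<le> M e" by (rule N.nonneg, rule M.nonneg)
    define d where "d = 1 / (N e + M e + 1)"
    have "0 < d" "d * N e < 1" "d * M e < 1"
      using \<open>0 \<le> N e\<close> \<open>0 \<le> M e\<close> by (simp_all add: d_def field_simps)
    then show ?thesis by (auto simp: N.homog M.homog intro!: exI[of _ d])
  qed
  then obtain d where d: "0 < d" "N (d *\<^sub>R e) < 1" "M (d *\<^sub>R e) < 1" by blast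
  have prp: "fib_mid N w x *\<^sub>R (y - (y \<bullet> w) *\<^sub>R w) = fib_mid M w y *\<^sub>R (x - (x \<bullet> w) *\<^sub>R w)"
    if "N x < 1" "M y < 1" for x y
    by (rule mid_proportional[OF p stationary[OF w]]) (use that in \<open>auto intro: mem_fib_dom\<close>)
  have ew: "w \<bullet> e = 0" "e \<bullet> e = 1" using e by (simp_all add: inner_commute norm_eq_1)
  have prp': "fib_mid N w x * (y \<bullet> e) = fib_mid M w y * (x \<bullet> e)" if "N x < 1" "M y < 1" for x y
    using arg_cong[OF prp[OF that], of "\<lambda>z. z \<bullet> e"] by (simp add: inner_diff_left ew)
  define k where "k = fib_mid M w (d *\<^sub>R e) / d"
  have kN: "fib_mid N w x = k * (x \<bullet> e)" if "N x < 1" for x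
    using prp'[OF that d(3)] d(1) by (simp add: k_def ew field_simps)
  have kM: "fib_mid M w x = k * (x \<bullet> e)" if "M x < 1" for x
    using prp'[OF d(2) that] kN[OF d(2)] d(1) by (simp add: ew)
  show thesis by (rule that[OF kN kM])
qed

lemma oblique_symmetry:
  assumes w: "norm w = 1"
  obtains e k where "e \<bullet> w = 0"
    "\<And>x. N (oblique w e k x) = N x" "\<And>x. M (oblique w e k x) = M x"
proof -
  obtain e0 where "e0 \<noteq> 0" "orthogonal w e0"
    using orthogonal_to_vector_exists[of w] card by auto
  define e where "e = sgn e0"
  have e: "norm e = 1" "e \<bullet> w = 0"
    using \<open>e0 \<noteq> 0\<close> \<open>orthogonal w e0\<close> by (auto simp: e_def norm_sgn sgn_div_norm orthogonal_def inner_commute)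
  obtain k where k: "\<And>x. N x < 1 \<Longrightarrow> fib_mid N w x = k * (x \<bullet> e)"
    "\<And>x. M x < 1 \<Longrightarrow> fib_mid M w x = k * (x \<bullet> e)"
    by (rule mid_linear[OF w e]) blast
  show thesis
  proof (rule that[OF e(2)])
    show "N (oblique w e k x) = N x" for x
      by (rule N.oblique_invariant[OF _ e(2) k(1)]) (unfold_locales, rule w)
    show "M (oblique w e k x) = M x" for x
      by (rule M.oblique_invariant[OF _ e(2) k(2)]) (unfold_locales, rule w)
  qed
qed

text \<open>Three dimensions leave room for two orthonormal vectors \<open>e\<close>,
  \<open>g\<close> orthogonal to \<open>w\<close>. The midpoint height is a multiple of x.e and also
  of x.g; at a multiple of \<open>e\<close> the latter vanishes, so the slope is 0.\<close>

lemma reflect_symmetry: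
  assumes w: "norm w = 1" and card3: "3 \<le> CARD('n)"
  shows "N (reflect w x) = N x" "M (reflect w x) = M x"
proof -
  obtain e0 where e0: "e0 \<noteq> 0" "orthogonal e0 w"
    using orthogonal_to_vector_exists[of w] card by (auto simp: orthogonal_commute)
  define e where "e = sgn e0"
  have e: "norm e = 1" "e \<bullet> w = 0"
    using e0 by (auto simp: e_def norm_sgn sgn_div_norm orthogonal_def)
  have "dim {w, e} \<le> card {w, e}" by (rule dim_le_card) (auto intro: span_base)
  also have "\<dots> \<le> 2" by (simp add: card_insert_if)
  finally have "dim {w, e} < DIM(real^'n)" using card3 by simp
  then obtain g0 where g0: "g0 \<noteq> 0" "\<And>y. y \<in> span {w, e} \<Longrightarrow> orthogonal g0 y"
    using orthogonal_to_subspace_exists[of "{w, e}"] by blast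
  define g where "g = sgn g0"
  have g: "norm g = 1" "g \<bullet> w = 0" "g \<bullet> e = 0"
    using g0 g0(2)[of w] g0(2)[of e] by (auto simp: g_def norm_sgn sgn_div_norm orthogonal_def span_base)
  obtain k where k: "\<And>x. N x < 1 \<Longrightarrow> fib_mid N w x = k * (x \<bullet> e)"
    "\<And>x. M x < 1 \<Longrightarrow> fib_mid M w x = k * (x \<bullet> e)"
    by (rule mid_linear[OF w e]) blast
  obtain k' where k': "\<And>x. N x < 1 \<Longrightarrow> fib_mid N w x = k' * (x \<bullet> g)"
    "\<And>x. M x < 1 \<Longrightarrow> fib_mid M w x = k' * (x \<bullet> g)"
    by (rule mid_linear[OF w g(1,2)]) blast
  define d where "d = 1 / (N e + 1)"
  have d: "0 < d" "N (d *\<^sub>R e) < 1" using N.nonneg[of e] by (simp_all add: d_def N.homog field_simps)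
  have "k = 0"
    using k(1)[OF d(2)] k'(1)[OF d(2)] d(1) e(1) g(3) by (auto simp: norm_eq_1 inner_commute)
  have "oblique w e 0 x = reflect w x" for x by (simp add: oblique_def reflect_def)
  moreover have "N (oblique w e 0 x) = N x" for x
    by (rule N.oblique_invariant[OF _ e(2)]) (unfold_locales, rule w, use k(1) \<open>k = 0\<close> in simp)
  moreover have "M (oblique w e 0 x) = M x" for x
    by (rule M.oblique_invariant[OF _ e(2)]) (unfold_locales, rule w, use k(2) \<open>k = 0\<close> in simp)
  ultimately show "N (reflect w x) = N x" "M (reflect w x) = M x" by simp_all
qed

end

lemma reflect_swap:
  assumes "norm x = norm y" "x \<noteq> y"
  shows "reflect (sgn (x - y)) x = y"
proof -
  have nz: "norm (x - y) \<noteq> 0" using assms by simp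
  have "2 * (x \<bullet> (x - y)) = (norm (x - y))\<^sup>2"
    using assms(1) by (simp add: power2_norm_eq_inner inner_diff_left inner_diff_right inner_commute norm_eq algebra_simps)
  moreover have "x \<bullet> sgn (x - y) = (x \<bullet> (x - y)) / norm (x - y)"
    unfolding sgn_div_norm inner_scaleR_right by (simp add: divide_inverse)
  ultimately have "2 * (x \<bullet> sgn (x - y)) = norm (x - y)"
    using nz by (simp add: power2_eq_square)
  moreover have "norm (x - y) *\<^sub>R sgn (x - y) = x - y" using nz by (simp add: sgn_div_norm)
  ultimately show ?thesis by (simp add: reflect_def)
qed

section \<open>Determinants and quadratic forms in the plane\<close>

lemma inner_2:
  fixes x y :: "real^'n"
  assumes "UNIV = {i, j :: 'n}" "i \<noteq> j"
  shows "x \<bullet> y = x$i * y$i + x$j * y$j"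
  using assms(2) unfolding inner_vec_def assms(1) by simp

lemma bracket_2:
  fixes x y :: "real^'n"
  assumes "UNIV = {i, j :: 'n}" "i \<noteq> j"
  shows "bracket x y = \<bar>x$i * y$j - x$j * y$i\<bar>"
proof -
  have "(bracket x y)\<^sup>2 = (x$i * y$j - x$j * y$i)\<^sup>2"
    using assms by (simp add: bracket_sq power2_norm_eq_inner inner_2[OF assms]) (simp add: power2_eq_square algebra_simps)
  then show ?thesis by (metis abs_of_nonneg bracket_nonneg power2_eq_iff_nonneg power2_abs abs_ge_zero)
qed

text \<open>In the plane the bracket is the absolute value of a determinant, and an oblique
  reflection has determinant \<open>1 - l \<bullet> w\<close>, which is -1.\<close>

lemma bracket_oblique_2:
  fixes x y :: "real^'n"
  assumes ij: "UNIV = {i, j :: 'n}" "i \<noteq> j" and w: "norm w = 1" "e \<bullet> w = 0"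
  shows "bracket (oblique w e k x) (oblique w e k y) = bracket x y"
proof -
  define l where "l = 2 *\<^sub>R w - (2 * k) *\<^sub>R e"
  have lw: "l \<bullet> w = 2" using w by (simp add: l_def inner_diff_left norm_eq_1)
  have ob: "oblique w e k x = x - (l \<bullet> x) *\<^sub>R w" for x
    by (simp add: oblique_def l_def inner_diff_left) (simp add: inner_commute)
  have "(x - (l \<bullet> x) *\<^sub>R w)$i * (y - (l \<bullet> y) *\<^sub>R w)$j - (x - (l \<bullet> x) *\<^sub>R w)$j * (y - (l \<bullet> y) *\<^sub>R w)$i
    = (x$i * y$j - x$j * y$i) * (1 - l \<bullet> w)"
    unfolding inner_2[OF ij] by (simp add: algebra_simps)
  then show ?thesis unfolding bracket_2[OF ij] ob lw by simp
qed


lemma det_card_2: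
  fixes A :: "real^'n^'n"
  assumes ij: "UNIV = {i, j :: 'n}" "i \<noteq> j"
  shows "det A = A$i$i * A$j$j - A$i$j * A$j$i"
proof -
  have f: "finite {j}" "i \<notin> {j}" using ij by auto
  show ?thesis
    unfolding det_def ij(1) sum_over_permutations_insert[OF f] permutes_sing
    using ij(2) by (simp add: sign_swap_id sign_id swap_id_eq prod.insert transpose_def)
qed

text \<open>Completing the square: A times the form is the squared length of the image under the
  triangular matrix with rows (A, B) and (0, D). Division by \<open>s\<close>, the root of A D,
  makes the determinant 1 and leaves \<open>D\<close> as the factor \<open>d\<close>.\<close>

lemma quadratic_form_2:
  fixes A B C :: real
  assumes ij: "UNIV = {i, j :: 'n::finite}" "i \<noteq> j"
    and pd: "0 < A" "0 < A * C - B\<^sup>2"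
  obtains \<phi> :: "real^'n^'n" and d where "det \<phi> = 1" "0 < d"
    "\<And>x. A * (x$i)\<^sup>2 + 2 * B * x$i * x$j + C * (x$j)\<^sup>2 = d * (norm (\<phi> *v x))\<^sup>2"
proof -
  define D where "D = sqrt (A * C - B\<^sup>2)"
  have D: "0 < D" "D\<^sup>2 = A * C - B\<^sup>2" using pd by (simp_all add: D_def)
  define s where "s = sqrt (A * D)"
  have s: "0 < s" "s\<^sup>2 = A * D" using pd D by (simp_all add: s_def)
  define \<phi> :: "real^'n^'n" where "\<phi> = (\<chi> r c. if r = i then (if c = i then A / s else B / s) else if c = i then 0 else D / s)"
  have "det \<phi> = A * D / s\<^sup>2"
    using ij(2) unfolding det_card_2[OF ij] by (simp add: \<phi>_def power2_eq_square)
  then have 1: "det \<phi> = 1" using s pd D by simp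
  have "A * (x$i)\<^sup>2 + 2 * B * x$i * x$j + C * (x$j)\<^sup>2 = D * (norm (\<phi> *v x))\<^sup>2" for x
  proof -
    have "(\<phi> *v x)$i = (A * x$i + B * x$j) / s" "(\<phi> *v x)$j = D * x$j / s"
      using ij(2) unfolding matrix_vector_mult_def ij(1) by (simp_all add: \<phi>_def add_divide_distrib)
    then have "(norm (\<phi> *v x))\<^sup>2 = ((A * x$i + B * x$j)\<^sup>2 + D\<^sup>2 * (x$j)\<^sup>2) / s\<^sup>2"
      unfolding power2_norm_eq_inner inner_2[OF ij] by (simp add: power2_eq_square add_divide_distrib[symmetric] mult_ac)
    also have "(A * x$i + B * x$j)\<^sup>2 + D\<^sup>2 * (x$j)\<^sup>2 = A * (A * (x$i)\<^sup>2 + 2 * B * x$i * x$j + C * (x$j)\<^sup>2)"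
      unfolding D(2) by (simp add: power2_eq_square algebra_simps)
    finally show ?thesis using pd D(1) unfolding s(2) by simp
  qed
  with 1 D(1) show thesis by (rule that)
qed

lemma norm_fn_bounded:
  assumes "norm_fn a b N" "N x < 1"
  shows "norm x \<le> 1 / a"
proof -
  interpret norm_fn a b N by fact
  have "a * norm x \<le> 1" using lower[of x] assms(2) by simp
  then show ?thesis using a_pos by (simp add: field_simps)
qed

context norm_fn
begin

lemma integrable_ball:
  assumes "continuous_on UNIV (g :: 'a \<Rightarrow> real)"
  shows "integrable lborel (\<lambda>z. g z * ind N z)"
proof -
  have g[measurable]: "g \<in> borel_measurable borel" using assms by (rule borel_measurable_continuous_onI)
  have "compact (g ` cball 0 (1 / a))"
    using assms by (intro compact_continuous_image) (auto intro: continuous_on_subset)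
  then obtain K where K: "\<And>z. z \<in> cball 0 (1 / a) \<Longrightarrow> norm (g z) \<le> K"
    by (meson bounded_iff compact_imp_bounded imageI)
  show ?thesis
  proof (rule Bochner_Integration.integrable_bound)
    show "integrable lborel (\<lambda>z. K * indicator (cball (0::'a) (1 / a)) z)"
      using a_pos by (intro integrable_mult_right) (simp add: integrable_indicator_iff emeasure_cball)
    show "AE z in lborel. norm (g z * ind N z) \<le> norm (K * indicator (cball (0::'a) (1 / a)) z)"
    proof (rule AE_I2)
      fix z
      show "norm (g z * ind N z) \<le> norm (K * indicator (cball (0::'a) (1 / a)) z)"
        using K[of z] norm_fn_bounded[OF norm_fn_axioms, of z] by (auto simp: indicator_def)
    qed
  qed simp
qed

end

context stationary_pair
begin

text \<open>A reflection exchanges any two vectors of equal length, so both norms depend on the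
  length only.\<close>

lemma radial_high:
  assumes card3: "3 \<le> CARD('n)"
  obtains c c' where "0 < c" "0 < c'" "\<And>x. N x = c * norm x" "\<And>x. M x = c' * norm x"
proof -
  obtain e :: "real^'n" where e: "norm e = 1" using vector_choose_size[of 1] by auto
  have sw: "N x = N y \<and> M x = M y" if "norm x = norm y" for x y
  proof (cases "x = y")
    case False
    then have "norm (sgn (x - y)) = 1" by (simp add: norm_sgn)
    from reflect_symmetry[OF this card3, of x] reflect_swap[OF that False] show ?thesis by simp
  qed simp
  have sw': "N x = N (norm x *\<^sub>R e) \<and> M x = M (norm x *\<^sub>R e)" for x
    by (rule sw) (simp add: e)
  have "N x = N e * norm x" for x by (rule trans[OF conjunct1[OF sw']]) (simp add: N.homog)
  moreover have "M x = M e * norm x" for x by (rule trans[OF conjunct2[OF sw']]) (simp add: M.homog)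
  moreover have "0 < N e" "0 < M e" using e by (auto intro!: N.pos M.pos)
  ultimately show thesis using that by blast
qed

text \<open>The form \<open>q\<close> averages the squared bracket over the ball of
  \<open>N\<close>. Each oblique symmetry preserves volume, ball and bracket, hence
  \<open>q\<close>, and therefore is the \<open>q\<close>-orthogonal reflection in its direction.
  With direction x - y it exchanges x and y whenever they have equal \<open>q\<close>-length, so
  both norms are constant on the level sets of \<open>q\<close>.\<close>

lemma elliptic_2:
  assumes card2: "CARD('n) = 2"
  obtains \<phi> :: "real^'n^'n" and c c' where "det \<phi> = 1" "0 < c" "0 < c'"
    "\<And>x. N x = c * norm (\<phi> *v x)" "\<And>x. M x = c' * norm (\<phi> *v x)"
proof -
  obtain i j :: 'n where ij: "UNIV = {i, j}" "i \<noteq> j"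
    using card2 by (metis card_2_iff)
  define mo where "mo r s = (\<integral>z. z$r * z$s * ind N z \<partial>lborel)" for r s
  \<comment> \<open>The bracket pairs the coordinate i of x with the coordinate j of z, so the
    moments appear with exchanged indices: \<open>q\<close> is the inertia form turned by a right
    angle.\<close>
  define A B C where "A = mo j j" and "B = - mo i j" and "C = mo i i"
  define q where "q x y = A * x$i * y$i + B * (x$i * y$j + x$j * y$i) + C * x$j * y$j" for x y :: "real^'n"
  have int: "integrable lborel (\<lambda>z. z$r * z$s * ind N z)" for r s
    by (rule N.integrable_ball) (intro continuous_intros)
  have q: "q x x = (\<integral>z. (bracket x z)\<^sup>2 * ind N z \<partial>lborel)" for x
  proof -
    have "(\<integral>z. (bracket x z)\<^sup>2 * ind N z \<partial>lborel)
      = (\<integral>z. (x$i)\<^sup>2 * (z$j * z$j * ind N z) - 2 * x$i * x$j * (z$i * z$j * ind N z)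
          + (x$j)\<^sup>2 * (z$i * z$i * ind N z) \<partial>lborel)"
      by (intro Bochner_Integration.integral_cong refl)
        (simp add: bracket_2[OF ij] power2_eq_square algebra_simps)
    also have "\<dots> = (x$i)\<^sup>2 * mo j j - 2 * x$i * x$j * mo i j + (x$j)\<^sup>2 * mo i i"
      unfolding mo_def using int by (simp add: Bochner_Integration.integral_add Bochner_Integration.integral_diff)
    finally show ?thesis by (simp add: q_def A_def B_def C_def power2_eq_square algebra_simps)
  qed
  have qpos: "0 < q x x" if "x \<noteq> 0" for x
  proof -
    have int2: "integrable lborel (\<lambda>z. (bracket x z)\<^sup>2 * ind N z)"
      by (rule N.integrable_ball) (intro continuous_intros)
    have "0 \<le> q x x" unfolding q by (intro integral_nonneg_AE) auto
    moreover have "q x x \<noteq> 0"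
    proof
      assume "q x x = 0"
      then have "AE z in lborel. (bracket x z)\<^sup>2 * ind N z = 0"
        unfolding q by (subst (asm) integral_nonneg_eq_0_iff_AE[OF int2]) auto
      then have "AE z in lborel. z \<notin> {z. 0 < bracket x z \<and> N z < 1}"
        by eventually_elim (auto simp: indicator_def)
      moreover have op: "open {z. 0 < bracket x z \<and> N z < 1}"
        by (intro open_Collect_conj open_Collect_less N.continuous continuous_intros)
      ultimately have "{z. 0 < bracket x z \<and> N z < 1} \<in> null_sets lborel"
        by (subst AE_iff_null_sets) auto
      then have neg: "negligible {z. 0 < bracket x z \<and> N z < 1}"
        by (simp add: negligible_iff_null_sets null_sets_completionI)
      obtain e0 where e0: "e0 \<noteq> 0" "orthogonal x e0" using orthogonal_to_vector_exists[of x] card2 by auto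
      define d where "d = 1 / (N e0 + 1)"
      have "0 < d" "N (d *\<^sub>R e0) < 1" using N.nonneg[of e0] by (simp_all add: d_def N.homog field_simps)
      moreover have "0 < bracket x e0" using e0 that by (simp add: bracket_def orthogonal_def)
      ultimately have "d *\<^sub>R e0 \<in> {z. 0 < bracket x z \<and> N z < 1}" by (simp add: bracket_scaleR_right)
      with neg op open_not_negligible show False by blast
    qed
    ultimately show ?thesis by simp
  qed
  have qdiff: "q (x - l *\<^sub>R w) (x - l *\<^sub>R w) = q x x - 2 * l * q x w + l\<^sup>2 * q w w" for x w l
    by (simp add: q_def power2_eq_square algebra_simps)
  have swap: "N x = N y \<and> M x = M y" if eq: "q x x = q y y" for x y
  proof (cases "x = y")
    case False
    define w where "w = sgn (x - y)"
    have w: "norm w = 1" using False by (simp add: w_def norm_sgn)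
    obtain e k where e: "e \<bullet> w = 0" and inv: "\<And>x. N (oblique w e k x) = N x" "\<And>x. M (oblique w e k x) = M x"
      by (rule oblique_symmetry[OF w]) blast
    let ?T = "oblique w e k"
    define l where "l x = 2 * (x \<bullet> w) - 2 * k * (x \<bullet> e)" for x
    have T: "?T x = x - l x *\<^sub>R w" for x by (simp add: oblique_def l_def)
    have [measurable]: "?T \<in> borel_measurable borel" unfolding oblique_def by measurable
    have qT: "q (?T x) (?T x) = q x x" for x
    proof -
      have "q (?T x) (?T x) = (\<integral>z. (bracket (?T x) z)\<^sup>2 * ind N z \<partial>distr lborel borel ?T)"
        unfolding q distr_oblique[OF w e] ..
      also have "\<dots> = (\<integral>z. (bracket (?T x) (?T z))\<^sup>2 * ind N (?T z) \<partial>lborel)"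
        by (rule integral_distr) measurable
      also have "\<dots> = q x x"
        unfolding q bracket_oblique_2[OF ij w e] by (simp add: indicator_def inv)
      finally show ?thesis .
    qed
    have lw: "l w = 2" using w e by (simp add: l_def norm_eq_1 inner_commute)
    have key: "l x * (l x * q w w - 2 * q x w) = 0" for x
      using qT[of x] unfolding T qdiff by (simp add: power2_eq_square algebra_simps)
    have qw: "0 < q w w" using w by (intro qpos) auto
    \<comment> \<open>\<open>key\<close> decides only where \<open>l x\<close> is nonzero; a point
      with \<open>l x = 0\<close> is replaced by \<open>x + w\<close>, where \<open>l\<close> equals
      2, and linearity carries the identity back.\<close>
    have l: "l x * q w w = 2 * q x w" for x
    proof (cases "l x = 0")
      case True
      have "l (x + w) = 2" "q (x + w) w = q x w + q w w"
        using True lw by (simp_all add: l_def q_def algebra_simps)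
      with key[of "x + w"] True show ?thesis by simp
    next
      case False
      with key[of x] show ?thesis by simp
    qed
    have r: "norm (x - y) \<noteq> 0" using False by simp
    define c where "c = 1 / norm (x - y)"
    have c: "c \<noteq> 0" "w = c *\<^sub>R (x - y)" using r by (simp_all add: c_def w_def sgn_div_norm inverse_eq_divide)
    have qq: "q x (c *\<^sub>R (x - y)) = c * (q x x - q x y)"
      "q (c *\<^sub>R (x - y)) (c *\<^sub>R (x - y)) = c * (c * (q x x - 2 * q x y + q y y))"
      by (simp_all add: q_def algebra_simps)
    \<comment> \<open>Since x and y have equal \<open>q\<close>-length, this determines the
      displacement of \<open>x\<close> under the symmetry: it is exactly
      \<open>x - y\<close>.\<close>
    have "2 * c * q x w = q w w" unfolding c(2) qq eq by (simp add: algebra_simps)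
    then have "c * l x * q w w = q w w" using l[of x] by (simp add: algebra_simps)
    then have "c * l x = 1" using qw by simp
    then have "l x *\<^sub>R w = x - y" unfolding c(2) by (simp add: mult.commute)
    then have "?T x = y" by (simp add: T)
    then show ?thesis using inv[of x] by simp
  qed simp
  have pd: "0 < A" "0 < A * C - B\<^sup>2"
  proof -
    have "0 < q (axis i 1) (axis i 1)" by (rule qpos) (simp add: axis_eq_0_iff)
    then show "0 < A" using ij(2) by (simp add: q_def axis_def)
    \<comment> \<open>This vector is \<open>q\<close>-orthogonal to the first axis, so the value of
      \<open>q\<close> there isolates the determinant.\<close>
    let ?v = "(\<chi> r. if r = i then - B else A) :: real^'n"
    have "?v$j \<noteq> 0" using \<open>0 < A\<close> ij(2) by simp
    then have "?v \<noteq> 0" by (metis zero_index)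
    then have "0 < q ?v ?v" by (rule qpos)
    also have "q ?v ?v = A * (A * C - B\<^sup>2)" using ij(2) by (simp add: q_def power2_eq_square algebra_simps)
    finally show "0 < A * C - B\<^sup>2" using \<open>0 < A\<close> by (simp add: zero_less_mult_iff)
  qed
  obtain \<phi> :: "real^'n^'n" and d where \<phi>: "det \<phi> = 1" "0 < d"
    "\<And>x. A * (x$i)\<^sup>2 + 2 * B * x$i * x$j + C * (x$j)\<^sup>2 = d * (norm (\<phi> *v x))\<^sup>2"
    by (rule quadratic_form_2[OF ij pd]) blast
  have qphi: "q x x = d * (norm (\<phi> *v x))\<^sup>2" for x
    unfolding \<phi>(3)[symmetric] q_def by (simp add: power2_eq_square algebra_simps)
  obtain e :: "real^'n" where e: "norm e = 1" using vector_choose_size[of 1] by auto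
  define r where "r = norm (\<phi> *v e)"
  have "0 < q e e" using e by (intro qpos) auto
  then have r: "0 < r" using \<phi>(2) unfolding qphi r_def by (simp add: zero_less_mult_iff) 
  have "N x = N e / r * norm (\<phi> *v x) \<and> M x = M e / r * norm (\<phi> *v x)" for x
  proof -
    let ?t = "norm (\<phi> *v x) / r"
    have "q x x = q (?t *\<^sub>R e) (?t *\<^sub>R e)"
      unfolding qphi using r by (simp add: matrix_vector_mult_scaleR power_mult_distrib r_def[symmetric] power_divide)
    then have "N x = N (?t *\<^sub>R e) \<and> M x = M (?t *\<^sub>R e)" by (rule swap)
    moreover have "N (?t *\<^sub>R e) = N e / r * norm (\<phi> *v x)" "M (?t *\<^sub>R e) = M e / r * norm (\<phi> *v x)"
      using r by (simp_all add: N.homog M.homog)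
    ultimately show ?thesis by simp
  qed
  moreover have "0 < N e / r" "0 < M e / r" using e r by (auto intro!: divide_pos_pos N.pos M.pos)
  ultimately show thesis using \<phi>(1) that by blast
qed

end

section \<open>Existence of a minimizer\<close>

text \<open>The volume of the unit ball of \<open>N\<close> relative to that of the Euclidean
  ball.\<close>

definition sph_vol :: "(real^'n \<Rightarrow> real) \<Rightarrow> ennreal" where
  "sph_vol N = (\<integral>\<^sup>+u. ennreal (N u powr - real CARD('n)) \<partial>sph)"

definition sph_energy :: "real \<Rightarrow> (real^'n \<Rightarrow> real) \<Rightarrow> (real^'n \<Rightarrow> real) \<Rightarrow> ennreal" where
  "sph_energy p N M = (\<integral>\<^sup>+u. \<integral>\<^sup>+v. ennreal (bracket u v powr p * N u powr - (real CARD('n) + p) * M v powr - (real CARD('n) + p))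
     \<partial>sph \<partial>sph)"

lemma nn_integral_ball_eq_sph_vol:
  fixes N :: "real^'n \<Rightarrow> real"
  assumes "norm_fn a b N"
  shows "(\<integral>\<^sup>+x. ind N x \<partial>lborel) = ennreal (unit_ball_vol (real CARD('n))) * sph_vol N"
proof -
  interpret norm_fn a b N by fact
  show ?thesis
    using nn_integral_sublevel_sphere[of "\<lambda>_. 1" N 0] by (simp add: sph_vol_def homog_pos pos)
qed

text \<open>One radial integration in each variable; the bracket has degree p in both, so the same
  positive factor occurs twice.\<close>

lemma body_energy_eq_sph_energy:
  fixes N M :: "real^'n \<Rightarrow> real"
  assumes "norm_fn a b N" "norm_fn a' b' M" and p: "0 \<le> p"
  defines "n \<equiv> real CARD('n)"
  shows "body_energy p N M = (ennreal (n * unit_ball_vol n / (n + p)))\<^sup>2 * sph_energy p N M"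
proof -
  interpret N: norm_fn a b N by fact
  interpret M: norm_fn a' b' M by fact
  interpret S: sigma_finite_measure "sphere_measure TYPE('n)" by (rule sigma_finite_sphere)
  let ?K = "ennreal (n * unit_ball_vol n / (n + p))"
  let ?s = "sphere_measure TYPE('n)"
  have [measurable]: "N \<in> borel_measurable ?s" "M \<in> borel_measurable ?s"
    by (rule borel_measurable_sphere, measurable)+
  have hom: "ennreal (bracket (s *\<^sub>R x) y powr p) = ennreal (s powr p) * ennreal (bracket x y powr p)"
    "ennreal (bracket y (s *\<^sub>R x) powr p) = ennreal (s powr p) * ennreal (bracket y x powr p)"
    if "0 < s" for s and x y :: "real^'n"
    using that by (simp_all add: bracket_scaleR_left bracket_scaleR_right powr_mult ennreal_mult)
  define G where "G x = (\<integral>\<^sup>+v. ennreal (bracket x v powr p) * ennreal (M v powr - (n + p)) \<partial>?s)" for x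
  note [measurable] = measurable_ident_sphere measurable_fst_sphere measurable_snd_sphere
  have [measurable]: "G \<in> borel_measurable borel"
    unfolding G_def by measurable
  have "body_energy p N M = (\<integral>\<^sup>+x. (\<integral>\<^sup>+y. ennreal (bracket x y powr p) * ind M y \<partial>lborel) * ind N x \<partial>lborel)"
    unfolding body_energy_def by (intro nn_integral_cong) (auto simp: indicator_def)
  also have "\<dots> = (\<integral>\<^sup>+x. (?K * G x) * ind N x \<partial>lborel)"
  proof (intro nn_integral_cong arg_cong2[where f = "(*)"] refl)
    fix x
    show "(\<integral>\<^sup>+y. ennreal (bracket x y powr p) * ind M y \<partial>lborel) = ?K * G x"
      unfolding G_def n_def
      by (rule nn_integral_sublevel_sphere) (use p in \<open>auto simp: hom M.homog_pos M.pos\<close>)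
  qed
  also have "\<dots> = ?K * (\<integral>\<^sup>+x. G x * ind N x \<partial>lborel)"
    by (subst nn_integral_cmult[symmetric]) (auto simp: mult.assoc)
  also have "(\<integral>\<^sup>+x. G x * ind N x \<partial>lborel) = ?K * (\<integral>\<^sup>+u. G u * ennreal (N u powr - (n + p)) \<partial>?s)"
    unfolding n_def
  proof (rule nn_integral_sublevel_sphere)
    show "G (s *\<^sub>R x) = ennreal (s powr p) * G x" if "0 < s" for s x
      unfolding G_def hom[OF that] mult.assoc by (rule nn_integral_cmult) measurable
  qed (use p in \<open>auto simp: N.homog_pos N.pos\<close>)
  also have "(\<integral>\<^sup>+u. G u * ennreal (N u powr - (n + p)) \<partial>?s) = sph_energy p N M"
    unfolding sph_energy_def G_def n_def[symmetric]
  proof (rule nn_integral_cong)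
    fix u
    have "(\<integral>\<^sup>+v. ennreal (bracket u v powr p) * ennreal (M v powr - (n + p)) \<partial>?s) * ennreal (N u powr - (n + p))
      = (\<integral>\<^sup>+v. ennreal (bracket u v powr p) * ennreal (M v powr - (n + p)) * ennreal (N u powr - (n + p)) \<partial>?s)"
      by (rule nn_integral_multc[symmetric]) measurable
    also have "\<dots> = (\<integral>\<^sup>+v. ennreal (bracket u v powr p * N u powr - (n + p) * M v powr - (n + p)) \<partial>?s)"
      by (intro nn_integral_cong) (simp add: ennreal_mult[symmetric] mult_ac)
    finally show "(\<integral>\<^sup>+v. ennreal (bracket u v powr p) * ennreal (M v powr - (n + p)) \<partial>?s) * ennreal (N u powr - (n + p))
      = (\<integral>\<^sup>+v. ennreal (bracket u v powr p * N u powr - (n + p) * M v powr - (n + p)) \<partial>?s)" .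
  qed
  finally show ?thesis by (simp add: power2_eq_square mult.assoc)
qed

lemma sph_vol_steiner:
  fixes N :: "real^'n \<Rightarrow> real"
  assumes "norm_fn a b N" "norm w = 1"
  shows "sph_vol (steiner N w) = sph_vol N"
proof -
  interpret norm_fn a b N by fact
  interpret norm_fn_dir a b N w by unfold_locales fact
  have "ennreal (unit_ball_vol (real CARD('n))) * sph_vol (steiner N w) = ennreal (unit_ball_vol (real CARD('n))) * sph_vol N"
    using nn_integral_steiner_ball[of "\<lambda>_. 1"]
    by (simp add: nn_integral_ball_eq_sph_vol[OF steiner_norm_fn] nn_integral_ball_eq_sph_vol[OF assms(1)])
  moreover have "ennreal (unit_ball_vol (real CARD('n))) \<noteq> 0" by (simp add: ennreal_eq_0_iff not_le)
  ultimately show ?thesis by (subst (asm) ennreal_mult_cancel_left) auto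
qed

text \<open>The upper bound is a common Lipschitz constant, hence equicontinuity; the conditions on
  \<open>N'\<close> are closed under pointwise limits, so \<open>a\<close> and \<open>b\<close> stay
  the same.\<close>

lemma norm_fn_subsequence:
  fixes N :: "nat \<Rightarrow> 'a::euclidean_space \<Rightarrow> real"
  assumes N: "\<And>k. norm_fn a b (N k)"
  obtains r N' where "strict_mono r" "norm_fn a b N'" "\<And>x. (\<lambda>k. N (r k) x) \<longlonglongrightarrow> N' x"
proof -
  have "\<exists>g r. continuous_on (cball 0 1) g \<and> strict_mono (r :: nat \<Rightarrow> nat) \<and>
      (\<forall>e>0. \<exists>K. \<forall>n x. n \<ge> K \<and> x \<in> cball 0 1 \<longrightarrow> norm (N (r n) x - g x) < e)"
  proof (rule Arzela_Ascoli[of "cball 0 1" N "\<bar>b\<bar>"])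
    fix n and x :: 'a assume "x \<in> cball 0 1"
    then have "b * norm x \<le> \<bar>b\<bar> * 1" by (intro mult_mono) auto
    then show "norm (N n x) \<le> \<bar>b\<bar>"
      using norm_fn.upper[OF N, of n x] norm_fn.nonneg[OF N, of n x] by simp
  next
    fix x :: 'a and e :: real assume e: "0 < e"
    have "norm (N n x - N n y) < e" if "norm (x - y) < e / (\<bar>b\<bar> + 1)" for n y
    proof -
      have "norm (N n x - N n y) \<le> b * norm (x - y)" using norm_fn.lipschitz[OF N, of n x y] by simp
      also have "\<dots> \<le> (\<bar>b\<bar> + 1) * norm (x - y)" by (intro mult_right_mono) auto
      also have "\<dots> < e" using that by (simp add: field_simps)
      finally show ?thesis .
    qed
    then show "\<exists>d>0. \<forall>n y. y \<in> cball 0 1 \<and> norm (x - y) < d \<longrightarrow> norm (N n x - N n y) < e"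
      using e by (intro exI[of _ "e / (\<bar>b\<bar> + 1)"]) auto
  qed (simp, blast)
  then obtain g r where r: "strict_mono (r :: nat \<Rightarrow> nat)"
    and g: "\<And>e. 0 < e \<Longrightarrow> \<exists>K. \<forall>n x. n \<ge> K \<and> x \<in> cball 0 1 \<longrightarrow> norm (N (r n) x - g x) < e"
    by blast
  \<comment> \<open>Arzela-Ascoli controls the limit on the unit ball only; elsewhere it is defined
    by homogeneity.\<close>
  define N' where "N' x = norm x * g (sgn x)" for x
  have lim: "(\<lambda>k. N (r k) x) \<longlonglongrightarrow> N' x" for x
  proof -
    have "(\<lambda>k. N (r k) (sgn x)) \<longlonglongrightarrow> g (sgn x)"
    proof (rule LIMSEQ_I)
      fix e :: real assume "0 < e"
      then obtain K where K: "\<And>n x. n \<ge> K \<Longrightarrow> x \<in> cball 0 1 \<Longrightarrow> norm (N (r n) x - g x) < e"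
        using g by blast
      have "sgn x \<in> cball 0 1" by (simp add: norm_sgn)
      with K show "\<exists>K. \<forall>n\<ge>K. norm (N (r n) (sgn x) - g (sgn x)) < e" by blast
    qed
    then have "(\<lambda>k. norm x * N (r k) (sgn x)) \<longlonglongrightarrow> N' x"
      unfolding N'_def by (intro tendsto_intros)
    moreover have "norm x * N (r k) (sgn x) = N (r k) x" for k
    proof -
      have "norm x *\<^sub>R sgn x = x" by (cases "x = 0") (simp_all add: sgn_div_norm)
      then show ?thesis using norm_fn.homog[OF N, of "r k" "norm x" "sgn x"] by simp
    qed
    ultimately show ?thesis by simp
  qed
  have "norm_fn a b N'"
  proof
    show "0 < a" by (rule norm_fn.a_pos[OF N])
    show "N' (x + y) \<le> N' x + N' y" for x y
      by (rule LIMSEQ_le[OF lim tendsto_add[OF lim lim]]) (use norm_fn.subadd[OF N] in blast)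
    show "N' (t *\<^sub>R x) = \<bar>t\<bar> * N' x" for t x
      by (rule LIMSEQ_unique[OF lim]) (use tendsto_mult[OF tendsto_const lim, of "\<bar>t\<bar>" x] in \<open>simp add: norm_fn.homog[OF N]\<close>)
    show "a * norm x \<le> N' x" for x
      by (rule LIMSEQ_le_const[OF lim]) (use norm_fn.lower[OF N] in blast)
    show "N' x \<le> b * norm x" for x
      by (rule LIMSEQ_le_const2[OF lim]) (use norm_fn.upper[OF N] in blast)
  qed
  with r lim show thesis using that by blast
qed

lemma (in norm_fn) powr_sphere_le:
  assumes "norm x = 1" "0 \<le> s"
  shows "N x powr - s \<le> a powr - s"
  using lower[of x] a_pos assms by (intro powr_mono2') auto

lemma powr_neg_tendsto:
  assumes "norm_fn a b N'" "norm x = 1" "(\<lambda>k. N k x) \<longlonglongrightarrow> N' x"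
  shows "(\<lambda>k. N k x powr - s) \<longlonglongrightarrow> N' x powr - s"
proof -
  have "x \<noteq> 0" using assms(2) by auto
  then have "N' x \<noteq> 0" using norm_fn.pos[OF assms(1), of x] by simp
  then show ?thesis using assms(3) by (intro tendsto_intros) auto
qed

lemma norm_fn_measurable_sphere:
  "norm_fn a b N \<Longrightarrow> N \<in> borel_measurable (sphere_measure TYPE('n::finite))"
  by (intro borel_measurable_sphere norm_fn.measurable_N)

text \<open>On the unit sphere the common lower bound dominates all the negative powers, so
  pointwise convergence is enough.\<close>

lemma sph_vol_tendsto:
  fixes N :: "nat \<Rightarrow> real^'n \<Rightarrow> real"
  assumes N: "\<And>k. norm_fn a b (N k)" and N': "norm_fn a b N'" and lim: "\<And>x. (\<lambda>k. N k x) \<longlonglongrightarrow> N' x"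
  shows "(\<lambda>k. sph_vol (N k)) \<longlonglongrightarrow> sph_vol N'"
  unfolding sph_vol_def
proof (rule nn_integral_dominated_convergence[where w = "\<lambda>_. ennreal (a powr - real CARD('n))"])
  note [measurable] = norm_fn_measurable_sphere[OF N] norm_fn_measurable_sphere[OF N']
  show "(\<lambda>u. ennreal (N k u powr - real CARD('n))) \<in> borel_measurable sph" for k
    by measurable
  show "(\<lambda>u. ennreal (N' u powr - real CARD('n))) \<in> borel_measurable sph"
    by measurable
  show "AE u in sph. ennreal (N k u powr - real CARD('n)) \<le> ennreal (a powr - real CARD('n))" for k
    by (intro AE_I2 ennreal_leI norm_fn.powr_sphere_le[OF N]) auto
  show "AE u in sph. (\<lambda>k. ennreal (N k u powr - real CARD('n))) \<longlonglongrightarrow> ennreal (N' u powr - real CARD('n))"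
    by (intro AE_I2 tendsto_ennrealI powr_neg_tendsto[OF N'] lim) auto
qed (simp_all add: emeasure_sphere_measure_space)

lemma sph_energy_tendsto:
  fixes N M :: "nat \<Rightarrow> real^'n \<Rightarrow> real"
  assumes p: "0 \<le> p"
    and N: "\<And>k. norm_fn a b (N k)" and N': "norm_fn a b N'" and limN: "\<And>x. (\<lambda>k. N k x) \<longlonglongrightarrow> N' x"
    and M: "\<And>k. norm_fn a' b' (M k)" and M': "norm_fn a' b' M'" and limM: "\<And>x. (\<lambda>k. M k x) \<longlonglongrightarrow> M' x"
  shows "(\<lambda>k. sph_energy p (N k) (M k)) \<longlonglongrightarrow> sph_energy p N' M'"
proof -
  interpret S: sigma_finite_measure "sphere_measure TYPE('n)" by (rule sigma_finite_sphere)
  let ?s = "sphere_measure TYPE('n)"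
  define s where "s = real CARD('n) + p"
  let ?e = "\<lambda>k u v. bracket u v powr p * N k u powr - s * M k v powr - s"
    and ?e' = "\<lambda>u v. bracket u v powr p * N' u powr - s * M' v powr - s"
  have s: "0 \<le> s" using p by (simp add: s_def)
  note [measurable] = norm_fn_measurable_sphere[OF N] norm_fn_measurable_sphere[OF N']
    norm_fn_measurable_sphere[OF M] norm_fn_measurable_sphere[OF M']
  note [measurable] = measurable_ident_sphere measurable_fst_sphere measurable_snd_sphere
  define W where "W = ennreal (a powr - s * a' powr - s)"
  have bound: "ennreal (?e k u v) \<le> W" if "norm u = 1" "norm v = 1" for u v k
  proof -
    have "bracket u v powr p \<le> 1"
      using bracket_le[of u v] that powr_mono2[of p "bracket u v" 1] p by simp
    then have "bracket u v powr p * N k u powr - s * M k v powr - s \<le> 1 * a powr - s * a' powr - s"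
      using that s by (intro mult_mono norm_fn.powr_sphere_le[OF N] norm_fn.powr_sphere_le[OF M]) auto
    then show ?thesis by (simp add: W_def ennreal_leI)
  qed
  have inner: "(\<lambda>k. \<integral>\<^sup>+v. ennreal (?e k u v) \<partial>?s)
     \<longlonglongrightarrow> (\<integral>\<^sup>+v. ennreal (?e' u v) \<partial>?s)" if u: "norm u = 1" for u
  proof (rule nn_integral_dominated_convergence[where w = "\<lambda>_. W"])
    show "(\<lambda>v. ennreal (?e k u v)) \<in> borel_measurable ?s" for k
      by measurable
    show "(\<lambda>v. ennreal (?e' u v)) \<in> borel_measurable ?s"
      by measurable
    show "AE v in ?s. ennreal (?e k u v) \<le> W" for k
      by (intro AE_I2 bound) (use u in auto)
    show "AE v in ?s. (\<lambda>k. ennreal (?e k u v))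
        \<longlonglongrightarrow> ennreal (?e' u v)"
      by (intro AE_I2 tendsto_ennrealI tendsto_mult tendsto_const powr_neg_tendsto[OF N' _ limN] powr_neg_tendsto[OF M' _ limM])
         (use u in auto)
  qed (simp_all add: emeasure_sphere_measure_space W_def)
  show ?thesis
    unfolding sph_energy_def s_def[symmetric]
  proof (rule nn_integral_dominated_convergence[where w = "\<lambda>_. W"])
    show "(\<lambda>u. \<integral>\<^sup>+v. ennreal (?e k u v) \<partial>?s) \<in> borel_measurable ?s" for k
      by measurable
    show "(\<lambda>u. \<integral>\<^sup>+v. ennreal (?e' u v) \<partial>?s) \<in> borel_measurable ?s"
      by measurable
    show "AE u in ?s. (\<integral>\<^sup>+v. ennreal (?e k u v) \<partial>?s) \<le> W" for k
    proof (intro AE_I2)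
      fix u assume "u \<in> space ?s"
      then have "(\<integral>\<^sup>+v. ennreal (?e k u v) \<partial>?s) \<le> (\<integral>\<^sup>+v. W \<partial>?s)"
        by (intro nn_integral_mono bound) auto
      then show "(\<integral>\<^sup>+v. ennreal (?e k u v) \<partial>?s) \<le> W"
        by (simp add: emeasure_sphere_measure_space)
    qed
    show "AE u in ?s. (\<lambda>k. \<integral>\<^sup>+v. ennreal (?e k u v) \<partial>?s)
        \<longlonglongrightarrow> (\<integral>\<^sup>+v. ennreal (?e' u v) \<partial>?s)"
      by (intro AE_I2 inner) auto
  qed (simp_all add: emeasure_sphere_measure_space W_def)
qed

text \<open>The minimum is taken under constraints on volumes and bounds. These constraints cause no
  boundary effects, because the minimizer is compared only with its own symmetrals, which satisfy
  them too.\<close>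

lemma exists_stationary_pair:
  fixes N0 M0 :: "real^'n \<Rightarrow> real"
  assumes p: "1 \<le> p" and N0: "norm_fn a b N0" and M0: "norm_fn a' b' M0" and card: "2 \<le> CARD('n)"
  obtains N M :: "real^'n \<Rightarrow> real" where "stationary_pair a b a' b' N M p" "sph_vol N = sph_vol N0" "sph_vol M = sph_vol M0"
    "sph_energy p N M \<le> sph_energy p N0 M0"
proof -
  define X where "X = {(N :: real^'n \<Rightarrow> real, M :: real^'n \<Rightarrow> real). norm_fn a b N \<and> norm_fn a' b' M \<and> sph_vol N = sph_vol N0 \<and> sph_vol M = sph_vol M0}"
  define E where "E = (\<lambda>(N, M). sph_energy p N M) ` X"
  have "(N0, M0) \<in> X" using N0 M0 by (simp add: X_def)
  then have "E \<noteq> {}" by (auto simp: E_def)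
  from Inf_as_limit[OF this] obtain u where u: "\<And>k. u k \<in> E" "u \<longlonglongrightarrow> Inf E" by blast
  then have "\<exists>N M. (N, M) \<in> X \<and> u k = sph_energy p N M" for k by (fastforce simp: E_def)
  then obtain N M where X: "\<And>k. (N k, M k) \<in> X" and uk: "\<And>k. u k = sph_energy p (N k) (M k)" by metis
  have N: "\<And>k. norm_fn a b (N k)" and M: "\<And>k. norm_fn a' b' (M k)"
    and VN: "\<And>k. sph_vol (N k) = sph_vol N0" and VM: "\<And>k. sph_vol (M k) = sph_vol M0"
    using X by (auto simp: X_def)
  obtain r N' where r: "strict_mono r" and N': "norm_fn a b N'" and limN: "\<And>x. (\<lambda>k. N (r k) x) \<longlonglongrightarrow> N' x"
    by (rule norm_fn_subsequence[of a b N, OF N]) blast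
  obtain r' M' where r': "strict_mono r'" and M': "norm_fn a' b' M'" and limM: "\<And>x. (\<lambda>k. M (r (r' k)) x) \<longlonglongrightarrow> M' x"
    by (rule norm_fn_subsequence[of a' b' "\<lambda>k. M (r k)", OF M]) blast
  have limN': "(\<lambda>k. N (r (r' k)) x) \<longlonglongrightarrow> N' x" for x
    using LIMSEQ_subseq_LIMSEQ[OF limN r'] by (simp add: o_def)
  have V: "sph_vol N' = sph_vol N0" "sph_vol M' = sph_vol M0"
    using sph_vol_tendsto[OF N N' limN'] sph_vol_tendsto[OF M M' limM]
    by (simp_all add: VN VM LIMSEQ_const_iff)
  have "(\<lambda>k. sph_energy p (N (r (r' k))) (M (r (r' k)))) \<longlonglongrightarrow> sph_energy p N' M'"
    by (rule sph_energy_tendsto[OF _ N N' limN' M M' limM]) (use p in simp)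
  moreover have "(\<lambda>k. sph_energy p (N (r (r' k))) (M (r (r' k)))) \<longlonglongrightarrow> Inf E"
    using LIMSEQ_subseq_LIMSEQ[OF LIMSEQ_subseq_LIMSEQ[OF u(2) r] r'] by (simp add: o_def uk)
  ultimately have min: "sph_energy p N' M' = Inf E" by (rule LIMSEQ_unique)
  have le: "sph_energy p N' M' \<le> sph_energy p K L" if "(K, L) \<in> X" for K L
    unfolding min by (rule Inf_lower) (use that in \<open>force simp: E_def\<close>)
  interpret N: norm_fn a b N' by (rule N')
  interpret M: norm_fn a' b' M' by (rule M')
  have "stationary_pair a b a' b' N' M' p"
  proof
    fix w :: "real^'n" assume w: "norm w = 1"
    interpret Nw: norm_fn_dir a b N' w by unfold_locales (rule w)
    interpret Mw: norm_fn_dir a' b' M' w by unfold_locales (rule w)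
    have "(steiner N' w, steiner M' w) \<in> X"
      by (simp add: X_def Nw.steiner_norm_fn Mw.steiner_norm_fn sph_vol_steiner[OF N' w] sph_vol_steiner[OF M' w] V)
    from le[OF this] show "body_energy p N' M' \<le> body_energy p (steiner N' w) (steiner M' w)"
      using p by (simp add: body_energy_eq_sph_energy[OF N' M'] body_energy_eq_sph_energy[OF Nw.steiner_norm_fn Mw.steiner_norm_fn] mult_left_mono)
  qed (use p card in auto)
  then show thesis using V le[OF \<open>(N0, M0) \<in> X\<close>] that by blast
qed

section \<open>The inequality for norms\<close>

lemma norm_fn_norm: "norm_fn 1 1 (norm :: 'a::euclidean_space \<Rightarrow> real)"
  by standard (auto simp: norm_triangle_ineq)

lemma norm_fn_matrix:
  fixes \<phi> :: "real^'n^'n"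
  assumes "det \<phi> \<noteq> 0"
  obtains a b where "norm_fn a b (\<lambda>x. norm (\<phi> *v x))"
proof -
  have "inj ((*v) \<phi>)" using assms by (simp add: inj_matrix_vector_mult invertible_det_nz)
  then obtain a where a: "0 < a" "\<And>x. a * norm x \<le> norm (\<phi> *v x)"
    using linear_inj_bounded_below_pos[of "(*v) \<phi>"] by (auto simp: matrix_vector_mul_linear)
  obtain b where b: "\<And>x. norm (\<phi> *v x) \<le> b * norm x"
    using linear_bounded[OF matrix_vector_mul_linear[of \<phi>]] by (auto simp: mult.commute)
  have "norm_fn a b (\<lambda>x. norm (\<phi> *v x))"
    by standard (use a b in \<open>auto simp: matrix_vector_right_distrib norm_triangle_ineq matrix_vector_mult_scaleR\<close>)
  then show thesis by (rule that)
qed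

section \<open>Linear maps of the plane preserving volume and bracket\<close>

lemma measurable_matrix_vector [measurable]: "(*v) (\<phi> :: real^'n^'m) \<in> borel_measurable borel"
  by (intro borel_measurable_continuous_onI linear_continuous_on) (simp add: linear_linear)

text \<open>An elementary shear. For \<open>i\<close> different from \<open>j\<close> the
  displacement is constant along its own direction, the case e = 1 of
  \<open>distr_fibrewise\<close>.\<close>

definition transvection :: "'n \<Rightarrow> 'n \<Rightarrow> real \<Rightarrow> real^'n \<Rightarrow> real^'n::finite" where
  "transvection i j t x = x + (t * x$j) *\<^sub>R axis i 1"

lemma distr_transvection: "i \<noteq> j \<Longrightarrow> distr lborel borel (transvection i j t) = lborel"
  unfolding transvection_def[abs_def]
  by (rule distr_fibrewise[where e = 1]) (auto simp: axis_def algebra_simps)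

lemma measurable_transvection [measurable]: "transvection i j t \<in> borel_measurable borel"
  unfolding transvection_def[abs_def] by measurable

lemma distr_transvection_comp:
  assumes "i \<noteq> j" and [measurable]: "T \<in> borel_measurable borel" and "distr lborel borel T = lborel"
  shows "distr lborel borel (\<lambda>x. transvection i j t (T x)) = lborel"
proof -
  have "distr lborel borel (\<lambda>x. transvection i j t (T x)) = distr (distr lborel borel T) borel (transvection i j t)"
    by (subst distr_distr) (auto simp: o_def)
  then show ?thesis using assms by (simp add: distr_transvection)
qed

text \<open>A matrix of determinant 1 with nonzero lower left entry is a product of three shears,
  and each shear preserves Lebesgue measure.\<close>

lemma distr_SL2:
  fixes \<phi> :: "real^'n^'n"
  assumes ij: "UNIV = {i, j :: 'n}" "i \<noteq> j" and det: "det \<phi> = 1"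
  shows "distr lborel borel ((*v) \<phi>) = lborel"
proof -
  have nz: "distr lborel borel ((*v) \<psi>) = lborel" if "det \<psi> = 1" "\<psi>$j$i \<noteq> 0" for \<psi> :: "real^'n^'n"
  proof -
    \<comment> \<open>The outer shears are chosen to match the two diagonal entries; the remaining
      entry is then forced by the determinant.\<close>
    define s t where "s = (\<psi>$i$i - 1) / \<psi>$j$i" and "t = (\<psi>$j$j - 1) / \<psi>$j$i"
    have d: "\<psi>$i$i * \<psi>$j$j - \<psi>$i$j * \<psi>$j$i = 1" using that(1) det_card_2[OF ij] by simp
    have e: "s * \<psi>$j$i = \<psi>$i$i - 1" "t * \<psi>$j$i = \<psi>$j$j - 1" "t + s * (\<psi>$j$i * t + 1) = \<psi>$i$j"
      using that(2) d by (simp_all add: s_def t_def field_simps)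
    have "\<psi> *v x = transvection i j s (transvection j i (\<psi>$j$i) (transvection i j t x))" for x
    proof (rule vec_eq_iff[THEN iffD2], rule allI)
      fix r
      have r: "r = i \<or> r = j" using ij(1) by auto
      have l: "(\<psi> *v x)$i = \<psi>$i$i * x$i + \<psi>$i$j * x$j" "(\<psi> *v x)$j = \<psi>$j$i * x$i + \<psi>$j$j * x$j"
        using ij(2) unfolding matrix_vector_mult_def ij(1) by simp_all
      have tj: "(transvection j i (\<psi>$j$i) (transvection i j t x))$j = \<psi>$j$i * x$i + \<psi>$j$j * x$j"
        using ij(2) e(2) by (simp add: transvection_def axis_def algebra_simps) (metis mult.assoc mult.commute distrib_right diff_add_cancel mult_1)
      have ti: "(transvection j i (\<psi>$j$i) (transvection i j t x))$i = x$i + t * x$j"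
        using ij(2) by (simp add: transvection_def axis_def)
      have "(transvection i j s (transvection j i (\<psi>$j$i) (transvection i j t x)))$j = \<psi>$j$i * x$i + \<psi>$j$j * x$j"
        using ij(2) tj by (simp add: transvection_def[of i j s] axis_def)
      moreover have "(transvection i j s (transvection j i (\<psi>$j$i) (transvection i j t x)))$i = \<psi>$i$i * x$i + \<psi>$i$j * x$j"
      proof -
        have "(transvection i j s (transvection j i (\<psi>$j$i) (transvection i j t x)))$i
          = x$i + t * x$j + s * (\<psi>$j$i * x$i + \<psi>$j$j * x$j)"
          unfolding transvection_def[of i j s] vector_add_component tj ti by (simp add: axis_def)
        also have "\<dots> = x$i + (s * \<psi>$j$i) * x$i + (t + s * \<psi>$j$j) * x$j" by (simp add: algebra_simps)
        also have "t + s * \<psi>$j$j = \<psi>$i$j" using e(2,3) by (simp add: algebra_simps)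
        finally show ?thesis unfolding e(1) by (simp add: algebra_simps)
      qed
      ultimately show "(\<psi> *v x)$r = (transvection i j s (transvection j i (\<psi>$j$i) (transvection i j t x)))$r"
        using r l by auto
    qed
    then have "(*v) \<psi> = (\<lambda>x. transvection i j s (transvection j i (\<psi>$j$i) (transvection i j t x)))" by auto
    moreover have "distr lborel borel (\<lambda>x. transvection i j s (transvection j i (\<psi>$j$i) (transvection i j t x))) = lborel"
      using ij(2) by (intro distr_transvection_comp distr_transvection) auto
    ultimately show ?thesis by simp
  qed
  show ?thesis
  proof (cases "\<phi>$j$i = 0")
    case False with nz det show ?thesis by blast
  next
    case True
    \<comment> \<open>The lower left entry is 0, so determinant 1 makes both diagonal entries
      nonzero; adding one row to the other produces a nonzero entry there at the cost of one more
      shear.\<close>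
    define \<psi> :: "real^'n^'n" where "\<psi> = (\<chi> r c. if r = j then \<phi>$j$c + \<phi>$i$c else \<phi>$r$c)"
    have "det \<psi> = 1" using det ij(2) unfolding det_card_2[OF ij] by (simp add: \<psi>_def algebra_simps)
    moreover have "\<psi>$j$i \<noteq> 0" using det True unfolding det_card_2[OF ij] by (auto simp: \<psi>_def)
    ultimately have D: "distr lborel borel ((*v) \<psi>) = lborel" by (rule nz)
    have "\<phi> *v x = transvection j i (-1) (\<psi> *v x)" for x
    proof (rule vec_eq_iff[THEN iffD2], rule allI)
      fix r
      have "r = i \<or> r = j" using ij(1) by auto
      then show "(\<phi> *v x)$r = transvection j i (-1) (\<psi> *v x)$r"
        using ij(2) unfolding transvection_def matrix_vector_mult_def ij(1)
        by (auto simp: \<psi>_def axis_def algebra_simps)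
    qed
    then have "(*v) \<phi> = (\<lambda>x. transvection j i (-1) (\<psi> *v x))" by auto
    moreover have "distr lborel borel (\<lambda>x. transvection j i (-1) (\<psi> *v x)) = lborel"
      using ij(2) by (intro distr_transvection_comp D) auto
    ultimately show ?thesis by simp
  qed
qed

lemma bracket_SL2:
  fixes \<phi> :: "real^'n^'n"
  assumes ij: "UNIV = {i, j :: 'n}" "i \<noteq> j" and det: "det \<phi> = 1"
  shows "bracket (\<phi> *v x) (\<phi> *v y) = bracket x y"
proof -
  have l: "(\<phi> *v x)$i = \<phi>$i$i * x$i + \<phi>$i$j * x$j" "(\<phi> *v x)$j = \<phi>$j$i * x$i + \<phi>$j$j * x$j" for x
    using ij(2) unfolding matrix_vector_mult_def ij(1) by simp_all
  have "(\<phi> *v x)$i * (\<phi> *v y)$j - (\<phi> *v x)$j * (\<phi> *v y)$i = det \<phi> * (x$i * y$j - x$j * y$i)"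
    unfolding l det_card_2[OF ij] by (simp add: algebra_simps)
  then show ?thesis unfolding bracket_2[OF ij] det by simp
qed

section \<open>Energies of balls and ellipses, and the sharp bound for norms\<close>

definition ball_energy :: "'n::finite itself \<Rightarrow> real \<Rightarrow> ennreal" where
  "ball_energy T p = sph_energy p (norm :: real^'n \<Rightarrow> real) norm"

lemma sph_vol_norm: "sph_vol (norm :: real^'n \<Rightarrow> real) = 1"
proof -
  have "sph_vol (norm :: real^'n \<Rightarrow> real) = (\<integral>\<^sup>+u. 1 \<partial>sphere_measure TYPE('n))"
    unfolding sph_vol_def by (intro nn_integral_cong) simp
  then show ?thesis by (simp add: emeasure_sphere_measure_space)
qed

lemma sph_vol_scale:
  fixes N :: "real^'n \<Rightarrow> real"
  assumes "norm_fn a b N" "0 < c"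
  shows "sph_vol (\<lambda>x. c * N x) = ennreal (c powr - real CARD('n)) * sph_vol N"
proof -
  note [measurable] = norm_fn_measurable_sphere[OF assms(1)]
  show ?thesis
    unfolding sph_vol_def
    by (subst nn_integral_cmult[symmetric], measurable)
       (intro nn_integral_cong, use assms(2) norm_fn.nonneg[OF assms(1)] in \<open>simp add: powr_mult ennreal_mult\<close>)
qed

lemma sph_energy_scale:
  fixes N M :: "real^'n \<Rightarrow> real"
  assumes N: "norm_fn a b N" and M: "norm_fn a' b' M" and c: "0 < c" "0 < c'"
  shows "sph_energy p (\<lambda>x. c * N x) (\<lambda>x. c' * M x)
    = ennreal (c powr - (real CARD('n) + p) * c' powr - (real CARD('n) + p)) * sph_energy p N M"
proof -
  interpret S: sigma_finite_measure "sphere_measure TYPE('n)" by (rule sigma_finite_sphere)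
  note [measurable] = norm_fn_measurable_sphere[OF N] norm_fn_measurable_sphere[OF M]
    measurable_ident_sphere measurable_fst_sphere measurable_snd_sphere
  let ?s = "sphere_measure TYPE('n)"
  let ?k = "c powr - (real CARD('n) + p) * c' powr - (real CARD('n) + p)"
  have "sph_energy p (\<lambda>x. c * N x) (\<lambda>x. c' * M x) = (\<integral>\<^sup>+u. \<integral>\<^sup>+v. ennreal ?k * ennreal (bracket u v powr p * N u powr - (real CARD('n) + p) * M v powr - (real CARD('n) + p)) \<partial>?s \<partial>?s)"
    unfolding sph_energy_def
    by (intro nn_integral_cong)
       (use c norm_fn.nonneg[OF N] norm_fn.nonneg[OF M] in \<open>simp add: powr_mult ennreal_mult[symmetric] mult_ac\<close>)
  also have "\<dots> = (\<integral>\<^sup>+u. ennreal ?k * (\<integral>\<^sup>+v. ennreal (bracket u v powr p * N u powr - (real CARD('n) + p) * M v powr - (real CARD('n) + p)) \<partial>?s) \<partial>?s)"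
    by (intro nn_integral_cong nn_integral_cmult) measurable
  also have "\<dots> = ennreal ?k * sph_energy p N M"
    unfolding sph_energy_def by (rule nn_integral_cmult) measurable
  finally show ?thesis .
qed

text \<open>In the plane determinant 1 preserves both volume and bracket, so \<open>\<phi>\<close>
  can be substituted away in each variable. In higher dimension it does not preserve the bracket,
  and only the identity occurs.\<close>

lemma elliptic_vol_energy:
  fixes \<phi> :: "real^'n^'n"
  assumes p: "0 \<le> p" and det: "det \<phi> = 1" and card: "CARD('n) = 2 \<or> \<phi> = mat 1"
  shows "sph_vol (\<lambda>x. norm (\<phi> *v x)) = 1"
    and "sph_energy p (\<lambda>x. norm (\<phi> *v x)) (\<lambda>x. norm (\<phi> *v x)) = ball_energy TYPE('n) p"
proof -
  obtain a b where \<phi>: "norm_fn a b (\<lambda>x. norm (\<phi> *v x))" using norm_fn_matrix[of \<phi>] det by auto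
  have D: "distr lborel borel ((*v) \<phi>) = lborel" and B: "\<And>x y. bracket (\<phi> *v x) (\<phi> *v y) = bracket x y"
  proof -
    have "distr lborel borel ((*v) \<phi>) = lborel \<and> (\<forall>x y. bracket (\<phi> *v x) (\<phi> *v y) = bracket x y)"
      using card
    proof
      assume "CARD('n) = 2"
      then obtain i j :: 'n where ij: "UNIV = {i, j}" "i \<noteq> j" by (metis card_2_iff)
      show ?thesis using distr_SL2[OF ij det] bracket_SL2[OF ij det] by simp
    next
      assume "\<phi> = mat 1"
      then have "(*v) \<phi> = (\<lambda>x. x)" by auto
      then show ?thesis using distr_id2[of borel "lborel :: (real^'n) measure"] by (simp add: id_def)
    qed
    then show "distr lborel borel ((*v) \<phi>) = lborel" "\<And>x y. bracket (\<phi> *v x) (\<phi> *v y) = bracket x y" by auto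
  qed
  let ?w = "ennreal (unit_ball_vol (real CARD('n)))"
  have w: "?w \<noteq> 0" by (simp add: ennreal_eq_0_iff not_le)
  have "?w * sph_vol (\<lambda>x. norm (\<phi> *v x)) = (\<integral>\<^sup>+x. ind norm (\<phi> *v x) \<partial>lborel)"
    unfolding nn_integral_ball_eq_sph_vol[OF \<phi>, symmetric] by (intro nn_integral_cong) (simp add: indicator_def)
  also have "\<dots> = (\<integral>\<^sup>+x. ind norm x \<partial>distr lborel borel ((*v) \<phi>))"
    by (rule nn_integral_distr[symmetric]) measurable
  also have "\<dots> = ?w * 1"
    unfolding D nn_integral_ball_eq_sph_vol[OF norm_fn_norm] sph_vol_norm ..
  finally show "sph_vol (\<lambda>x. norm (\<phi> *v x)) = 1"
    using w by (subst (asm) ennreal_mult_cancel_left) auto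
  have "body_energy p (\<lambda>x. norm (\<phi> *v x)) (\<lambda>x. norm (\<phi> *v x))
    = (\<integral>\<^sup>+x. \<integral>\<^sup>+y. ennreal (bracket (\<phi> *v x) (\<phi> *v y) powr p) * ind norm (\<phi> *v x) * ind norm (\<phi> *v y) \<partial>lborel \<partial>lborel)"
    unfolding body_energy_def B by (intro nn_integral_cong) (simp add: indicator_def)
  also have "\<dots> = (\<integral>\<^sup>+x. \<integral>\<^sup>+y. ennreal (bracket (\<phi> *v x) y powr p) * ind norm (\<phi> *v x) * ind norm y \<partial>distr lborel borel ((*v) \<phi>) \<partial>lborel)"
    by (intro nn_integral_cong nn_integral_distr[symmetric]) measurable
  also have "\<dots> = (\<integral>\<^sup>+x. \<integral>\<^sup>+y. ennreal (bracket x y powr p) * ind norm x * ind norm y \<partial>lborel \<partial>distr lborel borel ((*v) \<phi>))"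
    unfolding D by (subst D[symmetric], rule nn_integral_distr[symmetric]) measurable
  also have "\<dots> = body_energy p (norm :: real^'n \<Rightarrow> real) norm" unfolding D body_energy_def ..
  finally have *: "body_energy p (\<lambda>x. norm (\<phi> *v x)) (\<lambda>x. norm (\<phi> *v x)) = body_energy p (norm :: real^'n \<Rightarrow> real) norm" .
  let ?K = "ennreal (real CARD('n) * unit_ball_vol (real CARD('n)) / (real CARD('n) + p))"
  have "0 < real CARD('n) * unit_ball_vol (real CARD('n)) / (real CARD('n) + p)"
    using p by (intro divide_pos_pos mult_pos_pos) (auto intro: add_pos_nonneg)
  then have K: "?K\<^sup>2 \<noteq> 0" by (simp only: power2_eq_square mult_eq_0_iff ennreal_eq_0_iff not_le simp_thms)
  show "sph_energy p (\<lambda>x. norm (\<phi> *v x)) (\<lambda>x. norm (\<phi> *v x)) = ball_energy TYPE('n) p"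
    using * K unfolding ball_energy_def body_energy_eq_sph_energy[OF \<phi> \<phi> p] body_energy_eq_sph_energy[OF norm_fn_norm norm_fn_norm p]
    by (subst (asm) ennreal_mult_cancel_left) (auto simp: power2_eq_square ennreal_mult_eq_top_iff)
qed

lemma (in stationary_pair) rigid:
  obtains \<phi> :: "real^'n^'n" and c c' where "det \<phi> = 1" "0 < c" "0 < c'" "CARD('n) = 2 \<or> \<phi> = mat 1"
    "N = (\<lambda>x. c * norm (\<phi> *v x))" "M = (\<lambda>x. c' * norm (\<phi> *v x))"
proof (cases "CARD('n) = 2")
  case True
  from elliptic_2[OF this] obtain \<phi> :: "real^'n^'n" and c c' where "det \<phi> = 1" "0 < c" "0 < c'"
    "\<And>x. N x = c * norm (\<phi> *v x)" "\<And>x. M x = c' * norm (\<phi> *v x)" by blast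
  then show ?thesis using True by (intro that[of \<phi> c c']) auto
next
  case False
  with card have "3 \<le> CARD('n)" by simp
  from radial_high[OF this] obtain c c' where "0 < c" "0 < c'" "\<And>x. N x = c * norm x" "\<And>x. M x = c' * norm x" by blast
  then show ?thesis by (intro that[of "mat 1" c c']) auto
qed

text \<open>A stationary pair with the same volumes is a pair of scaled copies of one ellipse or
  ball. Scaling by \<open>c\<close> changes volume by c^(-n) and energy by c^(-(n+p)), whence the
  exponent \<open>r\<close>.\<close>

theorem sph_energy_ge:
  fixes N M :: "real^'n \<Rightarrow> real"
  assumes p: "1 \<le> p" and N: "norm_fn a b N" and M: "norm_fn a' b' M" and card: "2 \<le> CARD('n)"
    and v: "sph_vol N = ennreal v" "sph_vol M = ennreal v'" "0 \<le> v" "0 \<le> v'"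
  defines "r \<equiv> (real CARD('n) + p) / real CARD('n)"
  shows "ennreal (v powr r * v' powr r) * ball_energy TYPE('n) p \<le> sph_energy p N M"
proof -
  let ?n = "real CARD('n)"
  obtain K L :: "real^'n \<Rightarrow> real" where s: "stationary_pair a b a' b' K L p" "sph_vol K = sph_vol N" "sph_vol L = sph_vol M"
    "sph_energy p K L \<le> sph_energy p N M"
    by (rule exists_stationary_pair[OF p N M card]) blast
  interpret stationary_pair a b a' b' K L p by fact
  obtain \<phi> :: "real^'n^'n" and c c' where \<phi>: "det \<phi> = 1" "0 < c" "0 < c'" "CARD('n) = 2 \<or> \<phi> = mat 1"
    "K = (\<lambda>x. c * norm (\<phi> *v x))" "L = (\<lambda>x. c' * norm (\<phi> *v x))" by (rule rigid)
  obtain a'' b'' where \<phi>n: "norm_fn a'' b'' (\<lambda>x. norm (\<phi> *v x))" using norm_fn_matrix[of \<phi>] \<phi>(1) by auto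
  have p0: "0 \<le> p" using p by simp
  note ell = elliptic_vol_energy[OF p0 \<phi>(1,4)]
  have "v = c powr - ?n" "v' = c' powr - ?n"
    using s(2,3) v unfolding \<phi>(5,6) sph_vol_scale[OF \<phi>n \<phi>(2)] sph_vol_scale[OF \<phi>n \<phi>(3)] ell by auto
  then have "v powr r = c powr - (?n + p)" "v' powr r = c' powr - (?n + p)"
    by (simp_all add: powr_powr r_def)
  then have "sph_energy p K L = ennreal (v powr r * v' powr r) * ball_energy TYPE('n) p"
    unfolding \<phi>(5,6) sph_energy_scale[OF \<phi>n \<phi>n \<phi>(2,3)] ell by simp
  with s(4) show ?thesis by simp
qed

text \<open>Symmetrals have the same volumes, hence obey the same lower bound; a pair attaining that
  bound cannot lose energy.\<close>

theorem sph_energy_eq_imp: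
  fixes N M :: "real^'n \<Rightarrow> real"
  assumes p: "1 \<le> p" and N: "norm_fn a b N" and M: "norm_fn a' b' M" and card: "2 \<le> CARD('n)"
    and v: "sph_vol N = ennreal v" "sph_vol M = ennreal v'" "0 \<le> v" "0 \<le> v'"
  defines "r \<equiv> (real CARD('n) + p) / real CARD('n)"
  assumes eq: "sph_energy p N M \<le> ennreal (v powr r * v' powr r) * ball_energy TYPE('n) p"
  shows "stationary_pair a b a' b' N M p"
proof -
  interpret N: norm_fn a b N by fact
  interpret M: norm_fn a' b' M by fact
  show ?thesis
  proof
    fix w :: "real^'n" assume w: "norm w = 1"
    interpret Nw: norm_fn_dir a b N w by unfold_locales (rule w)
    interpret Mw: norm_fn_dir a' b' M w by unfold_locales (rule w)
    have "sph_energy p N M \<le> sph_energy p (steiner N w) (steiner M w)"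
      using sph_energy_ge[OF p Nw.steiner_norm_fn Mw.steiner_norm_fn card, of v v'] v eq
      by (simp add: sph_vol_steiner[OF N w] sph_vol_steiner[OF M w] r_def)
    then show "body_energy p N M \<le> body_energy p (steiner N w) (steiner M w)"
      using p by (simp add: body_energy_eq_sph_energy[OF N M] body_energy_eq_sph_energy[OF Nw.steiner_norm_fn Mw.steiner_norm_fn] mult_left_mono)
  qed (use p card in auto)
qed

section \<open>The constant\<close>

text \<open>Both measures assign to a half line the volume of a ball. A product over a finite index
  set is used because the coordinates other than one form a subset of \<open>Basis\<close> and not a
  Euclidean type.\<close>

lemma distr_radius_PiM:
  assumes I: "finite I" "I \<noteq> {}"
  shows "distr (Pi\<^sub>M I (\<lambda>_. lborel)) borel (\<lambda>f. sqrt (\<Sum>i\<in>I. (f i)\<^sup>2))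
    = density lborel (\<lambda>r. ennreal (real (card I) * unit_ball_vol (real (card I)) * r ^ (card I - 1)) * indicator {0..} r)"
    (is "?M = ?N")
proof -
  define k where "k = card I"
  define c where "c = unit_ball_vol (real k)"
  have k: "0 < k" using I by (simp add: k_def card_gt_0_iff)
  have c: "0 < c" by (simp add: c_def)
  have meas: "(\<lambda>f. sqrt (\<Sum>i\<in>I. (f i)\<^sup>2)) \<in> borel_measurable (Pi\<^sub>M I (\<lambda>_. lborel))"
    by measurable
  have Mpos: "emeasure ?M {..r} = ennreal (c * r ^ k)" if "0 < r" for r
  proof -
    have "emeasure ?M {..r} = emeasure (Pi\<^sub>M I (\<lambda>_. lborel)) ({f. sqrt (\<Sum>i\<in>I. (f i)\<^sup>2) \<le> r} \<inter> space (Pi\<^sub>M I (\<lambda>_. lborel)))"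
      by (simp add: emeasure_distr[OF meas] vimage_def)
    then show ?thesis using emeasure_cball_aux[OF I(1) that] by (simp add: k_def c_def)
  qed
  \<comment> \<open>The ball volume formula requires a positive radius; half lines ending at or
    below 0 are squeezed by arbitrarily small positive radii.\<close>
  have Mneg: "emeasure ?M {..r} = 0" if "r \<le> 0" for r
  proof -
    have le: "emeasure ?M {..r} \<le> ennreal (c * e)" if "0 < e" "e \<le> 1" for e
    proof -
      have "emeasure ?M {..r} \<le> emeasure ?M {..e}" using \<open>r \<le> 0\<close> that by (intro emeasure_mono) auto
      also have "\<dots> \<le> ennreal (c * e)"
        unfolding Mpos[OF that(1)] using that k c power_decreasing[of 1 k e] by (intro ennreal_leI mult_left_mono) auto
      finally show ?thesis .
    qed
    have fin: "emeasure ?M {..r} \<noteq> \<infinity>" using le[of 1] by (auto simp: top_unique)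
    define x where "x = enn2real (emeasure ?M {..r})"
    have x: "emeasure ?M {..r} = ennreal x" "0 \<le> x" using fin by (simp_all add: x_def less_top)
    have "x \<le> 0"
    proof (rule ccontr)
      assume "\<not> x \<le> 0"
      define e where "e = min 1 (x / (2 * c))"
      have e: "0 < e" "e \<le> 1" "c * e < x"
      proof -
        show "0 < e" "e \<le> 1" using \<open>\<not> x \<le> 0\<close> c by (auto simp: e_def)
        have "c * e \<le> c * (x / (2 * c))" using c by (intro mult_left_mono) (auto simp: e_def)
        also have "\<dots> = x / 2" using c by simp
        finally show "c * e < x" using \<open>\<not> x \<le> 0\<close> by simp
      qed
      from le[OF e(1,2)] e c show False unfolding x by simp
    qed
    with x show ?thesis by simp
  qed
  have Nval: "emeasure ?N {..r} = (if 0 < r then ennreal (c * r ^ k) else 0)" for r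
  proof -
    have "emeasure ?N {..r} = (\<integral>\<^sup>+x. ennreal (real k * c * x ^ (k - 1)) * indicator {0..} x * indicator {..r} x \<partial>lborel)"
      by (subst emeasure_density) (auto simp: k_def c_def)
    also have "\<dots> = (\<integral>\<^sup>+x. ennreal (real k * c * x ^ (k - 1)) * indicator {0..r} x \<partial>lborel)"
      by (intro nn_integral_cong) (auto simp: indicator_def)
    also have "\<dots> = (if 0 < r then ennreal (c * r ^ k) else 0)"
    proof (cases "0 \<le> r")
      case True
      have "(\<integral>\<^sup>+x. ennreal (real k * c * x ^ (k - 1)) * indicator {0..r} x \<partial>lborel) = ennreal (c * r ^ k - c * 0 ^ k)"
        by (rule nn_integral_FTC_Icc) (use True c in \<open>auto intro!: derivative_eq_intros\<close>)
      then show ?thesis using k True by (auto simp: zero_power)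
    qed (simp add: not_le)
    finally show ?thesis .
  qed
  show ?thesis
  proof (rule measure_eqI_generator_eq[where E = "range (\<lambda>a::real. {..a})" and A = "\<lambda>i. {..real i}" and \<Omega> = UNIV])
    show "Int_stable (range (\<lambda>a::real. {..a}))"
      by (auto simp: Int_stable_def)
    show "emeasure ?M X = emeasure ?N X" if X: "X \<in> range (\<lambda>a::real. {..a})" for X
    proof -
      from X obtain a where a: "X = {..a}" by auto
      show ?thesis unfolding a Nval using Mpos[of a] Mneg[of a] by auto
    qed
    show "sets ?M = sigma_sets UNIV (range (\<lambda>a::real. {..a}))" "sets ?N = sigma_sets UNIV (range (\<lambda>a::real. {..a}))"
      by (simp_all add: borel_eq_atMost)
    show "(\<Union>i. {..real i}) = UNIV" using real_arch_simple by auto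
    show "emeasure ?M {..real i} \<noteq> \<infinity>" for i
      using Mpos[of "real i"] Mneg[of "real i"] by (cases "i = 0") auto
  qed auto
qed

lemma bracket_axis_sq:
  fixes x :: "real^'n"
  assumes "norm e = 1"
  shows "(bracket e x)\<^sup>2 = (norm x)\<^sup>2 - (x \<bullet> e)\<^sup>2"
  using assms by (simp add: bracket_sq inner_commute)

text \<open>The bracket with a unit vector is the distance from its axis, that is, the radius in the
  other n-1 coordinates. Integrating along the axis yields the chord length 2 sqrt(1 - r^2), and t =
  r^2 turns the remaining radial integral into a Beta integral.\<close>

lemma nn_integral_bracket_ball:
  fixes e :: "real^'n"
  assumes e: "e \<in> Basis" and card: "2 \<le> CARD('n)" and p: "1 \<le> p"
  defines "k \<equiv> real CARD('n) - 1"
  shows "(\<integral>\<^sup>+x. ennreal (bracket e x powr p) * ind norm x \<partial>lborel)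
    = ennreal (k * unit_ball_vol k * Beta ((k + p) / 2) (3 / 2))"
proof -
  interpret product_sigma_finite "\<lambda>_. lborel :: real measure" by standard
  define I where "I = Basis - {e}"
  have I: "finite I" "e \<notin> I" "insert e I = Basis" using e by (auto simp: I_def)
  have cardI: "card I = CARD('n) - 1" using e by (simp add: I_def)
  have I0: "I \<noteq> {}" using cardI card by auto
  have k: "k = real (card I)" using cardI card by (simp add: k_def of_nat_diff)
  have k1: "1 \<le> card I" using cardI card by simp
  define \<rho> where "\<rho> f = sqrt (\<Sum>i\<in>I. (f i)\<^sup>2)" for f :: "real^'n \<Rightarrow> real"
  have \<rho>m[measurable]: "\<rho> \<in> borel_measurable (Pi\<^sub>M I (\<lambda>_. lborel))" unfolding \<rho>_def[abs_def] by measurable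
  have \<rho>0: "0 \<le> \<rho> f" for f by (simp add: \<rho>_def sum_nonneg)
  have e1: "norm e = 1" using e by simp
  let ?S = "\<lambda>f. \<Sum>b\<in>Basis. f b *\<^sub>R b :: real^'n"
  have Sm[measurable]: "?S \<in> borel_measurable (Pi\<^sub>M Basis (\<lambda>_. lborel))"
    by measurable
  have S: "norm (?S (f(e := y))) ^ 2 = (\<rho> f)\<^sup>2 + y\<^sup>2" "?S (f(e := y)) \<bullet> e = y" for f y
  proof -
    have inner: "?S g \<bullet> b = g b" if "b \<in> Basis" for g and b :: "real^'n" using that by simp
    show "?S (f(e := y)) \<bullet> e = y" using inner[OF e, of "f(e := y)"] by simp
    have "norm (?S (f(e := y))) ^ 2 = (\<Sum>b\<in>Basis. (?S (f(e := y)) \<bullet> b)\<^sup>2)"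
      unfolding power2_norm_eq_inner by (subst euclidean_inner) (simp add: power2_eq_square)
    also have "\<dots> = (\<Sum>b\<in>Basis. ((f(e := y)) b)\<^sup>2)" by (intro sum.cong refl) (simp only: inner)
    also have "\<dots> = y\<^sup>2 + (\<Sum>b\<in>I. ((f(e := y)) b)\<^sup>2)"
      unfolding I(3)[symmetric] using I(1,2) by (subst sum.insert) auto
    also have "(\<Sum>b\<in>I. ((f(e := y)) b)\<^sup>2) = (\<rho> f)\<^sup>2"
      using I(2) by (simp add: \<rho>_def sum_nonneg) (intro sum.cong, auto)
    finally show "norm (?S (f(e := y))) ^ 2 = (\<rho> f)\<^sup>2 + y\<^sup>2" by simp
  qed
  have bS: "bracket e (?S (f(e := y))) = \<rho> f" for f y
  proof -
    have "(bracket e (?S (f(e := y))))\<^sup>2 = (\<rho> f)\<^sup>2" unfolding bracket_axis_sq[OF e1] S by simp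
    then show ?thesis using \<rho>0[of f] by simp
  qed
  have nS: "norm (?S (f(e := y))) < 1 \<longleftrightarrow> (\<rho> f)\<^sup>2 + y\<^sup>2 < 1" for f y
    unfolding S(1)[symmetric] by (simp add: power_less_one_iff abs_square_less_1)
  have sec: "(\<integral>\<^sup>+y. indicator {y. r\<^sup>2 + y\<^sup>2 < 1} y \<partial>lborel) = ennreal (2 * sqrt (1 - r\<^sup>2)) * indicator {..1} r" if "0 \<le> r" for r :: real
  proof (cases "r \<le> 1")
    case True
    have "{y. r\<^sup>2 + y\<^sup>2 < 1} = {- sqrt (1 - r\<^sup>2)<..<sqrt (1 - r\<^sup>2)}"
    proof (intro set_eqI)
      fix y
      have "y\<^sup>2 < 1 - r\<^sup>2 \<longleftrightarrow> \<bar>y\<bar> < sqrt (1 - r\<^sup>2)"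
        by (metis real_sqrt_abs real_sqrt_less_iff)
      then show "y \<in> {y. r\<^sup>2 + y\<^sup>2 < 1} \<longleftrightarrow> y \<in> {- sqrt (1 - r\<^sup>2)<..<sqrt (1 - r\<^sup>2)}" by auto
    qed
    moreover have "0 \<le> sqrt (1 - r\<^sup>2)" using True that by (simp add: power_le_one)
    ultimately show ?thesis using True by simp
  next
    case False
    then have "1 < r\<^sup>2" using that by (simp add: one_less_power)
    then have "{y. r\<^sup>2 + y\<^sup>2 < 1} = {}" by (auto simp: not_less) (smt (verit) zero_le_power2)
    then show ?thesis using False by simp
  qed
  let ?b = "\<lambda>t. t powr ((k + p) / 2 - 1) * (1 - t) powr (3 / 2 - 1)"
  let ?F = "\<lambda>x. ennreal (bracket e x powr p) * ind norm x"
  have "(\<integral>\<^sup>+x. ?F x \<partial>lborel) = (\<integral>\<^sup>+f. ?F (?S f) \<partial>Pi\<^sub>M (insert e I) (\<lambda>_. lborel))"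
    unfolding I(3) by (subst lborel_eq, rule nn_integral_distr) measurable
  also have "\<dots> = (\<integral>\<^sup>+f. \<integral>\<^sup>+y. ?F (?S (f(e := y))) \<partial>lborel \<partial>Pi\<^sub>M I (\<lambda>_. lborel))"
  proof (rule product_nn_integral_insert[OF I(1,2)])
    show "(\<lambda>f. ?F (?S f)) \<in> borel_measurable (Pi\<^sub>M (insert e I) (\<lambda>_. lborel))"
      unfolding I(3) by measurable
  qed
  also have "\<dots> = (\<integral>\<^sup>+f. ennreal (\<rho> f powr p) * (ennreal (2 * sqrt (1 - (\<rho> f)\<^sup>2)) * indicator {..1} (\<rho> f)) \<partial>Pi\<^sub>M I (\<lambda>_. lborel))"
  proof (rule nn_integral_cong)
    fix f
    have "(\<integral>\<^sup>+y. ?F (?S (f(e := y))) \<partial>lborel) = (\<integral>\<^sup>+y. ennreal (\<rho> f powr p) * indicator {y. (\<rho> f)\<^sup>2 + y\<^sup>2 < 1} y \<partial>lborel)"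
      unfolding bS by (intro nn_integral_cong) (simp only: indicator_def mem_Collect_eq nS)
    also have "\<dots> = ennreal (\<rho> f powr p) * (\<integral>\<^sup>+y. indicator {y. (\<rho> f)\<^sup>2 + y\<^sup>2 < 1} y \<partial>lborel)"
      by (rule nn_integral_cmult) measurable
    finally show "(\<integral>\<^sup>+y. ?F (?S (f(e := y))) \<partial>lborel) = ennreal (\<rho> f powr p) * (ennreal (2 * sqrt (1 - (\<rho> f)\<^sup>2)) * indicator {..1} (\<rho> f))"
      unfolding sec[OF \<rho>0] .
  qed
  also have "\<dots> = (\<integral>\<^sup>+r. ennreal (r powr p) * (ennreal (2 * sqrt (1 - r\<^sup>2)) * indicator {..1} r) \<partial>distr (Pi\<^sub>M I (\<lambda>_. lborel)) borel \<rho>)"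
    by (rule nn_integral_distr[symmetric]) measurable
  also have "\<dots> = (\<integral>\<^sup>+r. ennreal (k * unit_ball_vol k * r ^ (card I - 1)) * indicator {0..} r * (ennreal (r powr p) * (ennreal (2 * sqrt (1 - r\<^sup>2)) * indicator {..1} r)) \<partial>lborel)"
    unfolding \<rho>_def[abs_def] distr_radius_PiM[OF I(1) I0] k by (rule nn_integral_density) measurable
  also have "\<dots> = (\<integral>\<^sup>+r. ennreal (k * unit_ball_vol k) * (ennreal (?b (r\<^sup>2)) * ennreal (2 * r) * indicator {0..1} r) \<partial>lborel)"
  proof (rule nn_integral_cong)
    fix r :: real
    show "ennreal (k * unit_ball_vol k * r ^ (card I - 1)) * indicator {0..} r * (ennreal (r powr p) * (ennreal (2 * sqrt (1 - r\<^sup>2)) * indicator {..1} r))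
      = ennreal (k * unit_ball_vol k) * (ennreal (?b (r\<^sup>2)) * ennreal (2 * r) * indicator {0..1} r)"
    proof (cases "0 < r \<and> r \<le> 1")
      case True
      have f1: "r ^ (card I - 1) = r powr (k - 1)" using True k1 by (simp add: k powr_realpow[symmetric] of_nat_diff)
      have f2: "(r\<^sup>2) powr ((k + p) / 2 - 1) = r powr (k + p - 2)"
      proof -
        have h1: "(r\<^sup>2) powr s = r powr (2 * s)" for s using True by (simp add: powr_powr flip: powr_numeral)
        have h2: "2 * ((k + p) / 2 - 1) = k + p - 2" by (simp add: field_simps)
        show ?thesis unfolding h1 h2 ..
      qed
      have f3: "r powr (k - 1) * r powr p = r powr (k + p - 2) * r"
      proof -
        have "r powr (k - 1) * r powr p = r powr ((k - 1) + p)" by (simp only: powr_add)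
        also have "(k - 1) + p = (k + p - 2) + 1" by simp
        also have "r powr ((k + p - 2) + 1) = r powr (k + p - 2) * r" using True by (simp only: powr_add) simp
        finally show ?thesis .
      qed
      have f4: "(1 - r\<^sup>2) powr (3 / 2 - 1) = sqrt (1 - r\<^sup>2)"
        using True by (simp add: powr_half_sqrt power_le_one)
      have f5: "0 \<le> k * unit_ball_vol k" "0 \<le> sqrt (1 - r\<^sup>2)" using k True by (auto simp: power_le_one)
      have prod: "ennreal (K * x) * (ennreal y * ennreal (2 * S)) = ennreal K * (ennreal (z * S) * ennreal (2 * r))"
        if "0 \<le> K" "0 \<le> x" "0 \<le> y" "0 \<le> S" "0 \<le> z" and e: "x * y = z * r" for K x y z S :: real
      proof -
        have "K * x * (y * (2 * S)) = K * (2 * S) * (x * y)" by simp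
        also have "\<dots> = K * (z * S * (2 * r))" unfolding e by simp
        finally show ?thesis using that True by (simp add: ennreal_mult[symmetric])
      qed
      show ?thesis
        unfolding f1 f2 f4 using True prod[OF f5(1) _ _ f5(2) _ f3] by simp
    next
      case False
      then show ?thesis using p by (cases "r = 0") (auto simp: indicator_def)
    qed
  qed
  also have "\<dots> = ennreal (k * unit_ball_vol k) * (\<integral>\<^sup>+r. ennreal (?b (r\<^sup>2)) * ennreal (2 * r) * indicator {0..1} r \<partial>lborel)"
    by (rule nn_integral_cmult) measurable
  also have "(\<integral>\<^sup>+r. ennreal (?b (r\<^sup>2)) * ennreal (2 * r) * indicator {0..1} r \<partial>lborel)
    = (\<integral>\<^sup>+t. ennreal (?b t) * indicator {0\<^sup>2..1\<^sup>2} t \<partial>lborel)"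
    by (rule nn_integral_substitution_aux[symmetric, where g = "\<lambda>r. r\<^sup>2"])
       (auto intro!: derivative_eq_intros continuous_intros)
  also have "\<dots> = (\<integral>\<^sup>+t. indicator {0..1} t * ennreal (?b t) \<partial>lborel)"
    by (simp add: mult.commute)
  also have "\<dots> = (\<integral>\<^sup>+t. ennreal (indicator {0..1} t * (?b t)) \<partial>lborel)"
    by (intro nn_integral_cong) (auto simp: indicator_def)
  also have "\<dots> = ennreal (Beta ((k + p) / 2) (3 / 2))"
    by (rule nn_integral_has_integral_lebesgue) (use has_integral_Beta_real[of "(k + p) / 2" "3/2"] k p in auto)
  also have "ennreal (k * unit_ball_vol k) * \<dots> = ennreal (k * unit_ball_vol k * Beta ((k + p) / 2) (3 / 2))"
    using k by (simp add: ennreal_mult'' ennreal_mult')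
  finally show ?thesis .
qed

text \<open>Reflections make the potential of the uniform density constant on the sphere, so the
  energy equals that constant. It is read off from a ball integral by undoing the radial
  integration.\<close>

lemma ball_energy_eq:
  assumes card: "2 \<le> CARD('n::finite)" and p: "1 \<le> p"
  defines "n \<equiv> real CARD('n)"
  shows "ball_energy TYPE('n) p = ennreal ((n - 1) * omega (n - 1) * omega (n + p - 2) / (n * omega n * omega (n + p - 3)))"
proof -
  define Z where "Z u = (\<integral>\<^sup>+v. ennreal (bracket u v powr p) \<partial>sph)" for u :: "real^'n"
  define k where "k = n - 1"
  have n: "2 \<le> n" using card by (simp add: n_def)
  obtain e :: "real^'n" where e: "e \<in> Basis" using nonempty_Basis by blast
  have e1: "norm e = 1" using e by simp
  \<comment> \<open>The factor that radial integration over the unit ball produces for an integrand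
    of degree p.\<close>
  define K where "K = n * unit_ball_vol n / (n + p)"
  have K: "0 < K" using n p by (simp add: K_def)
  have KZ: "ennreal K * Z u = ennreal (k * unit_ball_vol k * Beta ((k + p) / 2) (3 / 2))" if u: "norm u = 1" for u
  proof -
    have "(\<integral>\<^sup>+x. ennreal (bracket u x powr p) * ind norm x \<partial>lborel)
      = ennreal K * (\<integral>\<^sup>+v. ennreal (bracket u v powr p) * ennreal (norm v powr - (n + p)) \<partial>sph)"
      unfolding K_def n_def
      by (rule nn_integral_sublevel_sphere) (use p in \<open>auto simp: bracket_scaleR_right powr_mult ennreal_mult\<close>)
    also have "(\<integral>\<^sup>+v. ennreal (bracket u v powr p) * ennreal (norm v powr - (n + p)) \<partial>sph) = Z u"
      unfolding Z_def by (intro nn_integral_cong) simp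
    finally have 1: "ennreal K * Z u = (\<integral>\<^sup>+x. ennreal (bracket u x powr p) * ind norm x \<partial>lborel)" by simp
    have 2: "\<dots> = (\<integral>\<^sup>+x. ennreal (bracket e x powr p) * ind norm x \<partial>lborel)"
    proof (cases "u = e")
      case False
      define w where "w = sgn (e - u)"
      have w: "norm w = 1" using False by (simp add: w_def norm_sgn)
      have r: "reflect w e = u" unfolding w_def using False u e1 by (intro reflect_swap) auto
      have "(\<integral>\<^sup>+x. ennreal (bracket u x powr p) * ind norm x \<partial>lborel)
        = (\<integral>\<^sup>+x. ennreal (bracket u x powr p) * ind norm x \<partial>distr lborel borel (reflect w))"
        by (simp add: distr_reflect w)
      also have "\<dots> = (\<integral>\<^sup>+x. ennreal (bracket (reflect w e) (reflect w x) powr p) * ind norm (reflect w x) \<partial>lborel)"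
        unfolding r by (rule nn_integral_distr) measurable
      also have "\<dots> = (\<integral>\<^sup>+x. ennreal (bracket e x powr p) * ind norm x \<partial>lborel)"
        by (simp add: bracket_reflect w indicator_def norm_reflect)
      finally show ?thesis .
    qed simp
    show ?thesis unfolding 1 2 k_def n_def by (rule nn_integral_bracket_ball[OF e card p])
  qed
  define \<kappa> where "\<kappa> = k * unit_ball_vol k * Beta ((k + p) / 2) (3 / 2) / K"
  have B0: "0 < Beta ((k + p) / 2) (3 / 2)" using n p unfolding Beta_def k_def
    by (intro divide_pos_pos mult_pos_pos Gamma_real_pos) (auto simp: field_simps)
  have \<kappa>0: "0 \<le> \<kappa>" using B0 K n by (simp add: \<kappa>_def k_def)
  have Z: "Z u = ennreal \<kappa>" if "norm u = 1" for u
  proof -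
    have "ennreal K * Z u = ennreal K * ennreal \<kappa>"
      using KZ[OF that] K \<kappa>0 by (simp add: ennreal_mult[symmetric] \<kappa>_def)
    then show ?thesis using K by (subst (asm) ennreal_mult_cancel_left) auto
  qed
  have "ball_energy TYPE('n) p = (\<integral>\<^sup>+u. Z u \<partial>sph)"
    unfolding ball_energy_def sph_energy_def Z_def by (intro nn_integral_cong) simp
  also have "\<dots> = (\<integral>\<^sup>+u. ennreal \<kappa> \<partial>sphere_measure TYPE('n))" by (intro nn_integral_cong Z) simp
  also have "\<dots> = ennreal \<kappa>" by (simp add: emeasure_sphere_measure_space)
  also have "\<kappa> = (n - 1) * omega (n - 1) * omega (n + p - 2) / (n * omega n * omega (n + p - 3))"
  proof -
    have ub: "unit_ball_vol s = omega s" for s by (simp add: unit_ball_vol_def omega_def add.commute)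
    define G where "G = Gamma ((n + p) / 2)"
    define G' where "G' = Gamma ((n + p - 1) / 2)"
    have G: "0 < G" "0 < G'" using n p by (simp_all add: G_def G'_def Gamma_real_pos)
    have o1: "omega (n + p - 2) = pi powr ((n + p - 2) / 2) / G"
      unfolding omega_def G_def by (rule arg_cong2[where f = "(/)"], simp, rule arg_cong[where f = Gamma]) (simp add: field_simps)
    have o2: "omega (n + p - 3) = pi powr ((n + p - 3) / 2) / G'"
      unfolding omega_def G'_def by (rule arg_cong2[where f = "(/)"], simp, rule arg_cong[where f = Gamma]) (simp add: field_simps)
    have "pi powr ((n + p - 2) / 2) = pi powr (1/2) * pi powr ((n + p - 3) / 2)"
      by (simp add: powr_add[symmetric]) (simp add: field_simps)
    \<comment> \<open>The quotient of \<open>omega\<close> at consecutive arguments encodes the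
      quotient of Gamma values that the Beta function leaves.\<close>
    then have oq: "omega (n + p - 2) / omega (n + p - 3) = sqrt pi * G' / G"
      unfolding o1 o2 using G by (simp add: powr_half_sqrt)
    have g32: "Gamma (3 / 2 :: real) = sqrt pi / 2"
    proof -
      have "(1 / 2 :: real) \<notin> \<int>\<^sub>\<le>\<^sub>0" using nonpos_Ints_nonpos[of "1 / 2 :: real"] by auto
      then show ?thesis using Gamma_plus1[of "1 / 2 :: real"] by (simp add: Gamma_one_half_real)
    qed
    have gs: "Gamma ((k + p) / 2 + 3 / 2) = (n + p) / 2 * G"
    proof -
      have "(k + p) / 2 + 3 / 2 = (n + p) / 2 + 1" by (simp add: k_def field_simps)
      moreover have "(n + p) / 2 \<noteq> 0" "(n + p) / 2 \<notin> \<int>\<^sub>\<le>\<^sub>0" using n p by (auto elim!: nonpos_Ints_cases)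
      ultimately show ?thesis using Gamma_plus1[of "(n + p) / 2"] by (simp add: G_def)
    qed
    have be: "Beta ((k + p) / 2) (3 / 2) = G' * (sqrt pi / 2) / ((n + p) / 2 * G)"
      unfolding Beta_def gs g32 G'_def by (simp add: k_def algebra_simps)
    have "\<kappa> = k * omega k * (G' * sqrt pi / G) / (n * omega n)"
    proof -
      have "k * w * (G' * (s / 2) / (m / 2 * G)) / (n * W / m) = k * w * (G' * s / G) / (n * W)"
        if "m \<noteq> 0" for w s m W :: real
        using that by (simp add: field_simps)
      from this[of "n + p"] show ?thesis
        unfolding \<kappa>_def be K_def ub using n p by simp
    qed
    also have "G' * sqrt pi / G = omega (n + p - 2) / omega (n + p - 3)" unfolding oq by simp
    finally show ?thesis by (simp add: k_def)
  qed
  finally show ?thesis .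
qed

section \<open>Reverse Hoelder inequality\<close>

lemma convex_powr_nonneg:
  fixes x y u v p :: real
  assumes p: "1 \<le> p" and xy: "0 \<le> x" "0 \<le> y" and uv: "0 \<le> u" "0 \<le> v" "u + v = 1"
  shows "(u * x + v * y) powr p \<le> u * x powr p + v * y powr p"
proof -
  have *: "(t * z) powr p \<le> t * z powr p" if "0 \<le> t" "t \<le> 1" "0 \<le> z" for t z :: real
  proof (cases "t = 0")
    case False
    then have "t powr p \<le> t powr 1" using that p by (intro powr_mono') auto
    then have "t powr p * z powr p \<le> t * z powr p" using that by (intro mult_right_mono) auto
    then show ?thesis using that by (simp add: powr_mult)
  qed simp
  consider "x = 0" | "y = 0" | "0 < x" "0 < y" using xy by linarith
  then show ?thesis
  proof cases
    case 3
    have v: "u = 1 - v" using uv by simp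
    show ?thesis
      using convex_onD[OF powr_convex[OF p], of v x y] 3 uv unfolding v by simp
  qed (use *[of v y] *[of u x] uv xy in auto)
qed

text \<open>With t = exp y, the difference of the sides is exp y times a positive combination of the
  gaps in exp z >= 1 + z at z = \<open>\<alpha> * y\<close> and z = -y; both gaps vanish only for y
  = 0.\<close>

lemma bernoulli_powr_strict:
  fixes t \<alpha> :: real
  assumes t: "0 < t" and \<alpha>: "0 < \<alpha>"
  shows "(1 + \<alpha>) * t - \<alpha> \<le> t powr (1 + \<alpha>)"
    and "(1 + \<alpha>) * t - \<alpha> = t powr (1 + \<alpha>) \<Longrightarrow> t = 1"
proof -
  define y where "y = ln t"
  have ty: "t = exp y" using t by (simp add: y_def)
  have e1: "1 + \<alpha> * y \<le> exp (\<alpha> * y)" by simp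
  have e2: "1 - y \<le> exp (- y)" using exp_ge_add_one_self[of "- y"] by simp
  have pw: "t powr (1 + \<alpha>) = exp y * exp (\<alpha> * y)"
  proof -
    have "t powr (1 + \<alpha>) = exp ((1 + \<alpha>) * y)" using t by (simp add: powr_def y_def)
    also have "(1 + \<alpha>) * y = y + \<alpha> * y" by (simp add: distrib_right)
    finally show ?thesis by (simp only: exp_add)
  qed
  have key: "t powr (1 + \<alpha>) - ((1 + \<alpha>) * t - \<alpha>) = exp y * ((exp (\<alpha> * y) - (1 + \<alpha> * y)) + \<alpha> * (exp (- y) - (1 - y)))"
    unfolding pw unfolding ty by (simp add: algebra_simps exp_minus)
  have "0 \<le> exp y * ((exp (\<alpha> * y) - (1 + \<alpha> * y)) + \<alpha> * (exp (- y) - (1 - y)))"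
    using e1 e2 \<alpha> by (intro mult_nonneg_nonneg add_nonneg_nonneg) auto
  then show "(1 + \<alpha>) * t - \<alpha> \<le> t powr (1 + \<alpha>)" using key by linarith
  assume "(1 + \<alpha>) * t - \<alpha> = t powr (1 + \<alpha>)"
  then have "exp y * ((exp (\<alpha> * y) - (1 + \<alpha> * y)) + \<alpha> * (exp (- y) - (1 - y))) = 0" using key by linarith
  then have "(exp (\<alpha> * y) - (1 + \<alpha> * y)) + \<alpha> * (exp (- y) - (1 - y)) = 0" by simp
  moreover have "0 \<le> \<alpha> * (exp (- y) - (1 - y))" using e2 \<alpha> by simp
  ultimately have "\<alpha> * (exp (- y) - (1 - y)) = 0" using e1 by linarith
  then have "exp (- y) = 1 - y" using \<alpha> by simp
  then have "ln (exp (- y)) = exp (- y) - 1" unfolding ln_exp by simp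
  then have "exp (- y) = 1" by (intro ln_eq_minus_one) auto
  then show "t = 1" by (simp add: ty)
qed

text \<open>The preceding inequality made homogeneous by t = x / y. The value \<open>x = 0\<close>
  is included because a density may vanish; there the inequality is strict.\<close>

lemma reverse_young:
  fixes x y \<alpha> :: real
  assumes x: "0 \<le> x" and y: "0 < y" and \<alpha>: "0 < \<alpha>"
  shows "(1 + \<alpha>) * x - \<alpha> * y \<le> x powr (1 + \<alpha>) * y powr - \<alpha>"
    and "(1 + \<alpha>) * x - \<alpha> * y = x powr (1 + \<alpha>) * y powr - \<alpha> \<Longrightarrow> x = y"
proof -
  have "(1 + \<alpha>) * x - \<alpha> * y \<le> x powr (1 + \<alpha>) * y powr - \<alpha> \<and>
    ((1 + \<alpha>) * x - \<alpha> * y = x powr (1 + \<alpha>) * y powr - \<alpha> \<longrightarrow> x = y)"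
  proof (cases "x = 0")
    case True
    then show ?thesis using y \<alpha> by simp
  next
    case False
    define t where "t = x / y"
    have t: "0 < t" "x = t * y" using False x y by (simp_all add: t_def)
    have r: "x powr (1 + \<alpha>) * y powr - \<alpha> = y * t powr (1 + \<alpha>)"
    proof -
      have "y powr (1 + \<alpha>) * y powr - \<alpha> = y" using y by (simp add: powr_add[symmetric])
      then show ?thesis using t y by (simp add: powr_mult mult_ac)
    qed
    have l: "(1 + \<alpha>) * x - \<alpha> * y = y * ((1 + \<alpha>) * t - \<alpha>)" by (simp add: t(2) algebra_simps)
    show ?thesis
      unfolding r l using bernoulli_powr_strict[OF t(1) \<alpha>] y t(2) by (auto intro: mult_left_mono)
  qed
  then show "(1 + \<alpha>) * x - \<alpha> * y \<le> x powr (1 + \<alpha>) * y powr - \<alpha>"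
    "(1 + \<alpha>) * x - \<alpha> * y = x powr (1 + \<alpha>) * y powr - \<alpha> \<Longrightarrow> x = y" by auto
qed

text \<open>On a finite measure space the bound f^q <= 1 + f suffices; without integrability the
  integral inside \<open>sph_norm\<close> would take its default value 0.\<close>

lemma integrable_powr_sphere:
  assumes f: "integrable (sphere_measure TYPE('n::finite)) f" and f0: "AE u in sph. 0 \<le> f u"
    and q: "0 \<le> q" "q \<le> (1 :: real)"
  shows "integrable sph (\<lambda>u. f u powr q)"
proof -
  interpret finite_measure "sphere_measure TYPE('n)" by (rule finite_measure_sphere)
  note [measurable] = borel_measurable_integrable[OF f]
  show ?thesis
  proof (rule Bochner_Integration.integrable_bound)
    show "integrable sph (\<lambda>u. 1 + f u)" using f by simp
    show "AE u in sph. norm (f u powr q) \<le> norm (1 + f u)"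
      using f0
    proof eventually_elim
      case (elim u)
      have "f u powr q \<le> (1 + f u) powr q" using elim q by (intro powr_mono2) auto
      also have "\<dots> \<le> (1 + f u) powr 1" using elim q by (intro powr_mono) auto
      finally show ?case using elim by simp
    qed
  qed measurable
qed

lemma integrable_norm_fn_powr:
  fixes N :: "real^'n \<Rightarrow> real"
  assumes N: "norm_fn a b N" and s: "0 \<le> s"
  shows "integrable sph (\<lambda>u. N u powr - s)"
proof -
  interpret finite_measure "sphere_measure TYPE('n)" by (rule finite_measure_sphere)
  note [measurable] = norm_fn_measurable_sphere[OF N]
  show ?thesis
    by (rule integrable_const_bound[where B = "a powr - s"])
       (auto intro!: AE_I2 norm_fn.powr_sphere_le[OF N] s)
qed

lemma sph_vol_eq_integral:
  fixes N :: "real^'n \<Rightarrow> real"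
  assumes N: "norm_fn a b N"
  shows "sph_vol N = ennreal (\<integral>u. N u powr - real CARD('n) \<partial>sph)"
  unfolding sph_vol_def by (rule nn_integral_eq_integral) (auto intro!: integrable_norm_fn_powr[OF N])

lemma integral_sphere_pos:
  fixes N :: "real^'n \<Rightarrow> real"
  assumes N: "norm_fn a b N" and s: "0 \<le> s"
  shows "0 < (\<integral>u. N u powr - s \<partial>sph)"
proof -
  have i: "integrable sph (\<lambda>u. N u powr - s)" by (rule integrable_norm_fn_powr[OF N s])
  have "0 \<le> (\<integral>u. N u powr - s \<partial>sph)" by (intro integral_nonneg_AE) auto
  moreover have "(\<integral>u. N u powr - s \<partial>sph) \<noteq> 0"
  proof
    assume "(\<integral>u. N u powr - s \<partial>sph) = 0"
    then have "AE u in sph. N u powr - s = 0"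
      by (subst (asm) integral_nonneg_eq_0_iff_AE[OF i]) auto
    moreover have "AE u in sph. N u powr - s \<noteq> 0"
    proof (rule AE_I2)
      fix u :: "real^'n" assume "u \<in> space (sphere_measure TYPE('n))"
      then have "u \<noteq> 0" by auto
      then show "N u powr - s \<noteq> 0" using norm_fn.pos[OF N, of u] by simp
    qed
    ultimately have "AE u in sphere_measure TYPE('n). False" by eventually_elim simp
    then obtain Z where Z: "{u \<in> space (sphere_measure TYPE('n)). \<not> False} \<subseteq> Z" "emeasure (sphere_measure TYPE('n)) Z = 0"
      "Z \<in> sets (sphere_measure TYPE('n))" by (rule AE_E)
    then have "Z = sphere 0 1" using sets.sets_into_space[OF Z(3)] by auto
    with Z(2) show False by (simp add: emeasure_sphere_measure_space)
  qed
  ultimately show ?thesis by linarith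
qed

text \<open>\<open>reverse_young\<close> with exponent p/n is integrated for the normalized
  functions f^q / F and N^(-n) / A, both of integral 1. Equality of the integrals makes the
  pointwise gap vanish almost everywhere, so these functions agree.\<close>

lemma reverse_hoelder:
  fixes N f :: "real^'n \<Rightarrow> real"
  assumes p: "0 < p" and N: "norm_fn a b N"
    and f: "integrable sph f" and f0: "AE u in sph. 0 \<le> f u"
  defines "n \<equiv> real CARD('n)"
  defines "A \<equiv> (\<integral>u. N u powr - n \<partial>sph)"
    and "F \<equiv> (\<integral>u. f u powr (n / (n + p)) \<partial>sph)"
    and "I \<equiv> (\<integral>u. f u * N u powr p \<partial>sph)"
  shows "A powr - (p / n) * F powr ((n + p) / n) \<le> I"
    and "A powr - (p / n) * F powr ((n + p) / n) = I \<Longrightarrow> 0 < F \<Longrightarrow>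
      \<exists>d>0. AE u in sph. f u = d * N u powr - (n + p)"
proof -
  let ?s = "sphere_measure TYPE('n)"
  interpret N: norm_fn a b N by fact
  interpret S: finite_measure ?s by (rule finite_measure_sphere)
  have n: "0 < n" by (simp add: n_def)
  define q \<alpha> where "q = n / (n + p)" and "\<alpha> = p / n"
  have \<alpha>: "0 < \<alpha>" "1 + \<alpha> = (n + p) / n" using n p by (simp_all add: \<alpha>_def field_simps)
  have q: "0 < q" "q \<le> 1" "q * (1 + \<alpha>) = 1" using n p unfolding \<alpha>(2) by (simp_all add: q_def)
  have fq: "integrable ?s (\<lambda>u. f u powr q)" using q by (intro integrable_powr_sphere[OF f f0]) auto
  have Nn: "integrable ?s (\<lambda>u. N u powr - n)" using n by (intro integrable_norm_fn_powr[OF N]) simp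
  have A: "0 < A" unfolding A_def using n by (intro integral_sphere_pos[OF N]) simp
  have F0: "0 \<le> F" unfolding F_def by (intro integral_nonneg_AE) auto
  note [measurable] = norm_fn_measurable_sphere[OF N] borel_measurable_integrable[OF f]
  have fN: "integrable ?s (\<lambda>u. f u * N u powr p)"
  proof (rule Bochner_Integration.integrable_bound)
    show "integrable ?s (\<lambda>u. \<bar>b\<bar> powr p * f u)" using f by simp
    show "AE u in ?s. norm (f u * N u powr p) \<le> norm (\<bar>b\<bar> powr p * f u)"
    proof (rule AE_I2)
      fix u assume "u \<in> space ?s"
      then have "N u \<le> \<bar>b\<bar>" using N.upper[of u] by simp
      then have "N u powr p \<le> \<bar>b\<bar> powr p" using N.nonneg[of u] p by (intro powr_mono2) auto
      then show "norm (f u * N u powr p) \<le> norm (\<bar>b\<bar> powr p * f u)"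
        by (simp add: abs_mult mult.commute mult_left_mono)
    qed
  qed measurable
  have I0: "0 \<le> I" unfolding I_def using f0 by (intro integral_nonneg_AE) (auto elim!: eventually_mono)
  have main: "A powr - (p / n) * F powr ((n + p) / n) \<le> I \<and> (A powr - (p / n) * F powr ((n + p) / n) = I \<longrightarrow>
      (\<exists>d>0. AE u in ?s. f u = d * N u powr - (n + p)))" if F: "0 < F"
  proof -
    \<comment> \<open>Chosen so that the product on the right of \<open>reverse_young\<close>
      becomes \<open>c\<close> times f N^p, with all powers of \<open>A\<close> and \<open>F\<close>
      collected.\<close>
    define c where "c = A powr \<alpha> * F powr - (1 + \<alpha>)"
    have c: "0 < c" using A F by (simp add: c_def)
    define D where "D u = c * (f u * N u powr p) - ((1 + \<alpha>) * (f u powr q / F) - \<alpha> * (N u powr - n / A))" for u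
    have prod: "(f u powr q / F) powr (1 + \<alpha>) * (N u powr - n / A) powr - \<alpha> = c * (f u * N u powr p)"
      if "0 \<le> f u" "u \<in> space ?s" for u
    proof -
      have Nu: "0 < N u" using that(2) by (intro N.pos) auto
      have "(f u powr q / F) powr (1 + \<alpha>) = f u * F powr - (1 + \<alpha>)"
        using that(1) F unfolding powr_minus_divide by (simp add: powr_divide powr_powr q(3))
      moreover have "(N u powr - n / A) powr - \<alpha> = N u powr p * A powr \<alpha>"
        using Nu A n by (simp add: powr_divide powr_powr \<alpha>_def) (simp add: powr_minus_divide)
      ultimately show ?thesis by (simp add: c_def mult_ac)
    qed
    have Dint: "integrable ?s D"
      unfolding D_def using fN fq Nn by (intro Bochner_Integration.integrable_diff integrable_mult_right integrable_divide) auto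
    have Dnn: "AE u in ?s. 0 \<le> D u" and Deq: "AE u in ?s. D u = 0 \<longrightarrow> f u powr q / F = N u powr - n / A"
    proof -
      have "AE u in ?s. 0 \<le> D u \<and> (D u = 0 \<longrightarrow> f u powr q / F = N u powr - n / A)"
        using f0 AE_space
      proof eventually_elim
        case (elim u)
        have Nu: "0 < N u" using elim(2) by (intro N.pos) auto
        have 1: "0 \<le> f u powr q / F" "0 < N u powr - n / A" using Nu F A by simp_all
        show ?case
          using reverse_young[OF 1 \<alpha>(1)] unfolding prod[OF elim] D_def by auto
      qed
      then show "AE u in ?s. 0 \<le> D u" "AE u in ?s. D u = 0 \<longrightarrow> f u powr q / F = N u powr - n / A"
        by (auto elim: eventually_mono)
    qed
    have DI: "integral\<^sup>L ?s D = c * I - 1"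
    proof -
      have "integral\<^sup>L ?s D = c * I - ((1 + \<alpha>) * (F / F) - \<alpha> * (A / A))"
        unfolding D_def I_def F_def A_def q_def[symmetric] using fN fq Nn by simp
      then show ?thesis using F A by simp
    qed
    have cinv: "A powr - (p / n) * F powr ((n + p) / n) = 1 / c"
      unfolding c_def \<alpha>(2)[symmetric] \<alpha>_def[symmetric] powr_minus_divide using A F by simp
    have "0 \<le> c * I - 1" unfolding DI[symmetric] using Dnn by (rule integral_nonneg_AE)
    then have le: "1 / c \<le> I" using c by (simp add: field_simps)
    moreover have "\<exists>d>0. AE u in ?s. f u = d * N u powr - (n + p)" if eq: "1 / c = I"
    proof -
      have "integral\<^sup>L ?s D = 0" using DI eq c by (auto simp: field_simps)
      then have "AE u in ?s. D u = 0" by (subst (asm) integral_nonneg_eq_0_iff_AE[OF Dint Dnn])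
      with Deq f0 AE_space have "AE u in ?s. f u = (F / A) powr (1 / q) * N u powr - (n + p)"
      proof eventually_elim
        case (elim u)
        have Nu: "0 < N u" using elim(3) by (intro N.pos) auto
        have "f u powr q = F / A * N u powr - n" using elim(1,4) F A by (simp add: field_simps)
        then have "(f u powr q) powr (1 / q) = (F / A) powr (1 / q) * (N u powr - n) powr (1 / q)"
          by (simp only: powr_mult)
        moreover have "(f u powr q) powr (1 / q) = f u" using q elim(2) by (simp add: powr_powr)
        moreover have "(N u powr - n) powr (1 / q) = N u powr - (n + p)"
          using n by (simp add: powr_powr q_def)
        ultimately show ?case by simp
      qed
      moreover have "0 < (F / A) powr (1 / q)" using F A by simp
      ultimately show ?thesis by blast
    qed
    ultimately show ?thesis unfolding cinv by blast
  qed
  \<comment> \<open>The normalization needs F > 0; for F = 0 the left-hand side is 0, since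
    \<open>powr\<close> vanishes at base 0.\<close>
  show "A powr - (p / n) * F powr ((n + p) / n) \<le> I"
    using main F0 I0 by (cases "F = 0") auto
  show "\<exists>d>0. AE u in ?s. f u = d * N u powr - (n + p)" if "A powr - (p / n) * F powr ((n + p) / n) = I" "0 < F"
    using main that by blast
qed

section \<open>The potential of a density is a norm\<close>

definition potential :: "real \<Rightarrow> (real^'n \<Rightarrow> real) \<Rightarrow> real^'n \<Rightarrow> real" where
  "potential p f x = (\<integral>u. bracket x u powr p * f u \<partial>sph)"

text \<open>The lower bound is the minimum over the unit sphere, positive by compactness.\<close>

lemma norm_fnI:
  fixes N :: "real^'n \<Rightarrow> real"
  assumes subadd: "\<And>x y. N (x + y) \<le> N x + N y" and homog: "\<And>t x. N (t *\<^sub>R x) = \<bar>t\<bar> * N x"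
    and upper: "\<And>x. N x \<le> b * norm x" and b: "0 \<le> b" and pos: "\<And>x. x \<noteq> 0 \<Longrightarrow> 0 < N x"
  obtains a where "norm_fn a b N"
proof -
  have "b-lipschitz_on (sphere 0 1) N"
  proof (rule lipschitz_onI[OF _ b])
    fix x y
    have "N x \<le> N y + N (x - y)" "N y \<le> N x + N (y - x)"
      using subadd[of y "x - y"] subadd[of x "y - x"] by simp_all
    then show "dist (N x) (N y) \<le> b * dist x y"
      using upper[of "x - y"] upper[of "y - x"] by (simp add: dist_norm norm_minus_commute)
  qed
  then have cont: "continuous_on (sphere 0 1) N" by (rule lipschitz_on_continuous_on)
  obtain e :: "real^'n" where "norm e = 1" using vector_choose_size[of 1] by auto
  then have "sphere (0 :: real^'n) 1 \<noteq> {}" by auto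
  then obtain x0 :: "real^'n" where x0: "norm x0 = 1" "\<And>y. norm y = 1 \<Longrightarrow> N x0 \<le> N y"
    using continuous_attains_inf[OF compact_sphere _ cont] by auto
  have "norm_fn (N x0) b N"
  proof
    show "0 < N x0" using x0(1) by (intro pos) auto
    show "N x0 * norm x \<le> N x" for x
    proof (cases "x = 0")
      case False
      have "N x0 \<le> N (sgn x)" using False by (intro x0(2)) (simp add: norm_sgn)
      then have "norm x * N x0 \<le> norm x * N (sgn x)" by (intro mult_left_mono) auto
      also have "\<dots> = N (norm x *\<^sub>R sgn x)" unfolding homog by simp
      also have "norm x *\<^sub>R sgn x = x" using False by (simp add: sgn_div_norm)
      finally show ?thesis by (simp add: mult.commute)
    qed (use homog[of 0 0] in simp)
  qed (use subadd homog upper in auto)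
  then show thesis by (rule that)
qed

lemma measurable_bracket_sphere:
  "(\<lambda>u. bracket x u powr p) \<in> borel_measurable (sphere_measure TYPE('n::finite))"
  by (rule borel_measurable_sphere) measurable

lemma bracket_powr_le_sphere:
  assumes "0 \<le> p" "norm u = 1"
  shows "bracket x u powr p \<le> norm x powr p"
  using bracket_le[of x u] assms by (intro powr_mono2) auto

lemma potential_integrable:
  fixes f :: "real^'n \<Rightarrow> real"
  assumes p: "0 \<le> p" and f: "integrable sph f"
  shows "integrable sph (\<lambda>u. bracket x u powr p * f u)"
proof (rule Bochner_Integration.integrable_bound)
  note [measurable] = borel_measurable_integrable[OF f] measurable_bracket_sphere
  show "integrable sph (\<lambda>u. norm x powr p * f u)" using f by simp
  show "(\<lambda>u. bracket x u powr p * f u) \<in> borel_measurable sph" by measurable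
  show "AE u in sph. norm (bracket x u powr p * f u) \<le> norm (norm x powr p * f u)"
    by (intro AE_I2) (auto simp: abs_mult intro!: mult_right_mono bracket_powr_le_sphere p)
qed

lemma bracket_zero_imp_span: "norm u = 1 \<Longrightarrow> x \<noteq> 0 \<Longrightarrow> bracket x u = 0 \<Longrightarrow> u \<in> span {x}"
proof -
  assume u: "norm u = 1" and x: "x \<noteq> 0" and z: "bracket x u = 0"
  then have "(x \<bullet> u)\<^sup>2 = (norm x * norm u)\<^sup>2" using bracket_sq[of x u] by (simp add: power_mult_distrib)
  then have "\<bar>x \<bullet> u\<bar> = norm x * norm u" by (metis abs_norm_cancel abs_mult power2_eq_iff abs_minus_cancel)
  then have "norm x *\<^sub>R u = norm u *\<^sub>R x \<or> norm x *\<^sub>R u = - norm u *\<^sub>R x"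
    by (simp add: norm_cauchy_schwarz_abs_eq)
  then have "norm x *\<^sub>R u = x \<or> norm x *\<^sub>R u = - x" using u by simp
  then have "norm x *\<^sub>R u \<in> span {x}" using span_base[of x "{x}"] span_neg[of x "{x}"] by auto
  then have "inverse (norm x) *\<^sub>R (norm x *\<^sub>R u) \<in> span {x}" by (rule span_scale)
  then show ?thesis using x by simp
qed

locale sphere_density =
  fixes p :: real and f :: "real^'n \<Rightarrow> real"
  assumes p: "1 \<le> p" and card: "2 \<le> CARD('n)"
    and f: "integrable sph f"
    and f0: "AE u in sph. 0 \<le> f u"
begin

lemma potential_nonneg: "0 \<le> potential p f x"
  unfolding potential_def using f0 by (intro integral_nonneg_AE) (auto elim!: eventually_mono)

lemma kernel_integrable: "integrable sph (\<lambda>u. bracket x u powr p * f u)"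
  using p f by (intro potential_integrable) auto

lemma potential_scaleR: "potential p f (t *\<^sub>R x) = \<bar>t\<bar> powr p * potential p f x"
  unfolding potential_def
  by (subst integral_mult_right_zero[symmetric], intro Bochner_Integration.integral_cong refl)
     (simp add: bracket_scaleR_left powr_mult)

lemma potential_convex:
  assumes uv: "0 \<le> u" "0 \<le> v" "u + v = 1"
  shows "potential p f (u *\<^sub>R x + v *\<^sub>R y) \<le> u * potential p f x + v * potential p f y"
proof -
  have "potential p f (u *\<^sub>R x + v *\<^sub>R y)
    \<le> (\<integral>z. u * (bracket x z powr p * f z) + v * (bracket y z powr p * f z) \<partial>sph)"
    unfolding potential_def
  proof (rule integral_mono_AE)
    show "AE z in sph. bracket (u *\<^sub>R x + v *\<^sub>R y) z powr p * f z
      \<le> u * (bracket x z powr p * f z) + v * (bracket y z powr p * f z)"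
      using f0
    proof eventually_elim
      case (elim z)
      have "bracket (u *\<^sub>R x + v *\<^sub>R y) z \<le> u * bracket x z + v * bracket y z"
        using bracket_add_left[of "u *\<^sub>R x" "v *\<^sub>R y" z] uv by (simp add: bracket_scaleR_left)
      then have "bracket (u *\<^sub>R x + v *\<^sub>R y) z powr p \<le> (u * bracket x z + v * bracket y z) powr p"
        using p by (intro powr_mono2) auto
      also have "\<dots> \<le> u * bracket x z powr p + v * bracket y z powr p"
        by (intro convex_powr_nonneg p uv) auto
      finally show ?case using elim mult_right_mono[of _ _ "f z"] by (fastforce simp: algebra_simps)
    qed
  qed (use kernel_integrable in auto)
  also have "\<dots> = u * potential p f x + v * potential p f y"
    unfolding potential_def using kernel_integrable by simp
  finally show ?thesis .
qed

text \<open>The potential is convex of degree p, so its p-th root satisfies the triangle inequality: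
  x + y divided by the sum of the two root values is a convex combination of vectors of potential 1.
  It is positive because the bracket with x vanishes only on a line, which is a null set for n >=
  2.\<close>

lemma potential_norm_fn:
  assumes nz: "\<not> (AE u in sph. f u = 0)"
  obtains a b where "norm_fn a b (\<lambda>x. potential p f x powr (1 / p))"
proof -
  let ?s = "sphere_measure TYPE('n)" and ?N = "\<lambda>x. potential p f x powr (1 / p)"
  have p0: "0 < p" using p by simp
  have homog: "?N (t *\<^sub>R x) = \<bar>t\<bar> * ?N x" for t x
    using p0 by (simp add: potential_scaleR powr_mult powr_powr potential_nonneg)
  have pos: "0 < potential p f x" if x: "x \<noteq> 0" for x
  proof -
    have "potential p f x \<noteq> 0"
    proof
      assume "potential p f x = 0"
      moreover have "AE u in ?s. 0 \<le> bracket x u powr p * f u" using f0 by eventually_elim simp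
      ultimately have "AE u in ?s. bracket x u powr p * f u = 0"
        unfolding potential_def by (subst (asm) integral_nonneg_eq_0_iff_AE[OF kernel_integrable]) auto
      moreover have "AE u in ?s. u \<notin> span {x}"
      proof (rule null_sphere_lowdim)
        have "dim {x} \<le> 1" using dim_le_card'[of "{x}"] by simp
        then show "dim (span {x}) < CARD('n)" using card by simp
        show "span {x} \<in> sets borel" by (intro borel_closed closed_subspace) simp
      qed simp
      ultimately have "AE u in ?s. f u = 0"
        using AE_space
      proof eventually_elim
        case (elim u)
        then have "bracket x u \<noteq> 0" using bracket_zero_imp_span[of u x] x by auto
        then show ?case using elim(1) by simp
      qed
      with nz show False by simp
    qed
    with potential_nonneg[of x] show ?thesis by simp
  qed
  define b where "b = (integral\<^sup>L ?s f) powr (1 / p)"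
  have upper: "?N x \<le> b * norm x" for x
  proof -
    have "potential p f x \<le> (\<integral>u. norm x powr p * f u \<partial>?s)"
      unfolding potential_def
    proof (rule integral_mono_AE)
      show "AE u in ?s. bracket x u powr p * f u \<le> norm x powr p * f u"
        using f0 AE_space by eventually_elim (use p in \<open>auto intro!: mult_right_mono bracket_powr_le_sphere\<close>)
    qed (use f kernel_integrable in auto)
    also have "\<dots> = norm x powr p * integral\<^sup>L ?s f" by simp
    finally have "?N x \<le> (norm x powr p * integral\<^sup>L ?s f) powr (1 / p)"
      using p0 potential_nonneg by (intro powr_mono2) auto
    also have "\<dots> = b * norm x"
      using p0 integral_nonneg_AE[OF f0] by (simp add: b_def powr_mult powr_powr mult.commute)
    finally show ?thesis .
  qed
  have subadd: "?N (x + y) \<le> ?N x + ?N y" for x y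
  proof (cases "x = 0 \<or> y = 0")
    case False
    then have N: "0 < ?N x" "0 < ?N y" using pos[of x] pos[of y] by auto
    define s where "s = ?N x + ?N y"
    have s: "0 < s" unfolding s_def using N by (rule add_pos_pos)
    have unit: "potential p f ((1 / ?N z) *\<^sub>R z) = 1" if "z \<noteq> 0" for z
      using pos[OF that] p0 by (simp add: potential_scaleR powr_divide powr_powr)
    have ab: "0 \<le> ?N x / s" "0 \<le> ?N y / s" "?N x / s + ?N y / s = 1"
      using N s by (auto simp: add_divide_distrib[symmetric]) (simp add: s_def)
    have "(1 / s) *\<^sub>R (x + y) = (?N x / s) *\<^sub>R ((1 / ?N x) *\<^sub>R x) + (?N y / s) *\<^sub>R ((1 / ?N y) *\<^sub>R y)"
      using N by (simp add: scaleR_add_right)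
    then have "potential p f ((1 / s) *\<^sub>R (x + y))
      = potential p f ((?N x / s) *\<^sub>R ((1 / ?N x) *\<^sub>R x) + (?N y / s) *\<^sub>R ((1 / ?N y) *\<^sub>R y))"
      by (rule arg_cong)
    also have "\<dots> \<le> ?N x / s * potential p f ((1 / ?N x) *\<^sub>R x) + ?N y / s * potential p f ((1 / ?N y) *\<^sub>R y)"
      by (rule potential_convex[OF ab])
    also have "\<dots> = 1" using unit[of x] unit[of y] False ab(3) by simp
    finally have "?N ((1 / s) *\<^sub>R (x + y)) \<le> 1 powr (1 / p)"
      using p0 potential_nonneg by (intro powr_mono2) auto
    then have "(1 / s) * ?N (x + y) \<le> 1" unfolding homog using s by simp
    then show ?thesis using s by (simp add: s_def field_simps)
  next
    case True
    have "?N 0 = 0" using homog[of 0 0] by simp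
    with True show ?thesis by auto
  qed
  obtain a where "norm_fn a b ?N"
    by (rule norm_fnI[of ?N b]) (use subadd homog upper pos in \<open>auto simp: b_def less_imp_neq[THEN not_sym]\<close>)
  then show thesis by (rule that)
qed

end

section \<open>The double integral as a symmetric bilinear form\<close>

definition bilin :: "real \<Rightarrow> (real^'n \<Rightarrow> real) \<Rightarrow> (real^'n \<Rightarrow> real) \<Rightarrow> real" where
  "bilin p f g = (\<integral>u. (\<integral>v. bracket u v powr p * f u * g v \<partial>sph) \<partial>sph)"

lemma bilin_eq_potential:
  "bilin p f g = (\<integral>u. f u * potential p g u \<partial>sphere_measure TYPE('n::finite))"
  unfolding bilin_def potential_def
  by (intro Bochner_Integration.integral_cong refl, subst integral_mult_right_zero[symmetric])
     (simp add: mult_ac)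

lemma bilin_integrable:
  fixes f g :: "real^'n \<Rightarrow> real"
  assumes p: "0 \<le> p" and f: "integrable sph f" and g: "integrable sph g"
  shows "integrable (sph \<Otimes>\<^sub>M sph) (\<lambda>(u, v). bracket u v powr p * f u * g v)"
proof -
  let ?s = "sphere_measure TYPE('n)"
  interpret S: finite_measure ?s by (rule finite_measure_sphere)
  interpret P: pair_sigma_finite ?s ?s by unfold_locales
  note [measurable] = borel_measurable_integrable[OF f] borel_measurable_integrable[OF g]
    measurable_ident_sphere measurable_fst_sphere measurable_snd_sphere
  have int: "integrable ?s (\<lambda>v. bracket u v powr p * f u * g v)" for u
    using integrable_mult_left[OF potential_integrable[OF p g, of u], of "f u"] by (simp add: mult_ac)
  show ?thesis
  proof (rule P.Fubini_integrable)
    show "(\<lambda>(u, v). bracket u v powr p * f u * g v) \<in> borel_measurable (?s \<Otimes>\<^sub>M ?s)" by measurable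
    show "AE u in ?s. integrable ?s (\<lambda>v. case (u, v) of (u, v) \<Rightarrow> bracket u v powr p * f u * g v)"
      using int by simp
    show "integrable ?s (\<lambda>u. \<integral>v. norm (case (u, v) of (u, v) \<Rightarrow> bracket u v powr p * f u * g v) \<partial>?s)"
    proof (rule Bochner_Integration.integrable_bound)
      show "integrable ?s (\<lambda>u. (\<integral>v. \<bar>g v\<bar> \<partial>?s) * \<bar>f u\<bar>)" using f by simp
      show "AE u in ?s. norm (\<integral>v. norm (case (u, v) of (u, v) \<Rightarrow> bracket u v powr p * f u * g v) \<partial>?s)
          \<le> norm ((\<integral>v. \<bar>g v\<bar> \<partial>?s) * \<bar>f u\<bar>)"
      proof (rule AE_I2)
        fix u assume u: "u \<in> space ?s"
        have "(\<integral>v. \<bar>bracket u v powr p * f u * g v\<bar> \<partial>?s) \<le> (\<integral>v. \<bar>g v\<bar> * \<bar>f u\<bar> \<partial>?s)"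
        proof (rule integral_mono)
          fix v assume v: "v \<in> space ?s"
          have "bracket u v powr p \<le> 1" using bracket_powr_le_sphere[OF p, of v u] u v by simp
          then have "bracket u v powr p * (\<bar>f u\<bar> * \<bar>g v\<bar>) \<le> 1 * (\<bar>f u\<bar> * \<bar>g v\<bar>)" by (intro mult_right_mono) auto
          then show "\<bar>bracket u v powr p * f u * g v\<bar> \<le> \<bar>g v\<bar> * \<bar>f u\<bar>" by (simp add: abs_mult mult_ac)
        qed (use int g in auto)
        moreover have "0 \<le> (\<integral>v. \<bar>bracket u v powr p * f u * g v\<bar> \<partial>?s)" by (intro integral_nonneg_AE) auto
        ultimately show "norm (\<integral>v. norm (case (u, v) of (u, v) \<Rightarrow> bracket u v powr p * f u * g v) \<partial>?s)
          \<le> norm ((\<integral>v. \<bar>g v\<bar> \<partial>?s) * \<bar>f u\<bar>)" by simp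
      qed
    qed measurable
  qed
qed

text \<open>In \<open>chain\<close> this moves the potential from one density to the other, so that
  the volume of \<open>N\<close> can be bounded by a second reverse Hoelder estimate.\<close>

lemma bilin_commute:
  fixes f g :: "real^'n \<Rightarrow> real"
  assumes p: "0 \<le> p" and f: "integrable sph f" and g: "integrable sph g"
  shows "bilin p f g = bilin p g f"
proof -
  let ?s = "sphere_measure TYPE('n)"
  interpret S: finite_measure ?s by (rule finite_measure_sphere)
  interpret P: pair_sigma_finite ?s ?s by unfold_locales
  have "bilin p f g = (\<integral>v. (\<integral>u. bracket u v powr p * f u * g v \<partial>?s) \<partial>?s)"
    unfolding bilin_def using P.Fubini_integral[OF bilin_integrable[OF assms]] by simp
  also have "\<dots> = bilin p g f"
    unfolding bilin_def by (simp add: bracket_commute mult_ac)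
  finally show ?thesis .
qed

lemma sph_energy_eq_bilin:
  fixes N M :: "real^'n \<Rightarrow> real"
  assumes p: "0 \<le> p" and N: "norm_fn a b N" and M: "norm_fn a' b' M"
  shows "sph_energy p N M = ennreal (bilin p (\<lambda>u. N u powr - (real CARD('n) + p)) (\<lambda>u. M u powr - (real CARD('n) + p)))"
proof -
  let ?s = "sphere_measure TYPE('n)"
  let ?f = "\<lambda>u. N u powr - (real CARD('n) + p)" and ?g = "\<lambda>u. M u powr - (real CARD('n) + p)"
  interpret S: finite_measure ?s by (rule finite_measure_sphere)
  interpret P: pair_sigma_finite ?s ?s by unfold_locales
  have fg: "integrable ?s ?f" "integrable ?s ?g"
    using p by (intro integrable_norm_fn_powr[OF N] integrable_norm_fn_powr[OF M]; simp)+
  have int: "integrable ?s (\<lambda>v. bracket u v powr p * ?f u * ?g v)" for u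
    using integrable_mult_left[OF potential_integrable[OF p fg(2), of u], of "?f u"] by (simp add: mult_ac)
  have "sph_energy p N M = (\<integral>\<^sup>+u. ennreal (\<integral>v. bracket u v powr p * ?f u * ?g v \<partial>?s) \<partial>?s)"
    unfolding sph_energy_def by (intro nn_integral_cong nn_integral_eq_integral int) auto
  also have "\<dots> = ennreal (bilin p ?f ?g)"
    unfolding bilin_def
  proof (rule nn_integral_eq_integral)
    show "integrable ?s (\<lambda>u. \<integral>v. bracket u v powr p * ?f u * ?g v \<partial>?s)"
      using P.integrable_fst'[OF bilin_integrable[OF p fg]] by simp
  qed (intro AE_I2 integral_nonneg_AE, auto)
  finally show ?thesis .
qed

section \<open>From densities to norms\<close>

lemma omega_pos: "0 \<le> s \<Longrightarrow> 0 < omega s"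
  unfolding omega_def by (intro divide_pos_pos Gamma_real_pos) auto

text \<open>The cancellation step of \<open>chain\<close>: a volume standing on both sides of an
  inequality is divided out.\<close>

lemma powr_one_minus:
  fixes A r c :: real
  assumes "0 < A" "c * A powr r \<le> A"
  shows "c \<le> A powr - (r - 1)"
proof -
  have "c * A powr r * A powr - r \<le> A * A powr - r" using assms by (intro mult_right_mono) auto
  moreover have "A powr r * A powr - r = 1" using assms(1) by (simp add: powr_add[symmetric])
  moreover have "A * A powr - r = A powr - (r - 1)" using assms(1) by (simp add: powr_diff powr_minus_divide)
  ultimately show ?thesis by (simp add: mult.assoc)
qed

text \<open>One predicate for both equality cases: for n >= 3 the matrix is the identity, and the
  densities are constant on the sphere.\<close>

definition elliptic_densities :: "real \<Rightarrow> (real^'n \<Rightarrow> real) \<Rightarrow> (real^'n \<Rightarrow> real) \<Rightarrow> bool" where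
  "elliptic_densities s f g \<longleftrightarrow> (\<exists>(\<phi> :: real^'n^'n) d1 d2. det \<phi> = 1 \<and> (CARD('n) = 2 \<or> \<phi> = mat 1) \<and> 0 < d1 \<and> 0 < d2 \<and>
     (AE u in sph. f u = d1 * norm (\<phi> *v u) powr - s) \<and> (AE u in sph. g u = d2 * norm (\<phi> *v u) powr - s))"

locale sphere_densities = F: sphere_density p f + G: sphere_density p g
  for p :: real and f g :: "real^'n \<Rightarrow> real" +
  fixes n r \<kappa> IF IG :: real
  assumes n_def: "n = real CARD('n)" and r_def: "r = (n + p) / n"
    and \<kappa>: "ball_energy TYPE('n) p = ennreal \<kappa>" "0 < \<kappa>"
    and IF_def: "IF = (\<integral>u. f u powr (n / (n + p)) \<partial>sph)"
    and IG_def: "IG = (\<integral>u. g u powr (n / (n + p)) \<partial>sph)"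
    and IF: "0 < IF" and IG: "0 < IG"
begin

lemma n: "0 < n" and p0: "0 < p" and r: "r - 1 = p / n"
proof -
  show "0 < n" by (simp add: n_def)
  then show "r - 1 = p / n" by (simp add: r_def field_simps)
  show "0 < p" using F.p by simp
qed

text \<open>The auxiliary volumes cancel one after the other, so no information about them is
  required beyond positivity. Equality in the conclusion makes every link an equality.\<close>

lemma chain:
  shows "\<kappa> * IF powr r * IG powr r \<le> bilin p f g"
    and "bilin p f g = \<kappa> * IF powr r * IG powr r \<Longrightarrow> elliptic_densities (n + p) f g"
proof -
  let ?s = "sphere_measure TYPE('n)"
  have s0: "0 \<le> n + p" using n p0 by simp
  have nzg: "\<not> (AE u in ?s. g u = 0)"
  proof
    assume "AE u in ?s. g u = 0"
    then have "AE u in ?s. g u powr (n / (n + p)) = 0" by eventually_elim simp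
    then have "IG = 0" unfolding IG_def by (rule integral_eq_zero_AE)
    with IG show False by simp
  qed
  define N where "N x = potential p g x powr (1 / p)" for x
  obtain a b where N: "norm_fn a b N" unfolding N_def by (rule G.potential_norm_fn[OF nzg])
  have Np: "N x powr p = potential p g x" for x
    using p0 G.potential_nonneg by (simp add: N_def powr_powr)
  define f1 where "f1 u = N u powr - (n + p)" for u
  have f1: "integrable ?s f1" unfolding f1_def by (rule integrable_norm_fn_powr[OF N s0])
  interpret F1: sphere_density p f1
    by unfold_locales (use F.p F.card f1 in \<open>auto simp: f1_def\<close>)
  have nzf1: "\<not> (AE u in ?s. f1 u = 0)"
  proof
    assume "AE u in ?s. f1 u = 0"
    then have "integral\<^sup>L ?s f1 = 0" by (intro integral_eq_zero_AE)
    then show False using integral_sphere_pos[OF N s0] by (simp add: f1_def[abs_def])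
  qed
  define M where "M x = potential p f1 x powr (1 / p)" for x
  obtain a' b' where M: "norm_fn a' b' M" unfolding M_def by (rule F1.potential_norm_fn[OF nzf1])
  have Mp: "M x powr p = potential p f1 x" for x
    using p0 F1.potential_nonneg by (simp add: M_def powr_powr)
  define g1 where "g1 u = M u powr - (n + p)" for u
  have g1: "integrable ?s g1" unfolding g1_def by (rule integrable_norm_fn_powr[OF M s0])
  define A C where "A = (\<integral>u. N u powr - n \<partial>?s)" and "C = (\<integral>u. M u powr - n \<partial>?s)"
  have A: "0 < A" and C: "0 < C"
    unfolding A_def C_def using n by (intro integral_sphere_pos[OF N] integral_sphere_pos[OF M]; simp)+
  have vA: "sph_vol N = ennreal A" and vC: "sph_vol M = ennreal C"
    unfolding A_def C_def n_def by (rule sph_vol_eq_integral[OF N], rule sph_vol_eq_integral[OF M])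
  have pp: "K u powr - (n + p) * K u powr p = K u powr - n" if "norm_fn c d K" "u \<in> space ?s" for K :: "real^'n \<Rightarrow> real" and c d u
  proof -
    have "u \<noteq> 0" using that(2) by auto
    then have "0 < K u" by (rule norm_fn.pos[OF that(1)])
    then show ?thesis by (simp add: powr_add[symmetric])
  qed
  have B1: "bilin p f g = (\<integral>u. f u * N u powr p \<partial>?s)"
    unfolding bilin_eq_potential Np ..
  \<comment> \<open>Because N^p is the potential of \<open>g\<close>, the product N^(-(n+p)) N^p is
    the volume density: \<open>A\<close> is both a volume and an energy.\<close>
  have B2: "A = bilin p f1 g"
    unfolding bilin_eq_potential Np[symmetric] f1_def A_def
    by (intro Bochner_Integration.integral_cong refl) (rule pp[OF N, symmetric])
  have B3: "A = (\<integral>u. g u * M u powr p \<partial>?s)"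
    unfolding Mp bilin_eq_potential[symmetric] B2 by (rule bilin_commute[OF less_imp_le[OF p0] f1 G.f])
  have B4: "C = bilin p g1 f1"
    unfolding bilin_eq_potential Mp[symmetric] g1_def C_def
    by (intro Bochner_Integration.integral_cong refl) (rule pp[OF M, symmetric])
  have B5: "sph_energy p N M = ennreal C"
    unfolding sph_energy_eq_bilin[OF less_imp_le[OF p0] N M] B4 bilin_commute[OF less_imp_le[OF p0] g1 f1]
    by (simp add: f1_def[abs_def] g1_def[abs_def] n_def)
  have Ar: "A powr - (p / n) = A powr - (r - 1)" "C powr - (p / n) = C powr - (r - 1)" by (simp_all add: r)
  note H1 = reverse_hoelder[OF p0 N F.f F.f0, folded n_def, folded A_def IF_def r_def, folded B1, unfolded Ar]
  note H2 = reverse_hoelder[OF p0 M G.f G.f0, folded n_def, folded C_def IG_def r_def, folded B3, unfolded Ar]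
  have "ennreal (A powr r * C powr r) * ennreal \<kappa> \<le> ennreal C"
    using sph_energy_ge[OF F.p N M F.card vA vC] A C unfolding \<kappa>(1) B5 r_def n_def by simp
  then have E': "(\<kappa> * A powr r) * C powr r \<le> C"
    using \<kappa>(2) C by (simp add: ennreal_mult[symmetric] mult_ac)
  \<comment> \<open>The bound for norms has \<open>C\<close> on both sides. Dividing by it,
    inserting the reverse Hoelder bound for \<open>g\<close>, dividing by \<open>A\<close> and
    inserting the bound for \<open>f\<close> gives the claim.\<close>
  have c1: "\<kappa> * A powr r \<le> C powr - (r - 1)" by (rule powr_one_minus[OF C E'])
  have c2: "(\<kappa> * IG powr r) * A powr r \<le> A"
    using mult_right_mono[OF c1, of "IG powr r"] H2(1) by (simp add: mult_ac)
  have c3: "\<kappa> * IG powr r \<le> A powr - (r - 1)" by (rule powr_one_minus[OF A c2])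
  have c4: "\<kappa> * IF powr r * IG powr r \<le> A powr - (r - 1) * IF powr r"
    using mult_right_mono[OF c3, of "IF powr r"] by (simp add: mult_ac)
  show "\<kappa> * IF powr r * IG powr r \<le> bilin p f g" using c4 H1(1) by linarith
  assume eq: "bilin p f g = \<kappa> * IF powr r * IG powr r"
  \<comment> \<open>Equality is traced back along the same links: \<open>e1\<close> determines
    \<open>f\<close> from \<open>N\<close>, \<open>e4\<close> determines \<open>g\<close> from
    \<open>M\<close>, and \<open>e6\<close> makes the pair of norms extremal.\<close>
  have e1: "A powr - (r - 1) * IF powr r = bilin p f g" using eq c4 H1(1) by linarith
  obtain d1 where d1: "0 < d1" "AE u in ?s. f u = d1 * N u powr - (n + p)"
    using H1(2)[OF e1 IF] by blast
  have "A powr - (r - 1) * IF powr r = \<kappa> * IG powr r * IF powr r" using e1 eq by (simp add: mult_ac)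
  then have e2: "A powr - (r - 1) = \<kappa> * IG powr r" using IF by simp
  have "A powr - (r - 1) * A powr r = A" using A by (simp add: powr_add[symmetric])
  then have e3: "A = \<kappa> * IG powr r * A powr r" unfolding e2 by simp
  have c5: "\<kappa> * A powr r * IG powr r \<le> C powr - (r - 1) * IG powr r"
    using c1 by (intro mult_right_mono) auto
  have e4: "C powr - (r - 1) * IG powr r = A"
    using c5 H2(1) e3 by (simp add: mult_ac)
  obtain d2 where d2: "0 < d2" "AE u in ?s. g u = d2 * M u powr - (n + p)"
    using H2(2)[OF e4 IG] by blast
  have "C powr - (r - 1) * IG powr r = \<kappa> * A powr r * IG powr r" using e3 e4 by (simp add: mult_ac)
  then have e5: "C powr - (r - 1) = \<kappa> * A powr r" using IG by simp
  have "C powr - (r - 1) * C powr r = C" using C by (simp add: powr_add[symmetric])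
  then have e6: "C = A powr r * C powr r * \<kappa>" unfolding e5 by (simp add: mult_ac)
  have "sph_energy p N M \<le> ennreal (A powr r * C powr r) * ball_energy TYPE('n) p"
    unfolding B5 \<kappa>(1) using e6 \<kappa>(2) by (simp add: ennreal_mult[symmetric])
  then have "stationary_pair a b a' b' N M p"
    using sph_energy_eq_imp[OF F.p N M F.card vA vC] A C by (simp add: r_def n_def)
  then interpret stationary_pair a b a' b' N M p .
  obtain \<phi> :: "real^'n^'n" and c c' where \<phi>: "det \<phi> = 1" "0 < c" "0 < c'" "CARD('n) = 2 \<or> \<phi> = mat 1"
    "N = (\<lambda>x. c * norm (\<phi> *v x))" "M = (\<lambda>x. c' * norm (\<phi> *v x))" by (rule rigid)
  have "AE u in ?s. f u = (d1 * c powr - (n + p)) * norm (\<phi> *v u) powr - (n + p)"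
    using d1(2) unfolding \<phi>(5) by (simp add: powr_mult mult.assoc)
  moreover have "AE u in ?s. g u = (d2 * c' powr - (n + p)) * norm (\<phi> *v u) powr - (n + p)"
    using d2(2) unfolding \<phi>(6) by (simp add: powr_mult mult.assoc)
  moreover have "0 < d1 * c powr - (n + p)" "0 < d2 * c' powr - (n + p)" using d1 d2 \<phi>(2,3) by simp_all
  ultimately show "elliptic_densities (n + p) f g"
    unfolding elliptic_densities_def using \<phi>(1,4) by blast
qed

text \<open>Changes on null sets affect neither potentials nor integrals, so \<open>f\<close> and
  \<open>g\<close> may be replaced by multiples of one elliptic density, whose energy and volume are
  those of the Euclidean ball.\<close>

lemma bilin_elliptic:
  fixes \<phi> :: "real^'n^'n"
  assumes \<phi>: "det \<phi> = 1" "CARD('n) = 2 \<or> \<phi> = mat 1" and d: "0 < d1" "0 < d2"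
    and f: "AE u in sph. f u = d1 * norm (\<phi> *v u) powr - (n + p)"
    and g: "AE u in sph. g u = d2 * norm (\<phi> *v u) powr - (n + p)"
  shows "bilin p f g = \<kappa> * IF powr r * IG powr r"
proof -
  let ?s = "sphere_measure TYPE('n)"
  define N where "N x = norm (\<phi> *v x)" for x
  obtain a b where N: "norm_fn a b N" using norm_fn_matrix[of \<phi>] \<phi>(1) unfolding N_def by auto
  have s0: "0 \<le> n + p" using n p0 by simp
  note [measurable] = norm_fn_measurable_sphere[OF N] borel_measurable_integrable[OF F.f] borel_measurable_integrable[OF G.f]
    measurable_bracket_sphere
  define h where "h u = N u powr - (n + p)" for u
  have h: "integrable ?s h" unfolding h_def by (rule integrable_norm_fn_powr[OF N s0])
  have fh: "AE u in ?s. f u = d1 * h u" and gh: "AE u in ?s. g u = d2 * h u"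
    using f g by (simp_all add: h_def N_def)
  note [measurable] = borel_measurable_integrable[OF h]
  have pot: "potential p g x = d2 * potential p h x" for x
  proof -
    have "potential p g x = (\<integral>u. d2 * (bracket x u powr p * h u) \<partial>?s)"
      unfolding potential_def
    proof (rule integral_cong_AE)
      show "AE u in ?s. bracket x u powr p * g u = d2 * (bracket x u powr p * h u)"
        using gh by eventually_elim simp
    qed measurable
    then show ?thesis unfolding potential_def by simp
  qed
  have potm: "potential p h \<in> borel_measurable ?s"
  proof -
    interpret S: sigma_finite_measure ?s by (rule sigma_finite_sphere)
    note [measurable] = measurable_ident_sphere measurable_fst_sphere measurable_snd_sphere
    show ?thesis unfolding potential_def[abs_def] by measurable
  qed
  note [measurable] = potm
  have "bilin p f g = (\<integral>u. (d1 * d2) * (h u * potential p h u) \<partial>?s)"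
    unfolding bilin_eq_potential pot
  proof (rule integral_cong_AE)
    show "AE u in ?s. f u * (d2 * potential p h u) = d1 * d2 * (h u * potential p h u)"
      using fh by eventually_elim simp
  qed measurable
  then have B: "bilin p f g = d1 * d2 * bilin p h h" unfolding bilin_eq_potential by simp
  note ell = elliptic_vol_energy[OF less_imp_le[OF p0] \<phi>, folded N_def]
  have "ennreal (bilin p h h) = ennreal \<kappa>"
    using ell(2) sph_energy_eq_bilin[OF less_imp_le[OF p0] N N] unfolding \<kappa>(1)
    by (simp add: h_def[abs_def] n_def N_def[abs_def])
  moreover have "0 \<le> bilin p h h"
    unfolding bilin_def by (intro integral_nonneg_AE AE_I2) (simp add: h_def)
  ultimately have Bh: "bilin p h h = \<kappa>" using \<kappa>(2) by simp
  have vol: "(\<integral>u. N u powr - n \<partial>?s) = 1"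
  proof -
    have "ennreal (\<integral>u. N u powr - n \<partial>?s) = 1"
      using ell(1) sph_vol_eq_integral[OF N] by (simp add: N_def[abs_def] n_def)
    then show ?thesis by (simp add: ennreal_eq_1)
  qed
  have I: "(\<integral>u. k u powr (n / (n + p)) \<partial>?s) powr r = d"
    if k: "AE u in ?s. k u = d * h u" "k \<in> borel_measurable ?s" and "0 < d" for k d
  proof -
    note [measurable] = k(2)
    have "(\<integral>u. k u powr (n / (n + p)) \<partial>?s) = (\<integral>u. d powr (n / (n + p)) * N u powr - n \<partial>?s)"
    proof (rule integral_cong_AE)
      show "AE u in ?s. k u powr (n / (n + p)) = d powr (n / (n + p)) * N u powr - n"
        using k(1)
      proof eventually_elim
        case (elim u)
        have "(n + p) * (n / (n + p)) = n" using n p0 by simp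
        then have "- (n + p) * (n / (n + p)) = - n" by (simp only: mult_minus_left)
        then show ?case unfolding elim h_def powr_mult powr_powr by simp
      qed
    qed measurable
    also have "\<dots> = d powr (n / (n + p))" using vol by simp
    \<comment> \<open>The exponent \<open>r\<close> is the reciprocal of n/(n+p), so the factor
      comes out with power 1.\<close>
    finally show ?thesis using \<open>0 < d\<close> n p0 by (simp add: powr_powr r_def)
  qed
  have "IF powr r = d1" "IG powr r = d2"
    unfolding IF_def IG_def by (rule I[OF fh _ d(1)], measurable) (rule I[OF gh _ d(2)], measurable)
  then show ?thesis unfolding B Bh by simp
qed

end

theorem theorem6p2:
  fixes p :: real and f g :: "real^'n \<Rightarrow> real"
  defines "\<sigma> \<equiv> sphere_measure TYPE('n)"
    and "n \<equiv> real CARD('n)"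
  assumes hp: "p \<ge> 1" and hn: "CARD('n) \<ge> 2"
    and hf: "integrable \<sigma> f" and hg: "integrable \<sigma> g"
    and hf0: "AE u in \<sigma>. f u \<ge> 0" and hg0: "AE u in \<sigma>. g u \<ge> 0"
  shows "(\<integral>u. (\<integral>v. bracket u v powr p * f u * g v \<partial>\<sigma>) \<partial>\<sigma>)
           \<ge> (n - 1) * omega (n - 1) * omega (n + p - 2) / (n * omega n * omega (n + p - 3))
             * sph_norm TYPE('n) (n / (n + p)) f * sph_norm TYPE('n) (n / (n + p)) g
    \<and> (CARD('n) = 2 \<longrightarrow>
         sph_norm TYPE('n) (n / (n + p)) f * sph_norm TYPE('n) (n / (n + p)) g > 0 \<longrightarrow>
         ((\<integral>u. (\<integral>v. bracket u v powr p * f u * g v \<partial>\<sigma>) \<partial>\<sigma>)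
           = (n - 1) * omega (n - 1) * omega (n + p - 2) / (n * omega n * omega (n + p - 3))
             * sph_norm TYPE('n) (n / (n + p)) f * sph_norm TYPE('n) (n / (n + p)) g
          \<longleftrightarrow> (\<exists>\<phi> :: real^'n^'n. \<exists>d1 d2. det \<phi> = 1 \<and> d1 > 0 \<and> d2 > 0 \<and>
                 (AE u in \<sigma>. f u = d1 * norm (\<phi> *v u) powr (- 2 - p)) \<and>
                 (AE u in \<sigma>. g u = d2 * norm (\<phi> *v u) powr (- 2 - p)))))
    \<and> (CARD('n) \<ge> 3 \<longrightarrow>
         sph_norm TYPE('n) (n / (n + p)) f * sph_norm TYPE('n) (n / (n + p)) g > 0 \<longrightarrow>
         ((\<integral>u. (\<integral>v. bracket u v powr p * f u * g v \<partial>\<sigma>) \<partial>\<sigma>)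
           = (n - 1) * omega (n - 1) * omega (n + p - 2) / (n * omega n * omega (n + p - 3))
             * sph_norm TYPE('n) (n / (n + p)) f * sph_norm TYPE('n) (n / (n + p)) g
          \<longleftrightarrow> (\<exists>d3 d4. d3 > 0 \<and> d4 > 0 \<and>
                 (AE u in \<sigma>. f u = d3) \<and> (AE u in \<sigma>. g u = d4))))"
proof -
  define \<kappa> where "\<kappa> = (n - 1) * omega (n - 1) * omega (n + p - 2) / (n * omega n * omega (n + p - 3))"
  define IF IG where "IF = (\<integral>u. f u powr (n / (n + p)) \<partial>\<sigma>)" and "IG = (\<integral>u. g u powr (n / (n + p)) \<partial>\<sigma>)"
  define r where "r = (n + p) / n"
  have n: "2 \<le> n" using hn by (simp add: n_def)
  have \<kappa>: "0 < \<kappa>"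
    unfolding \<kappa>_def using n hp by (intro divide_pos_pos mult_pos_pos omega_pos) auto
  have ball: "ball_energy TYPE('n) p = ennreal \<kappa>"
    unfolding \<kappa>_def n_def by (rule ball_energy_eq[OF hn hp])
  have nf: "sph_norm TYPE('n) (n / (n + p)) f = IF powr r" and ng: "sph_norm TYPE('n) (n / (n + p)) g = IG powr r"
    by (simp_all add: sph_norm_def IF_def IG_def r_def \<sigma>_def)
  have B: "(\<integral>u. (\<integral>v. bracket u v powr p * f u * g v \<partial>\<sigma>) \<partial>\<sigma>) = bilin p f g"
    by (simp add: bilin_def \<sigma>_def)
  interpret F: sphere_density p f by standard (use hp hn hf[unfolded \<sigma>_def] hf0[unfolded \<sigma>_def] in simp_all)
  interpret G: sphere_density p g by standard (use hp hn hg[unfolded \<sigma>_def] hg0[unfolded \<sigma>_def] in simp_all)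
  have I0: "0 \<le> IF" "0 \<le> IG" unfolding IF_def IG_def by (intro integral_nonneg_AE; simp)+
  have dens: "sphere_densities p f g n r \<kappa> IF IG" if "0 < IF" "0 < IG"
    by unfold_locales (use ball \<kappa> that in \<open>simp_all add: IF_def IG_def n_def r_def \<sigma>_def\<close>)
  have ineq: "\<kappa> * IF powr r * IG powr r \<le> bilin p f g"
  proof (cases "0 < IF \<and> 0 < IG")
    case True
    then show ?thesis using sphere_densities.chain(1)[OF dens] by simp
  next
    case False
    \<comment> \<open>If one of the two integrals vanishes, the right-hand side is 0 and
      nonnegativity suffices; the potential of a density that is zero almost everywhere would not be
      a norm.\<close>
    have "0 \<le> bilin p f g"
      unfolding bilin_eq_potential using F.f0 G.potential_nonneg
      by (intro integral_nonneg_AE) (auto elim!: eventually_mono)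
    moreover have "IF = 0 \<or> IG = 0" using False I0 by auto
    ultimately show ?thesis by auto
  qed
  have eq: "bilin p f g = \<kappa> * IF powr r * IG powr r \<longleftrightarrow> elliptic_densities (n + p) f g"
    if pos: "0 < IF powr r * IG powr r"
  proof -
    have "0 < IF" "0 < IG" using I0 pos by (auto simp: less_le)
    then interpret sphere_densities p f g n r \<kappa> IF IG by (rule dens)
    show ?thesis
      using chain(2) bilin_elliptic unfolding elliptic_densities_def by blast
  qed
  have two: "elliptic_densities (n + p) f g \<longleftrightarrow>
      (\<exists>\<phi> :: real^'n^'n. \<exists>d1 d2. det \<phi> = 1 \<and> d1 > 0 \<and> d2 > 0 \<and>
        (AE u in \<sigma>. f u = d1 * norm (\<phi> *v u) powr (- 2 - p)) \<and>
        (AE u in \<sigma>. g u = d2 * norm (\<phi> *v u) powr (- 2 - p)))" if "CARD('n) = 2"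
  proof -
    have "- (n + p) = - 2 - p" using that by (simp add: n_def)
    then show ?thesis using that by (simp only: elliptic_densities_def \<sigma>_def simp_thms)
  qed
  have three: "elliptic_densities (n + p) f g \<longleftrightarrow>
      (\<exists>d3 d4. d3 > 0 \<and> d4 > 0 \<and> (AE u in \<sigma>. f u = d3) \<and> (AE u in \<sigma>. g u = d4))" if "3 \<le> CARD('n)"
  proof -
    \<comment> \<open>Almost every \<open>u\<close> is a unit vector of the sphere, where the power
      of the norm is 1.\<close>
    have const: "(AE u in \<sigma>. h u = d * norm ((mat 1 :: real^'n^'n) *v u) powr - (n + p)) \<longleftrightarrow> (AE u in \<sigma>. h u = d)" for h d
      by (rule AE_cong) (simp add: \<sigma>_def)
    have "CARD('n) \<noteq> 2" using that by simp
    then have "elliptic_densities (n + p) f g \<longleftrightarrow> (\<exists>d1 d2. 0 < d1 \<and> 0 < d2 \<and>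
        (AE u in \<sigma>. f u = d1 * norm ((mat 1 :: real^'n^'n) *v u) powr - (n + p)) \<and>
        (AE u in \<sigma>. g u = d2 * norm ((mat 1 :: real^'n^'n) *v u) powr - (n + p)))"
      unfolding elliptic_densities_def \<sigma>_def using det_I[where 'a = real and 'n = 'n] by blast
    then show ?thesis by (simp only: const)
  qed
  show ?thesis
    unfolding B nf ng \<kappa>_def[symmetric]
  proof (intro conjI impI)
    show "\<kappa> * IF powr r * IG powr r \<le> bilin p f g" by (rule ineq)
  next
    assume "CARD('n) = 2" "0 < IF powr r * IG powr r"
    then show "bilin p f g = \<kappa> * IF powr r * IG powr r \<longleftrightarrow>
        (\<exists>\<phi> :: real^'n^'n. \<exists>d1 d2. det \<phi> = 1 \<and> d1 > 0 \<and> d2 > 0 \<and>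
        (AE u in \<sigma>. f u = d1 * norm (\<phi> *v u) powr (- 2 - p)) \<and>
        (AE u in \<sigma>. g u = d2 * norm (\<phi> *v u) powr (- 2 - p)))"
      by (rule trans[OF eq two, rotated])
  next
    assume "3 \<le> CARD('n)" "0 < IF powr r * IG powr r"
    then show "bilin p f g = \<kappa> * IF powr r * IG powr r \<longleftrightarrow>
        (\<exists>d3 d4. d3 > 0 \<and> d4 > 0 \<and> (AE u in \<sigma>. f u = d3) \<and> (AE u in \<sigma>. g u = d4))"
      by (rule trans[OF eq three, rotated])
  qed
qed

end
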